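(* Let $S$ be a surface with a smooth Riemannian metric $g$ and let $s_0\in S$. Suppose that the geodesic flow of $g$ admits a fractional-linear integral in a neighborhood of $s_0$. Then the dimension of the space of fractional-linear integrals (near $s_0$) is $5$ if and only if the gaussian curvature $K$ of $g$ is constant (near $s_0$, i.e. $K$ is constant on some neighborhood of $s_0$).
   Context: Everything is local and smooth. Let $(x,y)$ be local coordinates on $S$ and $p,q$ the conjugate momenta on $T^*S$ with the symplectic form $dp\wedge dx+dq\wedge dy$. In conformal coordinates $g=\Lambda(x,y)(dx^2+dy^2)$ the geodesic flow is the Hamiltonian flow of $H=\dfrac{p^2+q^2}{2\Lambda}$. A fractional-linear integral near $s_0$ is a function $$I=\frac{A(x,y)p+B(x,y)q}{C(x,y)p+E(x,y)q}$$ with smooth real functions $A,B,C,E$ defined in a neighborhood of $s_0$, with $AE-BC$ nowhere zero, such that the Poisson bracket $\{I,H\}$ vanishes identically wherever $Cp+Eq\neq 0$. It is normalized if $AE-BC=1$ (this can be achieved by multiplying numerator and denominator by a common function, after replacing $I$ by $-I$ if necessary). Dimension of the space of integrals near $s_0$: let $\mathcal J$ be the set of all $1$-jets at $s_0$ of the coefficient quadruples $(A,B,C,E)$, $AE-BC=1$, of germs at $s_0$ of normalized fractional-linear integrals; $\mathcal J$ is a subset of the finite-dimensional vector space of $1$-jets at $s_0$ of maps to $\mathbb R^4$. The space of fractional-linear integrals has dimension $d$ if $\mathcal J$ is a $d$-dimensional embedded submanifold of this jet space. *)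

theory Defs
  imports "HOL-Analysis.Analysis"
begin

section \<open>Smooth maps and embedded submanifolds\<close>

text \<open>The two predicates below are meant for open sets only.\<close>

primrec Ck_on :: "nat \<Rightarrow> 'a::real_normed_vector set \<Rightarrow> ('a \<Rightarrow> 'b::real_normed_vector) \<Rightarrow> bool" where
  "Ck_on 0 U f \<longleftrightarrow> continuous_on U f"
| "Ck_on (Suc k) U f \<longleftrightarrow>
     (\<forall>x\<in>U. f differentiable (at x)) \<and> (\<forall>v. Ck_on k U (\<lambda>x. frechet_derivative f (at x) v))"

definition smooth_on :: "'a::real_normed_vector set \<Rightarrow> ('a \<Rightarrow> 'b::real_normed_vector) \<Rightarrow> bool" where
  "smooth_on U f \<longleftrightarrow> (\<forall>k. Ck_on k U f)"

text \<open>
  Embedded submanifolds through slice charts of the ambient space: near each of its points,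
  \<open>M\<close> is mapped onto an open piece of a \<open>d\<close>-dimensional linear subspace by a diffeomorphism
  \<open>\<phi>\<close> between open sets, with inverse \<open>\<psi>\<close>. As usual, the empty set counts as a
  submanifold of every dimension; for nonempty \<open>M\<close> the number \<open>d\<close> is unique.
\<close>

definition embedded_submanifold :: "nat \<Rightarrow> 'a::euclidean_space set \<Rightarrow> bool" where
  "embedded_submanifold d M \<longleftrightarrow>
     (\<forall>z\<in>M. \<exists>W W' T. \<exists>\<phi> :: 'a \<Rightarrow> 'a. \<exists>\<psi> :: 'a \<Rightarrow> 'a.
        open W \<and> z \<in> W \<and> open W' \<and> subspace T \<and> dim T = d \<and>
        smooth_on W \<phi> \<and> smooth_on W' \<psi> \<and> \<phi> ` W = W' \<and> \<psi> ` W' = W \<and>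
        (\<forall>w\<in>W. \<psi> (\<phi> w) = w) \<and> (\<forall>w\<in>W'. \<phi> (\<psi> w) = w) \<and>
        \<phi> ` (M \<inter> W) = T \<inter> W')"


section \<open>Riemannian metrics in local coordinates\<close>

text \<open>
  A coordinate domain of the surface is an open set \<open>U\<close> of \<^typ>\<open>real^2\<close>, a point \<open>s\<close> having the
  coordinates \<open>x = s $ 1\<close> and \<open>y = s $ 2\<close>. The metric is given by its Gram matrix \<open>g s\<close> in
  these coordinates, which need not be conformal.
\<close>

definition riemannian_metric_on :: "(real^2) set \<Rightarrow> (real^2 \<Rightarrow> real^2^2) \<Rightarrow> bool" where
  "riemannian_metric_on U g \<longleftrightarrow>
     smooth_on U g \<and>
     (\<forall>s\<in>U. transpose (g s) = g s \<and> (\<forall>v. v \<noteq> 0 \<longrightarrow> v \<bullet> (g s *v v) > 0))"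

definition pd :: "2 \<Rightarrow> (real^2 \<Rightarrow> 'b::real_normed_vector) \<Rightarrow> real^2 \<Rightarrow> 'b" where
  "pd i f s = frechet_derivative f (at s) (axis i 1)"

text \<open>\<open>christoffel g k i j s\<close> is $\Gamma^k_{ij}(s)$.\<close>

definition christoffel :: "(real^2 \<Rightarrow> real^2^2) \<Rightarrow> 2 \<Rightarrow> 2 \<Rightarrow> 2 \<Rightarrow> real^2 \<Rightarrow> real" where
  "christoffel g k i j s =
     (\<Sum>l\<in>UNIV. matrix_inv (g s) $ k $ l *
        (pd i (\<lambda>t. g t $ j $ l) s + pd j (\<lambda>t. g t $ i $ l) s - pd l (\<lambda>t. g t $ i $ j) s)) / 2"

text \<open>
  \<open>riemann g l k i j s\<close> is the \<open>l\<close>-th component of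
  $R(\partial_i,\partial_j)\partial_k$, with the convention
  $R(X,Y) = \nabla_X\nabla_Y - \nabla_Y\nabla_X - \nabla_{[X,Y]}$.
\<close>

definition riemann :: "(real^2 \<Rightarrow> real^2^2) \<Rightarrow> 2 \<Rightarrow> 2 \<Rightarrow> 2 \<Rightarrow> 2 \<Rightarrow> real^2 \<Rightarrow> real" where
  "riemann g l k i j s =
     pd i (christoffel g l j k) s - pd j (christoffel g l i k) s +
     (\<Sum>m\<in>UNIV. christoffel g l i m s * christoffel g m j k s
              - christoffel g l j m s * christoffel g m i k s)"

text \<open>
  $K = \langle R(\partial_1,\partial_2)\partial_2,\partial_1\rangle / \det g$,
  which is positive for the round sphere.
\<close>

definition gaussian_curvature :: "(real^2 \<Rightarrow> real^2^2) \<Rightarrow> real^2 \<Rightarrow> real" where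
  "gaussian_curvature g s = (\<Sum>l\<in>UNIV. g s $ 1 $ l * riemann g l 2 1 2 s) / det (g s)"


section \<open>The geodesic flow and its fractional-linear integrals\<close>

text \<open>
  Points of the cotangent bundle are pairs \<open>(s, m)\<close> of a base point and a momentum, with
  \<open>p = m $ 1\<close> and \<open>q = m $ 2\<close>. The Poisson bracket is that of the form
  $dp\wedge dx + dq\wedge dy$; the other sign convention would only change its sign.
\<close>

definition poisson ::
  "((real^2) \<times> (real^2) \<Rightarrow> real) \<Rightarrow> ((real^2) \<times> (real^2) \<Rightarrow> real) \<Rightarrow> (real^2) \<times> (real^2) \<Rightarrow> real" where
  "poisson F G z =
     (\<Sum>i\<in>UNIV.
        frechet_derivative F (at z) (0, axis i 1) * frechet_derivative G (at z) (axis i 1, 0)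
      - frechet_derivative F (at z) (axis i 1, 0) * frechet_derivative G (at z) (0, axis i 1))"

definition geodesic_hamiltonian :: "(real^2 \<Rightarrow> real^2^2) \<Rightarrow> (real^2) \<times> (real^2) \<Rightarrow> real" where
  "geodesic_hamiltonian g = (\<lambda>(s, m). (m \<bullet> (matrix_inv (g s) *v m)) / 2)"

lemma geodesic_hamiltonian_conformal:
  fixes \<Lambda> :: "real^2 \<Rightarrow> real"
  assumes "\<Lambda> s \<noteq> 0"
  shows "geodesic_hamiltonian (\<lambda>t. mat (\<Lambda> t)) (s, m) = ((m $ 1)\<^sup>2 + (m $ 2)\<^sup>2) / (2 * \<Lambda> s)"
proof -
  have mm: "mat a ** mat b = (mat (a * b) :: real^2^2)" for a b :: real
    by (simp add: matrix_matrix_mult_def mat_def vec_eq_iff sum_2 forall_2)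
  have "matrix_inv (mat (\<Lambda> s)) = (mat (1 / \<Lambda> s) :: real^2^2)"
    unfolding matrix_inv_def
  proof (rule some_equality)
    fix N :: "real^2^2"
    assume "mat (\<Lambda> s) ** N = mat 1 \<and> N ** mat (\<Lambda> s) = mat 1"
    then have "mat (1 / \<Lambda> s) ** (mat (\<Lambda> s) ** N) = mat (1 / \<Lambda> s)"
      by simp
    then show "N = mat (1 / \<Lambda> s)"
      using assms by (simp add: matrix_mul_assoc mm)
  qed (use assms in \<open>simp add: mm\<close>)
  then show ?thesis
    by (simp add: geodesic_hamiltonian_def inner_vec_def sum_2 matrix_vector_mult_def mat_def
        power2_eq_square add_divide_distrib)
qed

definition fractional_linear ::
  "(real^2 \<Rightarrow> real) \<Rightarrow> (real^2 \<Rightarrow> real) \<Rightarrow> (real^2 \<Rightarrow> real) \<Rightarrow> (real^2 \<Rightarrow> real)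
     \<Rightarrow> (real^2) \<times> (real^2) \<Rightarrow> real" where
  "fractional_linear A B C E = (\<lambda>(s, m). (A s * m $ 1 + B s * m $ 2) / (C s * m $ 1 + E s * m $ 2))"

definition fractional_linear_integral_on ::
  "(real^2) set \<Rightarrow> (real^2 \<Rightarrow> real^2^2)
     \<Rightarrow> (real^2 \<Rightarrow> real) \<Rightarrow> (real^2 \<Rightarrow> real) \<Rightarrow> (real^2 \<Rightarrow> real) \<Rightarrow> (real^2 \<Rightarrow> real) \<Rightarrow> bool" where
  "fractional_linear_integral_on V g A B C E \<longleftrightarrow>
     smooth_on V A \<and> smooth_on V B \<and> smooth_on V C \<and> smooth_on V E \<and>
     (\<forall>s\<in>V. A s * E s - B s * C s \<noteq> 0) \<and>
     (\<forall>s\<in>V. \<forall>m. C s * m $ 1 + E s * m $ 2 \<noteq> 0 \<longrightarrow>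
        poisson (fractional_linear A B C E) (geodesic_hamiltonian g) (s, m) = 0)"

definition normalized_on ::
  "(real^2) set \<Rightarrow> (real^2 \<Rightarrow> real) \<Rightarrow> (real^2 \<Rightarrow> real) \<Rightarrow> (real^2 \<Rightarrow> real) \<Rightarrow> (real^2 \<Rightarrow> real) \<Rightarrow> bool" where
  "normalized_on V A B C E \<longleftrightarrow> (\<forall>s\<in>V. A s * E s - B s * C s = 1)"


section \<open>The space of integrals near a point\<close>

text \<open>
  The 1-jet at \<open>s\<close> of a map to \<^typ>\<open>real^4\<close> is its value together with its two partial
  derivatives; the space of these jets has dimension 12.
\<close>

definition jet1 :: "real^2 \<Rightarrow> (real^2 \<Rightarrow> real^4) \<Rightarrow> (real^4) \<times> ((real^4)^2)" where
  "jet1 s F = (F s, \<chi> i. pd i F s)"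

definition integral_jets :: "(real^2) set \<Rightarrow> (real^2 \<Rightarrow> real^2^2) \<Rightarrow> real^2 \<Rightarrow> ((real^4) \<times> ((real^4)^2)) set" where
  "integral_jets U g s\<^sub>0 =
     {jet1 s\<^sub>0 (\<lambda>s. vector [A s, B s, C s, E s]) | A B C E.
        \<exists>V. open V \<and> s\<^sub>0 \<in> V \<and> V \<subseteq> U \<and>
            fractional_linear_integral_on V g A B C E \<and> normalized_on V A B C E}"

definition integrals_have_dim :: "(real^2) set \<Rightarrow> (real^2 \<Rightarrow> real^2^2) \<Rightarrow> real^2 \<Rightarrow> nat \<Rightarrow> bool" where
  "integrals_have_dim U g s\<^sub>0 d \<longleftrightarrow> embedded_submanifold d (integral_jets U g s\<^sub>0)"

end

theory Submission
  imports Defs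
begin

text \<open>
  Let \<open>X = A p + B q\<close> and \<open>Y = C p + E q\<close>. The bracket of \<open>X / Y\<close> with the Hamiltonian \<open>H\<close>
  vanishes if and only if $Y\{X,H\} = X\{Y,H\}$, so that $\{X,H\}$ and $\{Y,H\}$ are the products
  of \<open>X\<close> and of \<open>Y\<close> with one and the same linear form. For the covectors $\xi$ that correspond
  to \<open>X\<close> and to \<open>Y\<close> under the metric this means
  $\nabla_i \xi_k = \alpha_i \xi_k + \beta_k \xi_i$ with common $\alpha$ and $\beta$
  (\<open>bracket_condition_splits\<close>). If the integral is normalized, then
  $2\alpha + \beta = d \log\sqrt{\det g}$, and the 1-jet at \<open>s0\<close> is determined by a unimodular
  matrix, the values of \<open>A\<close>, \<open>B\<close>, \<open>C\<close>, \<open>E\<close>, and by the value of $\beta$. Thus all jets lie in a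
  manifold \<open>N\<close> of dimension 5, which is a copy of the product of \<open>SL(2)\<close> with a plane. The
  question is which values $\beta(s_0)$ occur.

  The symmetry of the second derivatives of $\xi$ gives
  $\nabla_{(i}\beta_{k)} = \beta_i\beta_k + K g_{ik}$ (\<open>integral_formI\<close>). Two more
  integrability conditions, one for $\beta$ and one for $w$ with $d\beta = 2 w\, dx\wedge dy$,
  express $w^2$ as an affine function of $\beta$; the derivative of this relation along the
  gradient of \<open>K\<close> no longer contains $w$ and says that
  $15 \langle \det g\,\nabla K, \beta\rangle^2$ equals an affine function of $\beta$ whose
  coefficients depend on the metric only (\<open>integral_form_quadratic\<close>).

  If the jets form a 5-dimensional submanifold, then they contain an open piece of \<open>N\<close>, by
  invariance of domain. Hence there are four integrals such that one of the four values
  $\beta(s_0)$ lies inside the triangle of the other three. This persists at the points near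
  \<open>s0\<close>, and at each of them the quadratic relation forces $dK = 0$
  (\<open>square_plus_affine_zero\<close>). So \<open>K\<close> is locally constant.

  Conversely, if \<open>K\<close> is constant, then the Killing equation prolongs to a flat linear system of
  rank 3, which has a solution for every initial value (\<open>flat_linear_system\<close>). The normalized
  quotients of Killing forms realize every point of \<open>N\<close>, and \<open>N\<close> is an embedded submanifold
  because left multiplication trivializes it.
\<close>

section \<open>Calculus of smooth maps\<close>

lemma Ck_on_subset: "Ck_on k U f \<Longrightarrow> V \<subseteq> U \<Longrightarrow> Ck_on k V f"
  by (induction k arbitrary: f) (auto intro: continuous_on_subset)

lemma smooth_on_subset: "smooth_on U f \<Longrightarrow> V \<subseteq> U \<Longrightarrow> smooth_on V f"
  unfolding smooth_on_def using Ck_on_subset by blast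

lemma Ck_on_SucD: "Ck_on (Suc k) U f \<Longrightarrow> Ck_on k U f"
proof (induction k arbitrary: f)
  case 0
  then show ?case
    by (simp add: differentiable_at_imp_differentiable_on differentiable_imp_continuous_on)
next
  case (Suc k)
  have "\<forall>x\<in>U. f differentiable (at x)"
    and "\<And>v. Ck_on (Suc k) U (\<lambda>x. frechet_derivative f (at x) v)"
    using Suc.prems[unfolded Ck_on.simps(2)[of "Suc k"]] by blast+
  then show ?case unfolding Ck_on.simps(2)[of k U f] using Suc.IH by blast
qed

lemma Ck_on_SucE:
  assumes "Ck_on (Suc k) U f" "x \<in> U"
  shows "(f has_derivative frechet_derivative f (at x)) (at x)"
  using assms by (auto simp: frechet_derivative_works[symmetric])

lemma Ck_on_cong:
  assumes "open U" "\<And>x. x \<in> U \<Longrightarrow> f x = g x" "Ck_on k U f"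
  shows "Ck_on k U g"
  using assms(2,3)
proof (induction k arbitrary: f g)
  case 0
  then show ?case by (auto cong: continuous_on_cong)
next
  case (Suc k)
  have d: "(g has_derivative frechet_derivative f (at x)) (at x)" if "x \<in> U" for x
    by (rule has_derivative_transform_within_open[OF Ck_on_SucE[OF Suc.prems(2) that] \<open>open U\<close> that])
       (rule Suc.prems(1))
  then have "frechet_derivative f (at x) = frechet_derivative g (at x)" if "x \<in> U" for x
    using frechet_derivative_at that by blast
  then have "Ck_on k U (\<lambda>x. frechet_derivative g (at x) v)" for v
    using Suc.prems(2) by (rule_tac Suc.IH[of "\<lambda>x. frechet_derivative f (at x) v"]) auto
  then show ?case
    using d by (auto simp: differentiable_def)
qed

lemma Ck_on_SucI:
  assumes "open U" "\<And>x. x \<in> U \<Longrightarrow> (f has_derivative f' x) (at x)"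
    "\<And>v. Ck_on k U (\<lambda>x. f' x v)"
  shows "Ck_on (Suc k) U f"
proof -
  have "f' x = frechet_derivative f (at x)" if "x \<in> U" for x
    using assms(2)[OF that] frechet_derivative_at by blast
  then have "Ck_on k U (\<lambda>x. frechet_derivative f (at x) v)" for v
    using assms(3)[of v] by (intro Ck_on_cong[OF \<open>open U\<close> _ assms(3)[of v]]) auto
  then show ?thesis using assms(2) by (auto simp: differentiable_def)
qed

lemma Ck_on_const: "open U \<Longrightarrow> Ck_on k U (\<lambda>x. c)"
proof (induction k arbitrary: c)
  case (Suc k)
  show ?case
    by (rule Ck_on_SucI[OF \<open>open U\<close>, where f' = "\<lambda>x v. 0"]) (use Suc in auto)
qed simp

lemma Ck_on_linear:
  assumes "open U" "bounded_linear L"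
  shows "Ck_on k U f \<Longrightarrow> Ck_on k U (\<lambda>x. L (f x))"
proof (induction k arbitrary: f)
  case 0
  then show ?case using assms by (auto intro: bounded_linear.continuous_on)
next
  case (Suc k)
  show ?case
    by (rule Ck_on_SucI[OF \<open>open U\<close>, where f' = "\<lambda>x v. L (frechet_derivative f (at x) v)"])
       (use Suc assms Ck_on_SucE[OF Suc.prems] in \<open>auto intro: bounded_linear.has_derivative\<close>)
qed

lemma Ck_on_ident: "open U \<Longrightarrow> Ck_on k U (\<lambda>x. x)"
proof (cases k)
  case (Suc n)
  assume U: "open U"
  show ?thesis unfolding Suc
    by (rule Ck_on_SucI[OF U, where f' = "\<lambda>x v. v"]) (use U in \<open>auto intro: Ck_on_const\<close>)
qed simp

lemma Ck_on_add:
  assumes "open U"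
  shows "Ck_on k U f \<Longrightarrow> Ck_on k U g \<Longrightarrow> Ck_on k U (\<lambda>x. f x + g x)"
proof (induction k arbitrary: f g)
  case 0
  then show ?case by (auto intro: continuous_intros)
next
  case (Suc k)
  show ?case
    by (rule Ck_on_SucI[OF \<open>open U\<close>,
          where f' = "\<lambda>x v. frechet_derivative f (at x) v + frechet_derivative g (at x) v"])
       (use Suc Ck_on_SucE[OF Suc.prems(1)] Ck_on_SucE[OF Suc.prems(2)] in \<open>auto intro: derivative_intros\<close>)
qed

lemma Ck_on_bilinear:
  assumes "open U" "bounded_bilinear pr"
  shows "Ck_on k U f \<Longrightarrow> Ck_on k U g \<Longrightarrow> Ck_on k U (\<lambda>x. pr (f x) (g x))"
proof (induction k arbitrary: f g)
  case 0
  then show ?case using bounded_bilinear.continuous_on[OF assms(2)] by auto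
next
  case (Suc k)
  have "Ck_on k U f" "Ck_on k U g"
    using Suc.prems Ck_on_SucD by blast+
  then have "Ck_on k U (\<lambda>x. pr (f x) (frechet_derivative g (at x) v) +
                            pr (frechet_derivative f (at x) v) (g x))" for v
    using Suc by (intro Ck_on_add[OF \<open>open U\<close>] Suc.IH) auto
  then show ?case
    using bounded_bilinear.FDERIV[OF assms(2) Ck_on_SucE[OF Suc.prems(1)] Ck_on_SucE[OF Suc.prems(2)]]
    by (intro Ck_on_SucI[OF \<open>open U\<close>, where f' = "\<lambda>x v. pr (f x) (frechet_derivative g (at x) v) +
                            pr (frechet_derivative f (at x) v) (g x)"])
qed

lemma Ck_on_inverse:
  fixes f :: "'a::real_normed_vector \<Rightarrow> real"
  assumes "open U" "\<And>x. x \<in> U \<Longrightarrow> f x \<noteq> 0"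
  shows "Ck_on k U f \<Longrightarrow> Ck_on k U (\<lambda>x. inverse (f x))"
proof (induction k)
  case 0
  then show ?case using assms by (auto intro: continuous_intros)
next
  case (Suc k)
  have "Ck_on k U (\<lambda>x. inverse (f x))"
    using Suc Ck_on_SucD by blast
  then have "Ck_on k U (\<lambda>x. - (inverse (f x) * frechet_derivative f (at x) v * inverse (f x)))" for v
    using Suc.prems by (intro Ck_on_linear[OF \<open>open U\<close> bounded_linear_minus[OF bounded_linear_ident]]
        Ck_on_bilinear[OF \<open>open U\<close> bounded_bilinear_mult]) auto
  then show ?case
    using assms Ck_on_SucE[OF Suc.prems]
    by (intro Ck_on_SucI[OF \<open>open U\<close>, where
          f' = "\<lambda>x v. - (inverse (f x) * frechet_derivative f (at x) v * inverse (f x))"])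
       (auto intro!: has_derivative_inverse)
qed

lemma Ck_on_sqrt:
  fixes f :: "'a::real_normed_vector \<Rightarrow> real"
  assumes "open U" "\<And>x. x \<in> U \<Longrightarrow> f x > 0"
  shows "Ck_on k U f \<Longrightarrow> Ck_on k U (\<lambda>x. sqrt (f x))"
proof (induction k)
  case 0
  then show ?case by (auto intro: continuous_intros)
next
  case (Suc k)
  have "Ck_on k U (\<lambda>x. sqrt (f x))"
    using Suc Ck_on_SucD by blast
  then have "Ck_on k U (\<lambda>x. inverse (sqrt (f x)) / 2 * frechet_derivative f (at x) v)" for v
    using Suc.prems assms
    by (intro Ck_on_bilinear[OF \<open>open U\<close> bounded_bilinear_mult]
         Ck_on_linear[OF \<open>open U\<close> bounded_linear_divide] Ck_on_inverse) force+
  then show ?case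
  proof (intro Ck_on_SucI[OF \<open>open U\<close>, where
          f' = "\<lambda>x v. inverse (sqrt (f x)) / 2 * frechet_derivative f (at x) v"])
    fix x assume x: "x \<in> U"
    have "(sqrt has_derivative (*) (inverse (sqrt (f x)) / 2)) (at (f x))"
      using DERIV_real_sqrt[OF assms(2)[OF x]] by (simp add: has_field_derivative_def)
    from diff_chain_at[OF Ck_on_SucE[OF Suc.prems x] this]
    show "((\<lambda>x. sqrt (f x)) has_derivative
          (\<lambda>v. inverse (sqrt (f x)) / 2 * frechet_derivative f (at x) v)) (at x)"
      by (simp add: o_def)
  qed
qed

context
  fixes U :: "'a::real_normed_vector set"
  assumes U: "open U"
begin

lemma smooth_on_const: "smooth_on U (\<lambda>x. c)"
  unfolding smooth_on_def by (simp add: Ck_on_const U)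

lemma smooth_on_ident: "smooth_on U (\<lambda>x. x)"
  unfolding smooth_on_def by (simp add: Ck_on_ident U)

lemma smooth_on_add: "smooth_on U f \<Longrightarrow> smooth_on U g \<Longrightarrow> smooth_on U (\<lambda>x. f x + g x)"
  unfolding smooth_on_def by (simp add: Ck_on_add U)

lemma smooth_on_linear: "bounded_linear L \<Longrightarrow> smooth_on U h \<Longrightarrow> smooth_on U (\<lambda>x. L (h x))"
  unfolding smooth_on_def by (simp add: Ck_on_linear U)

lemma smooth_on_bilinear:
  "bounded_bilinear pr \<Longrightarrow> smooth_on U p \<Longrightarrow> smooth_on U q \<Longrightarrow> smooth_on U (\<lambda>x. pr (p x) (q x))"
  unfolding smooth_on_def by (simp add: Ck_on_bilinear U)

lemma smooth_on_cong:
  assumes "smooth_on U f" "\<And>x. x \<in> U \<Longrightarrow> f x = g x"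
  shows "smooth_on U g"
  using assms(1) Ck_on_cong[OF U assms(2)] unfolding smooth_on_def by simp

lemma smooth_on_inverse:
  assumes "smooth_on U f" "\<And>x. x \<in> U \<Longrightarrow> f x \<noteq> 0"
  shows "smooth_on U (\<lambda>x. inverse (f x :: real))"
  using assms(1) Ck_on_inverse[OF U assms(2)] unfolding smooth_on_def by simp

lemma smooth_on_sqrt:
  assumes "smooth_on U f" "\<And>x. x \<in> U \<Longrightarrow> f x > 0"
  shows "smooth_on U (\<lambda>x. sqrt (f x))"
  using assms(1) Ck_on_sqrt[OF U assms(2)] unfolding smooth_on_def by simp

lemma smooth_on_minus: "smooth_on U f \<Longrightarrow> smooth_on U (\<lambda>x. - f x)"
  by (rule smooth_on_linear[OF bounded_linear_minus[OF bounded_linear_ident]])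

lemma smooth_on_diff: "smooth_on U f \<Longrightarrow> smooth_on U g \<Longrightarrow> smooth_on U (\<lambda>x. f x - g x)"
  using smooth_on_add[OF _ smooth_on_minus, of f g] by simp

lemma smooth_on_mult:
  "smooth_on U f \<Longrightarrow> smooth_on U g \<Longrightarrow> smooth_on U (\<lambda>x. f x * g x :: real)"
  by (rule smooth_on_bilinear[OF bounded_bilinear_mult])

lemma smooth_on_divide:
  "smooth_on U f \<Longrightarrow> smooth_on U g \<Longrightarrow> (\<And>x. x \<in> U \<Longrightarrow> g x \<noteq> 0) \<Longrightarrow> smooth_on U (\<lambda>x. f x / g x :: real)"
  by (simp add: divide_inverse smooth_on_mult smooth_on_inverse)

lemma smooth_on_power: "smooth_on U f \<Longrightarrow> smooth_on U (\<lambda>x. f x ^ n :: real)"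
  by (induction n) (simp_all add: smooth_on_const smooth_on_mult)

lemma smooth_on_vec_nth: "smooth_on U f \<Longrightarrow> smooth_on U (\<lambda>x. f x $ i)"
  by (rule smooth_on_linear[OF bounded_linear_vec_nth])

lemma smooth_on_sum:
  "(\<And>i. i \<in> I \<Longrightarrow> smooth_on U (f i)) \<Longrightarrow> smooth_on U (\<lambda>x. \<Sum>i\<in>I. f i x)"
  by (induction I rule: infinite_finite_induct) (simp_all add: smooth_on_const smooth_on_add)

lemmas smooth_intros = smooth_on_const smooth_on_ident smooth_on_add smooth_on_minus smooth_on_diff
  smooth_on_mult smooth_on_power smooth_on_vec_nth smooth_on_sum

end

lemma smooth_on_differentiable: "smooth_on U f \<Longrightarrow> s \<in> U \<Longrightarrow> f differentiable (at s)"
  unfolding smooth_on_def by (metis Ck_on.simps(2))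

lemma smooth_on_continuous: "smooth_on U f \<Longrightarrow> continuous_on U f"
  unfolding smooth_on_def by (metis Ck_on.simps(1))

lemma smooth_on_frechet_derivative:
  "smooth_on U f \<Longrightarrow> smooth_on U (\<lambda>s. frechet_derivative f (at s) v)"
  unfolding smooth_on_def by (metis Ck_on.simps(2))

text \<open>
  For solutions of differential equations: the derivative is an expression in the map itself,
  so each order of differentiability yields the next one.
\<close>

lemma smooth_onI:
  assumes "open U" "\<And>x. x \<in> U \<Longrightarrow> (f has_derivative f' x) (at x)"
    "\<And>k v. Ck_on k U f \<Longrightarrow> Ck_on k U (\<lambda>x. f' x v)"
  shows "smooth_on U f"
  unfolding smooth_on_def
proof
  fix k show "Ck_on k U f"
  proof (induction k)
    case 0
    have "continuous_on U f"
      by (rule continuous_at_imp_continuous_on) (blast intro: has_derivative_continuous assms(2))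
    then show ?case by simp
  next
    case (Suc k)
    show ?case by (rule Ck_on_SucI[OF assms(1,2) assms(3)[OF Suc]])
  qed
qed

lemma smooth_on_vec:
  fixes f :: "'a::real_normed_vector \<Rightarrow> 'b::euclidean_space^'n"
  assumes "open U" "\<And>i. smooth_on U (\<lambda>x. f x $ i)"
  shows "smooth_on U f"
proof -
  have bl: "bounded_linear (\<lambda>c::'b. axis i c :: 'b^'n)" for i
    unfolding linear_conv_bounded_linear[symmetric]
    by (rule linearI) (auto simp: axis_def vec_eq_iff)
  have "smooth_on U (\<lambda>x. \<Sum>i\<in>UNIV. axis i (f x $ i))"
    using assms by (intro smooth_on_sum smooth_on_linear[OF _ bl])
  moreover have "(\<Sum>i\<in>UNIV. axis i (f x $ i)) = f x" for x
    by (simp add: vec_eq_iff axis_def if_distrib[where f = "\<lambda>z. z $ _"] cong: if_cong)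
  ultimately show ?thesis by simp
qed

lemma smooth_on_Pair:
  assumes U: "open U" and "smooth_on U f" "smooth_on U g"
  shows "smooth_on U (\<lambda>x. (f x, g x))"
proof -
  have "smooth_on U (\<lambda>x. (f x, 0) + (0, g x))"
    using assms by (intro smooth_on_add[OF U] smooth_on_linear[OF U, of "\<lambda>y. (y, 0)"]
        smooth_on_linear[OF U, of "\<lambda>y. (0, y)"] bounded_linear_Pair
        bounded_linear_ident bounded_linear_zero)
  then show ?thesis by simp
qed


section \<open>Partial derivatives\<close>

text \<open>
  Both mixed derivatives are obtained from the same second difference over a small
  parallelogram, by applying the mean value theorem once in each direction.
\<close>

lemma second_difference_eq:
  fixes f :: "'a::real_normed_vector \<Rightarrow> real"
  assumes f: "smooth_on U f" and "h > 0"
    and U: "\<And>a b. a \<in> {0..h} \<Longrightarrow> b \<in> {0..h} \<Longrightarrow> s + a *\<^sub>R u + b *\<^sub>R v \<in> U"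
  obtains a b where "a \<in> {0..h}" "b \<in> {0..h}"
    "f (s + h *\<^sub>R u + h *\<^sub>R v) - f (s + h *\<^sub>R u) - f (s + h *\<^sub>R v) + f s =
     h * h * frechet_derivative (\<lambda>t. frechet_derivative f (at t) u) (at (s + a *\<^sub>R u + b *\<^sub>R v)) v"
proof -
  have D: "((\<lambda>r. F (p + r *\<^sub>R d)) has_real_derivative
        frechet_derivative F (at (p + r *\<^sub>R d)) d) (at r)"
    if F: "smooth_on U F" and U: "p + r *\<^sub>R d \<in> U" for F :: "'a \<Rightarrow> real" and p r d
  proof -
    have "(F has_derivative frechet_derivative F (at (p + r *\<^sub>R d))) (at (p + r *\<^sub>R d))"
      using smooth_on_differentiable[OF F U] by (simp add: frechet_derivative_works)
    moreover have "((\<lambda>r. p + r *\<^sub>R d) has_derivative (\<lambda>x. x *\<^sub>R d)) (at r)"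
      by (auto intro!: derivative_eq_intros)
    ultimately have "((\<lambda>r. F (p + r *\<^sub>R d)) has_derivative
        (\<lambda>x. frechet_derivative F (at (p + r *\<^sub>R d)) (x *\<^sub>R d))) (at r)"
      by (rule has_derivative_compose[rotated])
    then show ?thesis
      using linear_frechet_derivative[OF smooth_on_differentiable[OF F U]]
      by (simp add: has_field_derivative_def linear_scale mult.commute[of _ "frechet_derivative F _ _"])
  qed
  let ?fu = "\<lambda>t. frechet_derivative f (at t) u"
  define \<phi> where "\<phi> a = f (s + h *\<^sub>R v + a *\<^sub>R u) - f (s + a *\<^sub>R u)" for a
  have "(\<phi> has_real_derivative ?fu (s + h *\<^sub>R v + a *\<^sub>R u) - ?fu (s + a *\<^sub>R u)) (at a)"
    if "0 \<le> a" "a \<le> h" for a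
    unfolding \<phi>_def using U[of a h] U[of a 0] that \<open>h > 0\<close>
    by (intro DERIV_diff D[OF f]) (auto simp: algebra_simps)
  from MVT2[OF \<open>h > 0\<close> this] obtain a where a: "0 < a" "a < h"
    "\<phi> h - \<phi> 0 = h * (?fu (s + h *\<^sub>R v + a *\<^sub>R u) - ?fu (s + a *\<^sub>R u))" by auto
  have "((\<lambda>b. ?fu ((s + a *\<^sub>R u) + b *\<^sub>R v)) has_real_derivative
      frechet_derivative ?fu (at ((s + a *\<^sub>R u) + b *\<^sub>R v)) v) (at b)"
    if "0 \<le> b" "b \<le> h" for b
    using U[of a b] that a by (intro D smooth_on_frechet_derivative[OF f]) auto
  from MVT2[OF \<open>h > 0\<close> this] obtain b where "0 < b" "b < h"
    "?fu (s + a *\<^sub>R u + h *\<^sub>R v) - ?fu (s + a *\<^sub>R u) =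
      h * frechet_derivative ?fu (at (s + a *\<^sub>R u + b *\<^sub>R v)) v" by auto
  with a show thesis
    by (intro that[of a b]) (auto simp: \<phi>_def algebra_simps)
qed

lemma frechet_derivative_commute:
  fixes f :: "'a::real_normed_vector \<Rightarrow> real"
  assumes "open U" "smooth_on U f" "s \<in> U"
  shows "frechet_derivative (\<lambda>t. frechet_derivative f (at t) u) (at s) v =
         frechet_derivative (\<lambda>t. frechet_derivative f (at t) v) (at s) u"
proof (rule ccontr)
  define P where "P u v t = frechet_derivative (\<lambda>t. frechet_derivative f (at t) u) (at t) v" for u v t
  assume "\<not> ?thesis"
  then have ne: "\<bar>P u v s - P v u s\<bar> > 0" (is "?\<epsilon> > 0") by (simp add: P_def)
  have cont: "isCont (P u v) s" for u v
    unfolding P_def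
    using smooth_on_continuous[OF smooth_on_frechet_derivative[OF smooth_on_frechet_derivative[OF assms(2)]]]
      assms by (simp add: continuous_on_eq_continuous_at)
  obtain d1 where d1: "d1 > 0" "\<And>t. dist t s < d1 \<Longrightarrow> dist (P u v t) (P u v s) < ?\<epsilon> / 2"
    using cont[of u v] ne unfolding continuous_at_eps_delta by (metis half_gt_zero)
  obtain d2 where d2: "d2 > 0" "\<And>t. dist t s < d2 \<Longrightarrow> dist (P v u t) (P v u s) < ?\<epsilon> / 2"
    using cont[of v u] ne unfolding continuous_at_eps_delta by (metis half_gt_zero)
  obtain d3 where d3: "d3 > 0" "ball s d3 \<subseteq> U"
    using assms open_contains_ball by blast
  define d where "d = min d1 (min d2 d3)"
  define h where "h = d / (norm u + norm v + 1)"
  have "d > 0" using d1 d2 d3 by (simp add: d_def)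
  moreover have n: "norm u + norm v + 1 > 0"
    by (smt (verit) norm_ge_zero)
  ultimately have "h > 0" by (simp add: h_def)
  have close: "dist (s + a *\<^sub>R u + b *\<^sub>R v) s < d" if "a \<in> {0..h}" "b \<in> {0..h}" for a b
  proof -
    have "dist (s + a *\<^sub>R u + b *\<^sub>R v) s \<le> norm (a *\<^sub>R u) + norm (b *\<^sub>R v)"
      unfolding dist_norm add.assoc add_diff_cancel_left' by (rule norm_triangle_ineq)
    also have "\<dots> \<le> h * norm u + h * norm v"
      using that by (auto intro!: add_mono mult_right_mono)
    also have "\<dots> < h * (norm u + norm v + 1)"
      using \<open>h > 0\<close> by (simp add: algebra_simps)
    also have "\<dots> = d" using n by (simp add: h_def)
    finally show ?thesis .
  qed
  have inU: "s + a *\<^sub>R u + b *\<^sub>R v \<in> U" "s + b *\<^sub>R v + a *\<^sub>R u \<in> U" if "a \<in> {0..h}" "b \<in> {0..h}" for a b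
    using close[OF that] d3 by (auto simp: d_def dist_commute add_ac)
  obtain a b where ab: "a \<in> {0..h}" "b \<in> {0..h}"
    "f (s + h *\<^sub>R u + h *\<^sub>R v) - f (s + h *\<^sub>R u) - f (s + h *\<^sub>R v) + f s = h * h * P u v (s + a *\<^sub>R u + b *\<^sub>R v)"
    using second_difference_eq[OF assms(2) \<open>h > 0\<close> inU(1)] unfolding P_def by blast
  obtain a' b' where ab': "a' \<in> {0..h}" "b' \<in> {0..h}"
    "f (s + h *\<^sub>R v + h *\<^sub>R u) - f (s + h *\<^sub>R v) - f (s + h *\<^sub>R u) + f s = h * h * P v u (s + a' *\<^sub>R v + b' *\<^sub>R u)"
    using second_difference_eq[OF assms(2) \<open>h > 0\<close> inU(2)] unfolding P_def by blast
  have swap: "s + h *\<^sub>R u + h *\<^sub>R v = s + h *\<^sub>R v + h *\<^sub>R u"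
    by simp
  have "h * h * P u v (s + a *\<^sub>R u + b *\<^sub>R v) = h * h * P v u (s + a' *\<^sub>R v + b' *\<^sub>R u)"
    using ab(3) ab'(3) unfolding swap by linarith
  then have "P u v (s + a *\<^sub>R u + b *\<^sub>R v) = P v u (s + a' *\<^sub>R v + b' *\<^sub>R u)"
    using \<open>h > 0\<close> by simp
  moreover have "dist (P u v (s + a *\<^sub>R u + b *\<^sub>R v)) (P u v s) < ?\<epsilon> / 2"
    using close[OF ab(1,2)] by (intro d1) (simp add: d_def)
  moreover have "dist (P v u (s + a' *\<^sub>R v + b' *\<^sub>R u)) (P v u s) < ?\<epsilon> / 2"
    using close[OF ab'(2,1)] by (intro d2) (simp add: d_def add_ac)
  ultimately show False by (simp add: dist_real_def abs_if split: if_splits)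
qed

lemma pd_commute:
  fixes f :: "real^2 \<Rightarrow> real"
  assumes "open U" "smooth_on U f" "s \<in> U"
  shows "pd i (pd j f) s = pd j (pd i f) s"
  using frechet_derivative_commute[OF assms] unfolding pd_def .

lemma smooth_on_pd: "smooth_on U f \<Longrightarrow> smooth_on U (pd i f)"
  unfolding pd_def by (rule smooth_on_frechet_derivative)

lemma frechet_derivative_eq_pd:
  assumes "f differentiable (at s)"
  shows "frechet_derivative f (at s) v = v $ 1 *\<^sub>R pd 1 f s + v $ 2 *\<^sub>R pd 2 f s"
proof -
  have "v = v $ 1 *\<^sub>R axis 1 1 + v $ 2 *\<^sub>R axis 2 1"
    by (simp add: vec_eq_iff axis_def forall_2)
  then have "frechet_derivative f (at s) v =
      frechet_derivative f (at s) (v $ 1 *\<^sub>R axis 1 1 + v $ 2 *\<^sub>R axis 2 1)" by simp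
  then show ?thesis
    using linear_frechet_derivative[OF assms] by (simp add: linear_add linear_scale pd_def)
qed

lemma has_derivative_pd:
  "f differentiable (at s) \<Longrightarrow> (f has_derivative (\<lambda>v. v $ 1 *\<^sub>R pd 1 f s + v $ 2 *\<^sub>R pd 2 f s)) (at s)"
  unfolding frechet_derivative_eq_pd[symmetric] by (simp add: frechet_derivative_works)

lemma pd_eqI: "(f has_derivative f') (at s) \<Longrightarrow> pd i f s = f' (axis i 1)"
  unfolding pd_def by (simp flip: frechet_derivative_at)

lemma pd_cong:
  assumes "open V" "s \<in> V" "\<And>t. t \<in> V \<Longrightarrow> f t = h t" "f differentiable (at s)"
  shows "pd i h s = pd i f s"
proof -
  have "(h has_derivative frechet_derivative f (at s)) (at s)"
    by (rule has_derivative_transform_within_open[OF _ assms(1,2,3)])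
       (use assms(4) in \<open>auto simp: frechet_derivative_works\<close>)
  from pd_eqI[OF this] show ?thesis by (simp add: pd_def)
qed

lemma pd_pd_cong:
  assumes "open V" "s \<in> V" "smooth_on V f" "\<And>t. t \<in> V \<Longrightarrow> pd j f t = h t"
  shows "pd i (pd j f) s = pd i h s"
  using pd_cong[OF assms(1,2,4)] smooth_on_differentiable[OF smooth_on_pd[OF assms(3)] assms(2)] by simp


lemma pd_const [simp]: "pd i (\<lambda>t. c) s = 0"
  by (rule pd_eqI[of _ "\<lambda>v. 0", simplified]) simp

context
  fixes f h :: "real^2 \<Rightarrow> real" and s :: "real^2"
  assumes f: "f differentiable (at s)" and h: "h differentiable (at s)"
begin

lemma pd_add: "pd i (\<lambda>t. f t + h t) s = pd i f s + pd i h s"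
  using pd_eqI[OF has_derivative_add[OF f[unfolded frechet_derivative_works] h[unfolded frechet_derivative_works]]]
  by (simp add: pd_def)

lemma pd_diff: "pd i (\<lambda>t. f t - h t) s = pd i f s - pd i h s"
  using pd_eqI[OF has_derivative_diff[OF f[unfolded frechet_derivative_works] h[unfolded frechet_derivative_works]]]
  by (simp add: pd_def)

lemma pd_mult: "pd i (\<lambda>t. f t * h t) s = pd i f s * h s + f s * pd i h s"
  using pd_eqI[OF has_derivative_mult[OF f[unfolded frechet_derivative_works] h[unfolded frechet_derivative_works]]]
  by (simp add: pd_def)

lemma pd_divide: "h s \<noteq> 0 \<Longrightarrow> pd i (\<lambda>t. f t / h t) s = (pd i f s * h s - f s * pd i h s) / (h s)\<^sup>2"
  using pd_eqI[OF has_derivative_divide[OF f[unfolded frechet_derivative_works] h[unfolded frechet_derivative_works]]]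
  by (simp add: pd_def field_simps power2_eq_square)

end

lemma pd_cmult: "f differentiable (at s) \<Longrightarrow> pd i (\<lambda>t. c * f t :: real) s = c * pd i f s"
  by (simp add: pd_mult)

lemma pd_divide_const: "f differentiable (at s) \<Longrightarrow> pd i (\<lambda>t. f t / c :: real) s = pd i f s / c"
  using pd_cmult[of f s i "1 / c"] by (simp add: field_simps)

lemma pd_minus: "f differentiable (at s) \<Longrightarrow> pd i (\<lambda>t. - f t :: real) s = - pd i f s"
  using pd_cmult[of f s i "-1"] by simp

lemma pd_power2: "f differentiable (at s) \<Longrightarrow> pd i (\<lambda>t. (f t)\<^sup>2 :: real) s = 2 * f s * pd i f s"
  by (simp add: power2_eq_square pd_mult)

lemmas pd_simps = pd_add pd_diff pd_mult pd_minus pd_divide_const pd_power2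

lemma pd_vec_nth:
  assumes "f differentiable (at s)"
  shows "pd i (\<lambda>t. f t $ k) s = pd i f s $ k"
  using pd_eqI[OF bounded_linear.has_derivative[OF bounded_linear_vec_nth
        assms[unfolded frechet_derivative_works]]] by (simp add: pd_def)

section \<open>Levi-Civita connection and curvature in a coordinate domain\<close>

lemma matrix_inv_2x2:
  fixes M :: "real^2^2"
  assumes "det M \<noteq> 0"
  shows "matrix_inv M = vector [vector [M $ 2 $ 2 / det M, - M $ 1 $ 2 / det M],
                                vector [- M $ 2 $ 1 / det M, M $ 1 $ 1 / det M]]" (is "_ = ?N")
proof -
  have "?N ** M = mat 1"
    using assms by (simp add: vec_eq_iff forall_2 matrix_matrix_mult_def sum_2 mat_def det_2 divide_simps)
  then have "matrix_inv M = ?N ** M ** matrix_inv M" by simp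
  moreover have "invertible M"
    using assms by (simp add: invertible_det_nz)
  then have "M ** matrix_inv M = mat 1"
    unfolding invertible_def matrix_inv_def by (rule someI2_ex) blast
  ultimately show ?thesis
    by (simp only: matrix_mul_assoc[symmetric] matrix_mul_rid)
qed

locale riemannian_domain =
  fixes U :: "(real^2) set" and g :: "real^2 \<Rightarrow> real^2^2"
  assumes open_U: "open U" and metric: "riemannian_metric_on U g"
begin

definition "g11 s = g s $ 1 $ 1"
definition "g12 s = g s $ 1 $ 2"
definition "g22 s = g s $ 2 $ 2"
definition "dg s = g11 s * g22 s - g12 s * g12 s"

abbreviation "\<Gamma> \<equiv> christoffel g"
abbreviation "K \<equiv> gaussian_curvature g"

lemma g21: "s \<in> U \<Longrightarrow> g s $ 2 $ 1 = g12 s"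
  using metric unfolding riemannian_metric_on_def g12_def transpose_def
  by (auto simp: vec_eq_iff)

lemma g_components [simp]: "g s $ 1 $ 1 = g11 s" "g s $ 1 $ 2 = g12 s" "g s $ 2 $ 2 = g22 s"
  by (simp_all add: g11_def g12_def g22_def)

lemma smooth_g: "smooth_on U (\<lambda>s. g s $ i $ j)"
  using metric open_U by (auto simp: riemannian_metric_on_def intro: smooth_intros)

lemma smooth_g11: "smooth_on U g11" and smooth_g12: "smooth_on U g12" and smooth_g22: "smooth_on U g22"
  using smooth_g[of 1 1] smooth_g[of 1 2] smooth_g[of 2 2] by simp_all

lemma g_quadratic_pos:
  assumes "s \<in> U" "a \<noteq> 0 \<or> b \<noteq> 0"
  shows "g11 s * a\<^sup>2 + 2 * g12 s * a * b + g22 s * b\<^sup>2 > 0"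
proof -
  have "(vector [a, b] :: real^2) \<noteq> 0"
    using assms(2) by (auto simp: vec_eq_iff forall_2)
  then have "(vector [a, b] :: real^2) \<bullet> (g s *v vector [a, b]) > 0"
    using metric assms(1) by (auto simp: riemannian_metric_on_def)
  then show ?thesis
    by (simp add: inner_vec_def sum_2 matrix_vector_mult_def g21[OF assms(1)] power2_eq_square
        algebra_simps)
qed

lemma dg_pos: assumes "s \<in> U" shows "dg s > 0"
proof -
  have 1: "g11 s > 0" using g_quadratic_pos[OF assms, of 1 0] by simp
  have "g11 s * (g12 s)\<^sup>2 + 2 * g12 s * (g12 s) * (- g11 s) + g22 s * (g11 s)\<^sup>2 > 0"
    using g_quadratic_pos[OF assms, of "g12 s" "- g11 s"] 1 by simp
  then have "g11 s * dg s > 0"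
    by (simp add: dg_def power2_eq_square algebra_simps)
  with 1 show ?thesis by (simp add: zero_less_mult_iff)
qed

lemma dg_cancel: "s \<in> U \<Longrightarrow> dg s * x = dg s * y \<Longrightarrow> x = y"
  using dg_pos[of s] by simp

lemma det_g: "s \<in> U \<Longrightarrow> det (g s) = dg s"
  by (simp add: det_2 g21 dg_def)

lemma smooth_dg: "smooth_on U dg"
  unfolding dg_def[abs_def] using open_U smooth_g11 smooth_g12 smooth_g22 by (intro smooth_intros)

lemma matrix_inv_g:
  assumes "s \<in> U"
  shows "matrix_inv (g s) $ 1 $ 1 = g22 s / dg s" "matrix_inv (g s) $ 1 $ 2 = - g12 s / dg s"
    "matrix_inv (g s) $ 2 $ 1 = - g12 s / dg s" "matrix_inv (g s) $ 2 $ 2 = g11 s / dg s"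
  using matrix_inv_2x2[of "g s"] dg_pos[OF assms] by (simp_all add: det_g assms g21)

lemma pd_g21: "s \<in> U \<Longrightarrow> pd i (\<lambda>t. g t $ 2 $ 1) s = pd i g12 s"
  by (rule pd_cong[OF open_U]) (auto simp: g21 intro: smooth_on_differentiable[OF smooth_g12])

text \<open>
  Multiplication by the determinant keeps the formulas polynomial.
\<close>

lemma christoffel_expand:
  assumes "s \<in> U"
  shows
    "dg s * \<Gamma> 1 1 1 s = (g22 s * pd 1 g11 s - g12 s * (2 * pd 1 g12 s - pd 2 g11 s)) / 2"
    "dg s * \<Gamma> 2 1 1 s = (g11 s * (2 * pd 1 g12 s - pd 2 g11 s) - g12 s * pd 1 g11 s) / 2"
    "dg s * \<Gamma> 1 1 2 s = (g22 s * pd 2 g11 s - g12 s * pd 1 g22 s) / 2"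
    "dg s * \<Gamma> 2 1 2 s = (g11 s * pd 1 g22 s - g12 s * pd 2 g11 s) / 2"
    "dg s * \<Gamma> 1 2 2 s = (g22 s * (2 * pd 2 g12 s - pd 1 g22 s) - g12 s * pd 2 g22 s) / 2"
    "dg s * \<Gamma> 2 2 2 s = (g11 s * pd 2 g22 s - g12 s * (2 * pd 2 g12 s - pd 1 g22 s)) / 2"
    "\<Gamma> 1 2 1 s = \<Gamma> 1 1 2 s" "\<Gamma> 2 2 1 s = \<Gamma> 2 1 2 s"
  using dg_pos[OF assms]
  by (simp_all add: christoffel_def sum_2 matrix_inv_g[OF assms] pd_g21[OF assms] field_simps)

lemma smooth_matrix_inv_g: "smooth_on U (\<lambda>s. matrix_inv (g s) $ k $ l)"
proof -
  have inv: "smooth_on U (\<lambda>s. inverse (dg s))"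
    using smooth_on_inverse[OF open_U smooth_dg] dg_pos by force
  have "\<forall>k l. smooth_on U (\<lambda>s. matrix_inv (g s) $ k $ l)"
    unfolding forall_2
    using smooth_on_cong[OF open_U smooth_on_mult[OF open_U smooth_g11 inv]]
      smooth_on_cong[OF open_U smooth_on_mult[OF open_U smooth_on_minus[OF open_U smooth_g12] inv]]
      smooth_on_cong[OF open_U smooth_on_mult[OF open_U smooth_g22 inv]]
    by (simp add: matrix_inv_g divide_inverse)
  then show ?thesis by blast
qed

lemma smooth_christoffel: "smooth_on U (\<Gamma> k i j)"
  unfolding christoffel_def[abs_def] divide_inverse
  using open_U by (intro smooth_intros smooth_matrix_inv_g smooth_on_pd smooth_g)

lemma smooth_curvature: "smooth_on U K"
proof -
  have "smooth_on U (\<lambda>s. (\<Sum>l\<in>UNIV. g s $ 1 $ l * riemann g l 2 1 2 s) * inverse (dg s))"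
    unfolding riemann_def using dg_pos open_U
    by (intro smooth_intros smooth_on_pd smooth_g smooth_christoffel smooth_on_inverse smooth_dg) force+
  then show ?thesis
    by (rule smooth_on_cong[OF open_U]) (simp add: gaussian_curvature_def det_g divide_inverse)
qed

lemmas smooth_geometry = smooth_g11 smooth_g12 smooth_g22 smooth_dg smooth_christoffel smooth_curvature

text \<open>
  By these formulas the derivatives of the metric are always eliminated in favour of the
  Christoffel symbols; they say that the connection is metric.
\<close>

lemma pd_metric:
  assumes "s \<in> U"
  shows "pd 1 g11 s = 2 * (\<Gamma> 1 1 1 s * g11 s + \<Gamma> 2 1 1 s * g12 s)"
    "pd 2 g11 s = 2 * (\<Gamma> 1 1 2 s * g11 s + \<Gamma> 2 1 2 s * g12 s)"
    "pd 1 g12 s = \<Gamma> 1 1 1 s * g12 s + \<Gamma> 2 1 1 s * g22 s + \<Gamma> 1 1 2 s * g11 s + \<Gamma> 2 1 2 s * g12 s"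
    "pd 2 g12 s = \<Gamma> 1 1 2 s * g12 s + \<Gamma> 2 1 2 s * g22 s + \<Gamma> 1 2 2 s * g11 s + \<Gamma> 2 2 2 s * g12 s"
    "pd 1 g22 s = 2 * (\<Gamma> 1 1 2 s * g12 s + \<Gamma> 2 1 2 s * g22 s)"
    "pd 2 g22 s = 2 * (\<Gamma> 1 2 2 s * g12 s + \<Gamma> 2 2 2 s * g22 s)"
proof -
  have distr: "dg s * (2 * (a * x + b * y)) = 2 * ((dg s * a) * x + (dg s * b) * y)"
    "dg s * (a * x + b * y + c * z + d * w) = (dg s * a) * x + (dg s * b) * y + (dg s * c) * z + (dg s * d) * w"
    for a b c d x y z w by algebra+
  show "pd 1 g11 s = 2 * (\<Gamma> 1 1 1 s * g11 s + \<Gamma> 2 1 1 s * g12 s)"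
    "pd 2 g11 s = 2 * (\<Gamma> 1 1 2 s * g11 s + \<Gamma> 2 1 2 s * g12 s)"
    "pd 1 g12 s = \<Gamma> 1 1 1 s * g12 s + \<Gamma> 2 1 1 s * g22 s + \<Gamma> 1 1 2 s * g11 s + \<Gamma> 2 1 2 s * g12 s"
    "pd 2 g12 s = \<Gamma> 1 1 2 s * g12 s + \<Gamma> 2 1 2 s * g22 s + \<Gamma> 1 2 2 s * g11 s + \<Gamma> 2 2 2 s * g12 s"
    "pd 1 g22 s = 2 * (\<Gamma> 1 1 2 s * g12 s + \<Gamma> 2 1 2 s * g22 s)"
    "pd 2 g22 s = 2 * (\<Gamma> 1 2 2 s * g12 s + \<Gamma> 2 2 2 s * g22 s)"
    by (rule dg_cancel[OF assms], unfold distr christoffel_expand[OF assms], simp add: dg_def field_simps)+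
qed

lemma differentiable_geometry [simp]:
  assumes "s \<in> U"
  shows "g11 differentiable (at s)" "g12 differentiable (at s)" "g22 differentiable (at s)"
    "dg differentiable (at s)" "\<Gamma> k i j differentiable (at s)" "K differentiable (at s)"
  using smooth_geometry smooth_on_differentiable assms by blast+

lemma pd_christoffel_sym: "s \<in> U \<Longrightarrow> pd i (\<Gamma> k 2 1) s = pd i (\<Gamma> k 1 2) s"
proof (rule pd_cong[OF open_U])
  show "\<Gamma> k 1 2 t = \<Gamma> k 2 1 t" if "t \<in> U" for t
    using christoffel_expand(7,8)[OF that] exhaust_2[of k] by auto
qed simp_all

text \<open>
  On a surface the curvature tensor is determined by the Gaussian curvature: the metric
  connection makes it skew in the first two indices, by the symmetry of the second derivatives
  of the metric coefficients.
\<close>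

lemma riemann_eq:
  assumes s: "s \<in> U"
  shows "riemann g 1 1 1 2 s = K s * g12 s" "riemann g 2 1 1 2 s = - K s * g11 s"
    "riemann g 1 2 1 2 s = K s * g22 s" "riemann g 2 2 1 2 s = - K s * g12 s"
proof -
  note [simp] = s
  note r = riemann_def sum_2 pd_christoffel_sym[OF s] christoffel_expand(7,8)[OF s]
  note c = pd_commute[OF open_U smooth_g11 s, of 1 2] pd_commute[OF open_U smooth_g12 s, of 1 2]
    pd_commute[OF open_U smooth_g22 s, of 1 2]
  have skew11: "g11 s * riemann g 1 1 1 2 s + g12 s * riemann g 2 1 1 2 s = 0"
    using c(1)
    by (simp add: pd_pd_cong[OF open_U s smooth_g11 pd_metric(1)] pd_pd_cong[OF open_U s smooth_g11 pd_metric(2)] pd_simps pd_metric r algebra_simps)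
  have skew22: "g12 s * riemann g 1 2 1 2 s + g22 s * riemann g 2 2 1 2 s = 0"
    using c(3)
    by (simp add: pd_pd_cong[OF open_U s smooth_g22 pd_metric(5)] pd_pd_cong[OF open_U s smooth_g22 pd_metric(6)] pd_simps pd_metric r algebra_simps)
  have skew12: "g11 s * riemann g 1 2 1 2 s + g12 s * riemann g 2 2 1 2 s +
      g12 s * riemann g 1 1 1 2 s + g22 s * riemann g 2 1 1 2 s = 0"
    using c(2)
    by (simp add: pd_pd_cong[OF open_U s smooth_g12 pd_metric(3)] pd_pd_cong[OF open_U s smooth_g12 pd_metric(4)] pd_simps pd_metric r algebra_simps)
  have K: "g11 s * riemann g 1 2 1 2 s + g12 s * riemann g 2 2 1 2 s = K s * dg s"
    using dg_pos[OF s] by (simp add: gaussian_curvature_def sum_2 det_g)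
  show "riemann g 1 1 1 2 s = K s * g12 s" "riemann g 2 1 1 2 s = - K s * g11 s"
    "riemann g 1 2 1 2 s = K s * g22 s" "riemann g 2 2 1 2 s = - K s * g12 s"
    by (rule dg_cancel[OF s], use skew11 skew22 skew12 K in \<open>unfold dg_def, algebra\<close>)+
qed

text \<open>
  The Gauss equation, solved for derivatives of Christoffel symbols so that it can be used for
  rewriting: each integrability condition below is then an identity of polynomials.
\<close>

lemma pd2_christoffel:
  assumes s: "s \<in> U"
  shows
    "pd 2 (\<Gamma> 1 1 1) s = pd 1 (\<Gamma> 1 1 2) s + \<Gamma> 2 1 2 s * \<Gamma> 1 1 2 s - \<Gamma> 1 2 2 s * \<Gamma> 2 1 1 s - K s * g12 s"
    "pd 2 (\<Gamma> 2 1 1) s = pd 1 (\<Gamma> 2 1 2) s + \<Gamma> 2 1 1 s * \<Gamma> 1 1 2 s + \<Gamma> 2 1 2 s * \<Gamma> 2 1 2 s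
       - \<Gamma> 2 1 2 s * \<Gamma> 1 1 1 s - \<Gamma> 2 2 2 s * \<Gamma> 2 1 1 s + K s * g11 s"
    "pd 2 (\<Gamma> 1 1 2) s = pd 1 (\<Gamma> 1 2 2) s + \<Gamma> 1 1 1 s * \<Gamma> 1 2 2 s + \<Gamma> 1 1 2 s * \<Gamma> 2 2 2 s
       - \<Gamma> 1 1 2 s * \<Gamma> 1 1 2 s - \<Gamma> 1 2 2 s * \<Gamma> 2 1 2 s - K s * g22 s"
    "pd 2 (\<Gamma> 2 1 2) s = pd 1 (\<Gamma> 2 2 2) s + \<Gamma> 2 1 1 s * \<Gamma> 1 2 2 s - \<Gamma> 2 1 2 s * \<Gamma> 1 1 2 s + K s * g12 s"
  using riemann_eq[OF s]
  by (simp_all add: riemann_def sum_2 pd_christoffel_sym[OF s] christoffel_expand(7,8)[OF s] algebra_simps)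

end

section \<open>The bracket condition\<close>

lemma frechet_derivative_partial:
  assumes F: "F differentiable (at (s, m))"
  shows "frechet_derivative F (at (s, m)) (v, 0) = frechet_derivative (\<lambda>t. F (t, m)) (at s) v"
    and "frechet_derivative F (at (s, m)) (0, v) = frechet_derivative (\<lambda>n. F (s, n)) (at m) v"
proof -
  have d: "(F has_derivative frechet_derivative F (at (s, m))) (at (s, m))"
    using F by (simp add: frechet_derivative_works)
  have "((\<lambda>t. F (t, m)) has_derivative (\<lambda>v. frechet_derivative F (at (s, m)) (v, 0))) (at s)"
    by (rule has_derivative_compose[where f = "\<lambda>t. (t, m)" and f' = "\<lambda>v. (v, 0)", OF _ d])
       (auto intro!: derivative_eq_intros)
  then show "frechet_derivative F (at (s, m)) (v, 0) = frechet_derivative (\<lambda>t. F (t, m)) (at s) v"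
    by (simp flip: frechet_derivative_at)
  have "((\<lambda>n. F (s, n)) has_derivative (\<lambda>v. frechet_derivative F (at (s, m)) (0, v))) (at m)"
    by (rule has_derivative_compose[where f = "\<lambda>n. (s, n)" and f' = "\<lambda>v. (0, v)", OF _ d])
       (auto intro!: derivative_eq_intros)
  then show "frechet_derivative F (at (s, m)) (0, v) = frechet_derivative (\<lambda>n. F (s, n)) (at m) v"
    by (simp flip: frechet_derivative_at)
qed

lemma poisson_eq_pd:
  assumes "F differentiable (at (s, m))" "G differentiable (at (s, m))"
  shows "poisson F G (s, m) =
    pd 1 (\<lambda>n. F (s, n)) m * pd 1 (\<lambda>t. G (t, m)) s - pd 1 (\<lambda>t. F (t, m)) s * pd 1 (\<lambda>n. G (s, n)) m +
    (pd 2 (\<lambda>n. F (s, n)) m * pd 2 (\<lambda>t. G (t, m)) s - pd 2 (\<lambda>t. F (t, m)) s * pd 2 (\<lambda>n. G (s, n)) m)"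
  unfolding poisson_def sum_2 frechet_derivative_partial[OF assms(1)] frechet_derivative_partial[OF assms(2)]
  by (simp add: pd_def)

lemma differentiable_vec_nth [simp]: "(\<lambda>n::real^2. n $ i) differentiable F"
  using bounded_linear_imp_has_derivative[OF bounded_linear_vec_nth[of i]] differentiable_def by blast

lemma pd_vec_nth_id: "pd i (\<lambda>n::real^2. n $ j) m = (if i = j then 1 else 0)"
  using pd_eqI[OF bounded_linear_imp_has_derivative[OF bounded_linear_vec_nth[of j]], of i m]
  by (simp add: axis_def)

lemma differentiable_fst_comp:
  assumes "f differentiable (at (fst z))"
  shows "(\<lambda>z. f (fst z)) differentiable (at z)"
  using differentiable_chain_at[OF bounded_linear_imp_differentiable[OF bounded_linear_fst] assms]
  by (simp add: o_def)

lemma differentiable_snd_vec_nth: "(\<lambda>z::'a::real_normed_vector \<times> (real^2). snd z $ i) differentiable (at z)"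
  using bounded_linear_imp_differentiable[OF bounded_linear_compose[OF bounded_linear_vec_nth bounded_linear_snd]] .

lemma fractional_linear_differentiable:
  assumes "A differentiable (at s)" "B differentiable (at s)" "C differentiable (at s)" "E differentiable (at s)"
    "C s * m $ 1 + E s * m $ 2 \<noteq> 0"
  shows "fractional_linear A B C E differentiable (at (s, m))"
  unfolding fractional_linear_def case_prod_beta
  using assms
  by (intro differentiable_divide differentiable_add differentiable_mult differentiable_fst_comp
      differentiable_snd_vec_nth) auto

context riemannian_domain
begin

lemma geodesic_hamiltonian_eq:
  assumes "s \<in> U"
  shows "geodesic_hamiltonian g (s, m) =
    (g22 s * (m $ 1)\<^sup>2 - 2 * g12 s * (m $ 1 * m $ 2) + g11 s * (m $ 2)\<^sup>2) / (2 * dg s)"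
  using dg_pos[OF assms]
  by (simp add: geodesic_hamiltonian_def inner_vec_def sum_2 matrix_vector_mult_def matrix_inv_g[OF assms]
      field_simps power2_eq_square)

lemma geodesic_hamiltonian_differentiable:
  assumes s: "s \<in> U"
  shows "geodesic_hamiltonian g differentiable (at (s, m))"
proof -
  have "(\<lambda>z. (g22 (fst z) * (snd z $ 1)\<^sup>2 - 2 * g12 (fst z) * (snd z $ 1 * snd z $ 2) + g11 (fst z) * (snd z $ 2)\<^sup>2)
      / (2 * dg (fst z))) differentiable (at (s, m))"
    using dg_pos[OF s] s
    by (intro differentiable_divide differentiable_add differentiable_diff differentiable_mult
        differentiable_power differentiable_fst_comp differentiable_snd_vec_nth differentiable_const) auto
  then obtain f' where f': "((\<lambda>z. (g22 (fst z) * (snd z $ 1)\<^sup>2 - 2 * g12 (fst z) * (snd z $ 1 * snd z $ 2) + g11 (fst z) * (snd z $ 2)\<^sup>2)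
      / (2 * dg (fst z))) has_derivative f') (at (s, m))"
    unfolding differentiable_def by blast
  have "(geodesic_hamiltonian g has_derivative f') (at (s, m))"
    by (rule has_derivative_transform_within_open[OF f', where s = "U \<times> UNIV"])
       (use open_U s in \<open>auto simp: open_Times geodesic_hamiltonian_eq\<close>)
  then show ?thesis unfolding differentiable_def by blast
qed

text \<open>
  The momentum is given as \<open>m = g v\<close> by its velocity \<open>v\<close>: then the derivative of the inverse
  metric turns into the derivative of the metric itself.
\<close>

lemma pd_geodesic_hamiltonian:
  fixes m v :: "real^2"
  assumes s: "s \<in> U" and m: "m $ 1 = g11 s * v $ 1 + g12 s * v $ 2" "m $ 2 = g12 s * v $ 1 + g22 s * v $ 2"
  shows "pd 1 (\<lambda>n. geodesic_hamiltonian g (s, n)) m = v $ 1"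
    "pd 2 (\<lambda>n. geodesic_hamiltonian g (s, n)) m = v $ 2"
    "pd i (\<lambda>t. geodesic_hamiltonian g (t, m)) s =
      - (pd i g11 s * (v $ 1)\<^sup>2 + 2 * pd i g12 s * (v $ 1 * v $ 2) + pd i g22 s * (v $ 2)\<^sup>2) / 2"
proof -
  have d: "dg s \<noteq> 0" "g11 s * g22 s - g12 s * g12 s \<noteq> 0"
    using dg_pos[OF s] by (simp_all add: dg_def)
  show "pd 1 (\<lambda>n. geodesic_hamiltonian g (s, n)) m = v $ 1"
    using d by (simp add: geodesic_hamiltonian_eq[OF s] pd_simps pd_vec_nth_id m nonzero_divide_eq_eq)
      (simp add: dg_def algebra_simps)
  show "pd 2 (\<lambda>n. geodesic_hamiltonian g (s, n)) m = v $ 2"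
    using d by (simp add: geodesic_hamiltonian_eq[OF s] pd_simps pd_vec_nth_id m nonzero_divide_eq_eq)
      (simp add: dg_def algebra_simps)
  define q where "q t = g22 t * (m $ 1)\<^sup>2 - 2 * g12 t * (m $ 1 * m $ 2) + g11 t * (m $ 2)\<^sup>2" for t
  have q: "q differentiable (at s)" unfolding q_def using s by simp
  have "pd i (\<lambda>t. geodesic_hamiltonian g (t, m)) s = pd i (\<lambda>t. q t / (2 * dg t)) s"
    by (rule pd_cong[OF open_U s]) (use s q d in \<open>auto simp: geodesic_hamiltonian_eq q_def\<close>)
  also have "\<dots> = (pd i q s * dg s - q s * pd i dg s) / (2 * (dg s)\<^sup>2)"
    using q s d by (simp add: pd_divide pd_cmult) (simp add: power2_eq_square field_simps)
  also have "q s = dg s * (g11 s * (v $ 1)\<^sup>2 + 2 * g12 s * (v $ 1 * v $ 2) + g22 s * (v $ 2)\<^sup>2)"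
    unfolding q_def m dg_def by algebra
  also have "pd i q s * dg s - dg s * (g11 s * (v $ 1)\<^sup>2 + 2 * g12 s * (v $ 1 * v $ 2) + g22 s * (v $ 2)\<^sup>2) * pd i dg s
    = - (dg s)\<^sup>2 * (pd i g11 s * (v $ 1)\<^sup>2 + 2 * pd i g12 s * (v $ 1 * v $ 2) + pd i g22 s * (v $ 2)\<^sup>2)"
  proof -
    have "pd i q s = pd i g22 s * (m $ 1)\<^sup>2 - 2 * pd i g12 s * (m $ 1 * m $ 2) + pd i g11 s * (m $ 2)\<^sup>2"
      unfolding q_def using s by (simp add: pd_simps)
    moreover have "pd i dg s = pd i g11 s * g22 s + g11 s * pd i g22 s - 2 * g12 s * pd i g12 s"
      unfolding dg_def[abs_def] using s by (simp add: pd_simps)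
    ultimately show ?thesis unfolding m dg_def by algebra
  qed
  also have "- (dg s)\<^sup>2 * X / (2 * (dg s)\<^sup>2) = - X / 2" for X
    using d by (simp add: field_simps)
  finally show "pd i (\<lambda>t. geodesic_hamiltonian g (t, m)) s =
      - (pd i g11 s * (v $ 1)\<^sup>2 + 2 * pd i g12 s * (v $ 1 * v $ 2) + pd i g22 s * (v $ 2)\<^sup>2) / 2" .
qed

definition "low1 A B s = g11 s * A s + g12 s * B s"
definition "low2 A B s = g12 s * A s + g22 s * B s"

text \<open>
  \<open>nab\<close> is $\nabla_i \xi_k$ for the form $\xi_1 dx + \xi_2 dy$, and \<open>nabq\<close> is the quadratic form
  $\nabla_i \xi_k v^i v^k$ at the velocity \<open>v = (a, b)\<close>.
\<close>

definition "nab \<xi>1 \<xi>2 i k s =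
  pd i (if k = 1 then \<xi>1 else \<xi>2) s - \<Gamma> 1 i k s * \<xi>1 s - \<Gamma> 2 i k s * \<xi>2 s"

definition "nabq \<xi>1 \<xi>2 s a b = nab \<xi>1 \<xi>2 1 1 s * a\<^sup>2 + (nab \<xi>1 \<xi>2 1 2 s + nab \<xi>1 \<xi>2 2 1 s) * (a * b)
  + nab \<xi>1 \<xi>2 2 2 s * b\<^sup>2"

text \<open>
  Up to sign the left-hand side is the Poisson bracket of the momentum function of a vector
  field with the Hamiltonian. Along a geodesic \<open>v\<close> is parallel, so only the derivative of
  the field contributes.
\<close>

lemma nabq_low:
  fixes m v :: "real^2"
  assumes s: "s \<in> U" and A: "A differentiable (at s)" and B: "B differentiable (at s)"
    and m: "m $ 1 = g11 s * v $ 1 + g12 s * v $ 2" "m $ 2 = g12 s * v $ 1 + g22 s * v $ 2"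
  shows "(pd 1 A s * m $ 1 + pd 1 B s * m $ 2) * v $ 1 + (pd 2 A s * m $ 1 + pd 2 B s * m $ 2) * v $ 2
     + (A s * (pd 1 g11 s * (v $ 1)\<^sup>2 + 2 * pd 1 g12 s * (v $ 1 * v $ 2) + pd 1 g22 s * (v $ 2)\<^sup>2)
      + B s * (pd 2 g11 s * (v $ 1)\<^sup>2 + 2 * pd 2 g12 s * (v $ 1 * v $ 2) + pd 2 g22 s * (v $ 2)\<^sup>2)) / 2
     = nabq (low1 A B) (low2 A B) s (v $ 1) (v $ 2)"
proof -
  have l: "pd i (low1 A B) s = pd i g11 s * A s + g11 s * pd i A s + (pd i g12 s * B s + g12 s * pd i B s)"
    "pd i (low2 A B) s = pd i g12 s * A s + g12 s * pd i A s + (pd i g22 s * B s + g22 s * pd i B s)" for i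
    unfolding low1_def[abs_def] low2_def[abs_def] using s A B by (simp_all add: pd_simps)
  have "(2::2) \<noteq> 1" by simp
  then show ?thesis
    unfolding nabq_def nab_def m
    by (simp add: l christoffel_expand(7,8)[OF s])
      (simp add: low1_def low2_def pd_metric[OF s] field_simps power2_eq_square)
qed

proposition poisson_fractional_linear:
  fixes m v :: "real^2"
  assumes s: "s \<in> U" and A: "A differentiable (at s)" and B: "B differentiable (at s)"
    and C: "C differentiable (at s)" and E: "E differentiable (at s)"
    and m: "m $ 1 = g11 s * v $ 1 + g12 s * v $ 2" "m $ 2 = g12 s * v $ 1 + g22 s * v $ 2"
    and Y: "C s * m $ 1 + E s * m $ 2 \<noteq> 0"
  shows "poisson (fractional_linear A B C E) (geodesic_hamiltonian g) (s, m) =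
    ((A s * m $ 1 + B s * m $ 2) * nabq (low1 C E) (low2 C E) s (v $ 1) (v $ 2)
   - (C s * m $ 1 + E s * m $ 2) * nabq (low1 A B) (low2 A B) s (v $ 1) (v $ 2)) / (C s * m $ 1 + E s * m $ 2)\<^sup>2"
proof -
  have F1: "pd i (\<lambda>n. fractional_linear A B C E (s, n)) m =
      ((if i = 1 then A s else B s) * (C s * m $ 1 + E s * m $ 2) -
       (A s * m $ 1 + B s * m $ 2) * (if i = 1 then C s else E s)) / (C s * m $ 1 + E s * m $ 2)\<^sup>2" for i :: 2
    unfolding fractional_linear_def using Y exhaust_2[of i]
    by (auto simp: pd_divide pd_simps pd_vec_nth_id)
  have F2: "pd i (\<lambda>t. fractional_linear A B C E (t, m)) s =
      ((pd i A s * m $ 1 + pd i B s * m $ 2) * (C s * m $ 1 + E s * m $ 2) -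
       (A s * m $ 1 + B s * m $ 2) * (pd i C s * m $ 1 + pd i E s * m $ 2)) / (C s * m $ 1 + E s * m $ 2)\<^sup>2" for i
    unfolding fractional_linear_def using Y A B C E by (simp add: pd_divide pd_simps)
  have "(2::2) \<noteq> 1" by simp
  then show ?thesis
    using Y
    unfolding poisson_eq_pd[OF fractional_linear_differentiable[OF A B C E Y] geodesic_hamiltonian_differentiable[OF s]]
      pd_geodesic_hamiltonian[OF s m] F1 F2 nabq_low[OF s A B m, symmetric] nabq_low[OF s C E m, symmetric]
    by (simp add: divide_simps) (simp add: algebra_simps)
qed

lemma ex_velocity:
  fixes m :: "real^2"
  assumes s: "s \<in> U"
  obtains v :: "real^2" where "m $ 1 = g11 s * v $ 1 + g12 s * v $ 2" "m $ 2 = g12 s * v $ 1 + g22 s * v $ 2"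
proof -
  let ?v = "vector [(g22 s * m $ 1 - g12 s * m $ 2) / dg s, (g11 s * m $ 2 - g12 s * m $ 1) / dg s] :: real^2"
  show thesis
    by (rule that[of ?v]) (use dg_pos[OF s] in \<open>auto simp: field_simps\<close>, (simp add: dg_def algebra_simps)+)
qed

lemma low_pairing:
  fixes m v :: "real^2"
  assumes "m $ 1 = g11 s * v $ 1 + g12 s * v $ 2" "m $ 2 = g12 s * v $ 1 + g22 s * v $ 2"
  shows "A s * m $ 1 + B s * m $ 2 = low1 A B s * v $ 1 + low2 A B s * v $ 2"
  unfolding assms low1_def low2_def by algebra

text \<open>
  Over each point the bracket condition is an identity between two cubic forms in the velocity.
\<close>

corollary bracket_condition_iff:
  assumes s: "s \<in> U" and A: "A differentiable (at s)" and B: "B differentiable (at s)"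
    and C: "C differentiable (at s)" and E: "E differentiable (at s)"
  shows "(\<forall>m. C s * m $ 1 + E s * m $ 2 \<noteq> 0 \<longrightarrow>
      poisson (fractional_linear A B C E) (geodesic_hamiltonian g) (s, m) = 0) \<longleftrightarrow>
    (\<forall>a b. low1 C E s * a + low2 C E s * b \<noteq> 0 \<longrightarrow>
      (low1 C E s * a + low2 C E s * b) * nabq (low1 A B) (low2 A B) s a b =
      (low1 A B s * a + low2 A B s * b) * nabq (low1 C E) (low2 C E) s a b)" (is "?L \<longleftrightarrow> ?R")
proof
  assume L: ?L
  show ?R
  proof (intro allI impI)
    fix a b assume ne: "low1 C E s * a + low2 C E s * b \<noteq> 0"
    define v m :: "real^2" where "v = vector [a, b]"
      and "m = vector [g11 s * a + g12 s * b, g12 s * a + g22 s * b]"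
    have m: "m $ 1 = g11 s * v $ 1 + g12 s * v $ 2" "m $ 2 = g12 s * v $ 1 + g22 s * v $ 2"
      and [simp]: "v $ 1 = a" "v $ 2 = b"
      by (simp_all add: v_def m_def)
    have ne': "C s * m $ 1 + E s * m $ 2 \<noteq> 0"
      using ne low_pairing[OF m, where A = C and B = E] by simp
    with L have "poisson (fractional_linear A B C E) (geodesic_hamiltonian g) (s, m) = 0" by blast
    then show "(low1 C E s * a + low2 C E s * b) * nabq (low1 A B) (low2 A B) s a b =
      (low1 A B s * a + low2 A B s * b) * nabq (low1 C E) (low2 C E) s a b"
      using ne' unfolding poisson_fractional_linear[OF s A B C E m ne']
      by (simp add: low_pairing[OF m, where A = C and B = E] low_pairing[OF m, where A = A and B = B])
  qed
next
  assume R: ?R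
  show ?L
  proof (intro allI impI)
    fix m :: "real^2" assume ne: "C s * m $ 1 + E s * m $ 2 \<noteq> 0"
    obtain v :: "real^2" where m: "m $ 1 = g11 s * v $ 1 + g12 s * v $ 2" "m $ 2 = g12 s * v $ 1 + g22 s * v $ 2"
      using ex_velocity[OF s] by blast
    show "poisson (fractional_linear A B C E) (geodesic_hamiltonian g) (s, m) = 0"
      using ne R[rule_format, of "v $ 1" "v $ 2"] unfolding poisson_fractional_linear[OF s A B C E m ne]
      by (simp add: low_pairing[OF m, where A = C and B = E] low_pairing[OF m, where A = A and B = B])
  qed
qed

end

section \<open>The form attached to an integral\<close>

text \<open>
  In terms of the basis \<open>(y2, - y1)\<close>, \<open>(- x2, x1)\<close>, which is dual to the two linear forms up to
  the factor \<open>d\<close>, the identity compares the coefficients of two binary cubics. The four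
  resulting equations leave of the eight numbers \<open>P\<close>, \<open>R\<close> only the freedom of two covectors
  \<open>a\<close> and \<open>b\<close>, whose components are mixed entries in this basis.
\<close>

lemma proportional_quadratics:
  fixes x1 x2 y1 y2 P11 P12 P21 P22 R11 R12 R21 R22 :: real
  assumes d: "d = x1 * y2 - x2 * y1" "d \<noteq> 0"
    and H: "\<And>u v. y1 * u + y2 * v \<noteq> 0 \<Longrightarrow>
      (y1 * u + y2 * v) * (P11 * u\<^sup>2 + (P12 + P21) * (u * v) + P22 * v\<^sup>2) =
      (x1 * u + x2 * v) * (R11 * u\<^sup>2 + (R12 + R21) * (u * v) + R22 * v\<^sup>2)"
  defines "p \<equiv> - P11 * y2 * x2 + P12 * y2 * x1 + P21 * y1 * x2 - P22 * y1 * x1"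
    and "r \<equiv> - R11 * x2 * y2 + R12 * x2 * y1 + R21 * x1 * y2 - R22 * x1 * y1"
  defines "b1 \<equiv> (r * x1 + p * y1) / d\<^sup>2" and "b2 \<equiv> (r * x2 + p * y2) / d\<^sup>2"
  shows "\<exists>a1 a2.
    (P11 = a1 * x1 + b1 * x1 \<and> P12 = a1 * x2 + b2 * x1 \<and> P21 = a2 * x1 + b1 * x2 \<and> P22 = a2 * x2 + b2 * x2) \<and>
    (R11 = a1 * y1 + b1 * y1 \<and> R12 = a1 * y2 + b2 * y1 \<and> R21 = a2 * y1 + b1 * y2 \<and> R22 = a2 * y2 + b2 * y2)"
proof -
  define p' where "p' = - P11 * y2 * x2 + P21 * y2 * x1 + P12 * y1 * x2 - P22 * y1 * x1"
  define r' where "r' = - R11 * x2 * y2 + R21 * x2 * y1 + R12 * x1 * y2 - R22 * x1 * y1"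
  define P where "P u v = P11 * u\<^sup>2 + (P12 + P21) * (u * v) + P22 * v\<^sup>2" for u v
  define R where "R u v = R11 * u\<^sup>2 + (R12 + R21) * (u * v) + R22 * v\<^sup>2" for u v
  \<comment> \<open>On \<open>c\<close> times the first plus the second basis vector the linear forms have the values \<open>c d\<close>
     and \<open>d\<close>. The four values 0, 1, -1, 2 of \<open>c\<close> determine the coefficients.\<close>
  have H': "P (c * y2 - x2) (x1 - c * y1) = c * R (c * y2 - x2) (x1 - c * y1)" for c
  proof -
    have *: "y1 * (c * y2 - x2) + y2 * (x1 - c * y1) = d" "x1 * (c * y2 - x2) + x2 * (x1 - c * y1) = c * d"
      unfolding d(1) by algebra+
    show ?thesis
      using H[of "c * y2 - x2" "x1 - c * y1"] d(2) unfolding * P_def[symmetric] R_def[symmetric] by simp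
  qed
  have e: "P (c * y2 - x2) (x1 - c * y1) = c\<^sup>2 * P y2 (- y1) + c * (p + p') + P (- x2) x1"
    "R (c * y2 - x2) (x1 - c * y1) = c\<^sup>2 * R y2 (- y1) + c * (r + r') + R (- x2) x1" for c
    unfolding P_def R_def p_def p'_def r_def r'_def by algebra+
  have P0: "P (- x2) x1 = 0"
    using H'[of 0] unfolding e by simp
  have c: "P y2 (- y1) = r + r'" "p + p' = R (- x2) x1" "R y2 (- y1) = 0"
    using H'[of 1] H'[of "-1"] H'[of 2] P0 unfolding e by (auto simp: power2_eq_square)
  have cs: "P11 * y2\<^sup>2 - (P12 + P21) * (y2 * y1) + P22 * y1\<^sup>2 = r + r'"
    "R11 * x2\<^sup>2 - (R12 + R21) * (x2 * x1) + R22 * x1\<^sup>2 = p + p'"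
    "R11 * y2\<^sup>2 - (R12 + R21) * (y2 * y1) + R22 * y1\<^sup>2 = 0"
    "P11 * x2\<^sup>2 - (P12 + P21) * (x2 * x1) + P22 * x1\<^sup>2 = 0"
    using c P0 by (simp_all add: P_def R_def)
  have "d\<^sup>2 * P11 = (r' * x1 + p' * y1) * x1 + (r * x1 + p * y1) * x1"
    "d\<^sup>2 * P12 = (r' * x1 + p' * y1) * x2 + (r * x2 + p * y2) * x1"
    "d\<^sup>2 * P21 = (r' * x2 + p' * y2) * x1 + (r * x1 + p * y1) * x2"
    "d\<^sup>2 * P22 = (r' * x2 + p' * y2) * x2 + (r * x2 + p * y2) * x2"
    using cs(1,4) unfolding d(1) p_def p'_def r_def r'_def by algebra+
  moreover have "d\<^sup>2 * R11 = (r' * x1 + p' * y1) * y1 + (r * x1 + p * y1) * y1"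
    "d\<^sup>2 * R12 = (r' * x1 + p' * y1) * y2 + (r * x2 + p * y2) * y1"
    "d\<^sup>2 * R21 = (r' * x2 + p' * y2) * y1 + (r * x1 + p * y1) * y2"
    "d\<^sup>2 * R22 = (r' * x2 + p' * y2) * y2 + (r * x2 + p * y2) * y2"
    using cs(2,3) unfolding d(1) p_def p'_def r_def r'_def by algebra+
  moreover have "z = u / d\<^sup>2 * a + w / d\<^sup>2 * b" if "d\<^sup>2 * z = u * a + w * b" for z u a w b
  proof -
    have "z = (d\<^sup>2 * z) / d\<^sup>2" using d(2) by simp
    then show ?thesis unfolding that by (simp add: add_divide_distrib)
  qed
  ultimately show ?thesis
    unfolding b1_def b2_def
    by (intro exI[of _ "(r' * x1 + p' * y1) / d\<^sup>2"] exI[of _ "(r' * x2 + p' * y2) / d\<^sup>2"] conjI)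
qed

context riemannian_domain
begin

text \<open>
  The equation $\nabla_i \xi_k = a_i \xi_k + b_k \xi_i$.
\<close>

definition nab_splits :: "real \<Rightarrow> real \<Rightarrow> real \<Rightarrow> real \<Rightarrow> (real^2 \<Rightarrow> real) \<Rightarrow> (real^2 \<Rightarrow> real) \<Rightarrow> real^2 \<Rightarrow> bool" where
  "nab_splits a1 a2 b1 b2 \<xi>1 \<xi>2 s \<longleftrightarrow>
     nab \<xi>1 \<xi>2 1 1 s = a1 * \<xi>1 s + b1 * \<xi>1 s \<and> nab \<xi>1 \<xi>2 1 2 s = a1 * \<xi>2 s + b2 * \<xi>1 s \<and>
     nab \<xi>1 \<xi>2 2 1 s = a2 * \<xi>1 s + b1 * \<xi>2 s \<and> nab \<xi>1 \<xi>2 2 2 s = a2 * \<xi>2 s + b2 * \<xi>2 s"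

text \<open>
  Mixed components of $\nabla x$ and $\nabla y$ in the frame dual to \<open>x\<close> and \<open>y\<close>, multiplied by the
  square of the determinant. They are the components of the covector \<open>b\<close> of \<open>nab_splits\<close> in the
  coframe \<open>x\<close>, \<open>y\<close>, and \<open>form1\<close>, \<open>form2\<close> are those in coordinates.
\<close>

definition "frameP x1 x2 y1 y2 s =
  - nab x1 x2 1 1 s * y2 s * x2 s + nab x1 x2 1 2 s * y2 s * x1 s + nab x1 x2 2 1 s * y1 s * x2 s - nab x1 x2 2 2 s * y1 s * x1 s"

definition "frameR x1 x2 y1 y2 s =
  - nab y1 y2 1 1 s * x2 s * y2 s + nab y1 y2 1 2 s * x2 s * y1 s + nab y1 y2 2 1 s * x1 s * y2 s - nab y1 y2 2 2 s * x1 s * y1 s"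

definition "form1 x1 x2 y1 y2 s =
  (frameR x1 x2 y1 y2 s * x1 s + frameP x1 x2 y1 y2 s * y1 s) / (x1 s * y2 s - x2 s * y1 s)\<^sup>2"
definition "form2 x1 x2 y1 y2 s =
  (frameR x1 x2 y1 y2 s * x2 s + frameP x1 x2 y1 y2 s * y2 s) / (x1 s * y2 s - x2 s * y1 s)\<^sup>2"

lemma bracket_condition_splits:
  assumes d: "x1 s * y2 s - x2 s * y1 s \<noteq> 0"
    and H: "\<forall>a b. y1 s * a + y2 s * b \<noteq> 0 \<longrightarrow>
      (y1 s * a + y2 s * b) * nabq x1 x2 s a b = (x1 s * a + x2 s * b) * nabq y1 y2 s a b"
  obtains a1 a2 where
    "nab_splits a1 a2 (form1 x1 x2 y1 y2 s) (form2 x1 x2 y1 y2 s) x1 x2 s"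
    "nab_splits a1 a2 (form1 x1 x2 y1 y2 s) (form2 x1 x2 y1 y2 s) y1 y2 s"
proof -
  show thesis
    using proportional_quadratics[OF refl d H[unfolded nabq_def, rule_format]] that
    unfolding nab_splits_def form1_def form2_def frameP_def frameR_def by blast
qed

text \<open>
  The contractions $\Gamma^l_{il}$, which are the derivatives of $\log\sqrt{\det g}$.
\<close>

definition "tr1 s = \<Gamma> 1 1 1 s + \<Gamma> 2 1 2 s"
definition "tr2 s = \<Gamma> 1 1 2 s + \<Gamma> 2 2 2 s"

lemma pd_dg:
  assumes s: "s \<in> U"
  shows "pd 1 dg s = 2 * tr1 s * dg s" "pd 2 dg s = 2 * tr2 s * dg s"
proof -
  have p: "pd i dg s = pd i g11 s * g22 s + g11 s * pd i g22 s - 2 * g12 s * pd i g12 s" for i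
    unfolding dg_def[abs_def] using s by (simp add: pd_simps)
  show "pd 1 dg s = 2 * tr1 s * dg s" "pd 2 dg s = 2 * tr2 s * dg s"
    unfolding p pd_metric[OF s] tr1_def tr2_def dg_def[of s] by algebra+
qed

lemma nab_splits_pd:
  assumes "s \<in> U" "nab_splits a1 a2 b1 b2 x1 x2 s"
  shows "pd 1 x1 s = \<Gamma> 1 1 1 s * x1 s + \<Gamma> 2 1 1 s * x2 s + (a1 * x1 s + b1 * x1 s)"
    "pd 1 x2 s = \<Gamma> 1 1 2 s * x1 s + \<Gamma> 2 1 2 s * x2 s + (a1 * x2 s + b2 * x1 s)"
    "pd 2 x1 s = \<Gamma> 1 1 2 s * x1 s + \<Gamma> 2 1 2 s * x2 s + (a2 * x1 s + b1 * x2 s)"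
    "pd 2 x2 s = \<Gamma> 1 2 2 s * x1 s + \<Gamma> 2 2 2 s * x2 s + (a2 * x2 s + b2 * x2 s)"
  using assms unfolding nab_splits_def nab_def by (auto simp: christoffel_expand(7,8) algebra_simps)

text \<open>
  The unimodularity of the vector fields makes the determinant of the two forms equal to that
  of the metric; its logarithmic derivative is the trace of the equations for the forms.
\<close>

lemma nab_splits_trace:
  assumes V: "open V" "V \<subseteq> U" "s \<in> V"
    and diff: "x1 differentiable (at s)" "x2 differentiable (at s)" "y1 differentiable (at s)" "y2 differentiable (at s)"
    and det: "\<And>t. t \<in> V \<Longrightarrow> x1 t * y2 t - x2 t * y1 t = dg t"
    and x: "nab_splits a1 a2 b1 b2 x1 x2 s" and y: "nab_splits a1 a2 b1 b2 y1 y2 s"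
  shows "a1 = (tr1 s - b1) / 2" "a2 = (tr2 s - b2) / 2"
proof -
  have s: "s \<in> U" using V by blast
  have p: "pd i dg s = pd i x1 s * y2 s + x1 s * pd i y2 s - (pd i x2 s * y1 s + x2 s * pd i y1 s)" for i
  proof -
    have "pd i dg s = pd i (\<lambda>t. x1 t * y2 t - x2 t * y1 t) s"
      by (rule pd_cong[OF V(1,3)]) (use det diff in auto)
    then show ?thesis using diff by (simp add: pd_simps)
  qed
  have ne: "dg s \<noteq> 0" using dg_pos[OF s] by simp
  have "dg s * (2 * a1) = dg s * (tr1 s - b1)"
    using p[of 1] det[OF V(3)]
    unfolding nab_splits_pd[OF s x] nab_splits_pd[OF s y] pd_dg[OF s] tr1_def by algebra
  with ne show "a1 = (tr1 s - b1) / 2" by simp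
  have "dg s * (2 * a2) = dg s * (tr2 s - b2)"
    using p[of 2] det[OF V(3)]
    unfolding nab_splits_pd[OF s x] nab_splits_pd[OF s y] pd_dg[OF s] tr2_def by algebra
  with ne show "a2 = (tr2 s - b2) / 2" by simp
qed

lemma smooth_nab:
  assumes "open V" "V \<subseteq> U" "smooth_on V x1" "smooth_on V x2"
  shows "smooth_on V (nab x1 x2 i k)"
  unfolding nab_def[abs_def] using assms smooth_on_subset[OF smooth_christoffel]
  by (auto intro!: smooth_on_diff smooth_on_mult smooth_on_pd)

lemma smooth_form:
  assumes V: "open V" "V \<subseteq> U" and sm: "smooth_on V x1" "smooth_on V x2" "smooth_on V y1" "smooth_on V y2"
    and d: "\<And>t. t \<in> V \<Longrightarrow> x1 t * y2 t - x2 t * y1 t \<noteq> 0"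
  shows "smooth_on V (form1 x1 x2 y1 y2)" "smooth_on V (form2 x1 x2 y1 y2)"
proof -
  have "smooth_on V (frameP x1 x2 y1 y2)" "smooth_on V (frameR x1 x2 y1 y2)"
    unfolding frameP_def[abs_def] frameR_def[abs_def]
    using V sm by (intro smooth_intros smooth_nab; simp)+
  then show "smooth_on V (form1 x1 x2 y1 y2)" "smooth_on V (form2 x1 x2 y1 y2)"
    unfolding form1_def[abs_def] form2_def[abs_def]
    using V sm d by (intro smooth_on_divide smooth_intros; simp)+
qed

text \<open>
  The equation $\nabla_{(i} \beta_{k)} = \beta_i \beta_k + K g_{ik}$, which the covector \<open>b\<close> of an
  integral satisfies.
\<close>

definition integral_form :: "(real^2) set \<Rightarrow> (real^2 \<Rightarrow> real) \<Rightarrow> (real^2 \<Rightarrow> real) \<Rightarrow> bool" where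
  "integral_form V b1 b2 \<longleftrightarrow> smooth_on V b1 \<and> smooth_on V b2 \<and>
     (\<forall>s\<in>V. pd 1 b1 s = \<Gamma> 1 1 1 s * b1 s + \<Gamma> 2 1 1 s * b2 s + b1 s * b1 s + K s * g11 s \<and>
            pd 2 b2 s = \<Gamma> 1 2 2 s * b1 s + \<Gamma> 2 2 2 s * b2 s + b2 s * b2 s + K s * g22 s \<and>
            pd 1 b2 s + pd 2 b1 s = 2 * (\<Gamma> 1 1 2 s * b1 s + \<Gamma> 2 1 2 s * b2 s + b1 s * b2 s + K s * g12 s))"

text \<open>
  Both forms are parallel for the connection
  $\xi \mapsto \nabla_i \xi_k - \alpha_i \xi_k - \beta_k \xi_i$. As they are independent, it is
  flat. The form $\alpha$ contributes the multiple $d\alpha$ of the identity to the curvature, and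
  the three components from which it drops out are the equations for $\beta$.
\<close>

lemma integral_formI:
  assumes V: "open V" "V \<subseteq> U" and sm: "smooth_on V x1" "smooth_on V x2" "smooth_on V y1" "smooth_on V y2"
    and b: "smooth_on V b1" "smooth_on V b2" and a: "smooth_on V a1" "smooth_on V a2"
    and det: "\<And>s. s \<in> V \<Longrightarrow> x1 s * y2 s - x2 s * y1 s \<noteq> 0"
    and x: "\<And>s. s \<in> V \<Longrightarrow> nab_splits (a1 s) (a2 s) (b1 s) (b2 s) x1 x2 s"
    and y: "\<And>s. s \<in> V \<Longrightarrow> nab_splits (a1 s) (a2 s) (b1 s) (b2 s) y1 y2 s"
  shows "integral_form V b1 b2"
  unfolding integral_form_def
proof (intro conjI ballI b)
  fix s assume sV: "s \<in> V"
  then have s: "s \<in> U" using V by blast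
  define d\<alpha> where "d\<alpha> = pd 1 a2 s - pd 2 a1 s"
  \<comment> \<open>These are $\nabla_i\beta_k - \beta_i\beta_k - K g_{ik}$.\<close>
  define M11 where "M11 = pd 1 b1 s - (\<Gamma> 1 1 1 s * b1 s + \<Gamma> 2 1 1 s * b2 s + b1 s * b1 s + K s * g11 s)"
  define M12 where "M12 = pd 1 b2 s - (\<Gamma> 1 1 2 s * b1 s + \<Gamma> 2 1 2 s * b2 s + b1 s * b2 s + K s * g12 s)"
  define M21 where "M21 = pd 2 b1 s - (\<Gamma> 1 1 2 s * b1 s + \<Gamma> 2 1 2 s * b2 s + b1 s * b2 s + K s * g12 s)"
  define M22 where "M22 = pd 2 b2 s - (\<Gamma> 1 2 2 s * b1 s + \<Gamma> 2 2 2 s * b2 s + b2 s * b2 s + K s * g22 s)"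
  have curv: "(d\<alpha> - M21) * \<xi>1 s + M11 * \<xi>2 s = 0 \<and> (d\<alpha> + M12) * \<xi>2 s - M22 * \<xi>1 s = 0"
    if \<xi>: "smooth_on V \<xi>1" "smooth_on V \<xi>2"
      and sp: "\<And>s. s \<in> V \<Longrightarrow> nab_splits (a1 s) (a2 s) (b1 s) (b2 s) \<xi>1 \<xi>2 s" for \<xi>1 \<xi>2
  proof -
    have sp': "nab_splits (a1 t) (a2 t) (b1 t) (b2 t) \<xi>1 \<xi>2 t" "t \<in> U" if "t \<in> V" for t
      using sp that V by auto
    note [simp] = smooth_on_differentiable[OF a(1) sV] smooth_on_differentiable[OF a(2) sV]
      smooth_on_differentiable[OF b(1) sV] smooth_on_differentiable[OF b(2) sV]
      smooth_on_differentiable[OF \<xi>(1) sV] smooth_on_differentiable[OF \<xi>(2) sV] s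
    have pps: "pd 1 (pd 2 \<xi>1) s = pd 1 (\<lambda>t. \<Gamma> 1 1 2 t * \<xi>1 t + \<Gamma> 2 1 2 t * \<xi>2 t + (a2 t * \<xi>1 t + b1 t * \<xi>2 t)) s"
      "pd 2 (pd 1 \<xi>1) s = pd 2 (\<lambda>t. \<Gamma> 1 1 1 t * \<xi>1 t + \<Gamma> 2 1 1 t * \<xi>2 t + (a1 t * \<xi>1 t + b1 t * \<xi>1 t)) s"
      "pd 1 (pd 2 \<xi>2) s = pd 1 (\<lambda>t. \<Gamma> 1 2 2 t * \<xi>1 t + \<Gamma> 2 2 2 t * \<xi>2 t + (a2 t * \<xi>2 t + b2 t * \<xi>2 t)) s"
      "pd 2 (pd 1 \<xi>2) s = pd 2 (\<lambda>t. \<Gamma> 1 1 2 t * \<xi>1 t + \<Gamma> 2 1 2 t * \<xi>2 t + (a1 t * \<xi>2 t + b2 t * \<xi>1 t)) s"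
      using nab_splits_pd[OF sp'(2) sp'(1)] by (auto intro!: pd_pd_cong[OF V(1) sV] \<xi>)
    note p = nab_splits_pd[OF s sp[OF sV]]
    have "pd 1 (pd 2 \<xi>1) s = pd 2 (pd 1 \<xi>1) s" "pd 1 (pd 2 \<xi>2) s = pd 2 (pd 1 \<xi>2) s"
      using pd_commute[OF V(1) _ sV] \<xi> by blast+
    then show ?thesis
      unfolding pps by (simp_all add: pd_simps p pd2_christoffel)
        (simp add: d\<alpha>_def M11_def M12_def M21_def M22_def algebra_simps)
  qed
  have elim: "p = 0 \<and> q = 0" if "p * x1 s + q * x2 s = 0" "p * y1 s + q * y2 s = 0" for p q
  proof -
    have "(x1 s * y2 s - x2 s * y1 s) * p = 0" "(x1 s * y2 s - x2 s * y1 s) * q = 0"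
      using that by algebra+
    then show ?thesis using det[OF sV] by simp
  qed
  have "d\<alpha> - M21 = 0 \<and> M11 = 0" "- M22 = 0 \<and> d\<alpha> + M12 = 0"
    using curv[OF sm(1,2) x] curv[OF sm(3,4) y] by (intro elim; simp)+
  then have "M11 = 0" "M22 = 0" "M12 + M21 = 0" by simp_all
  then show "pd 1 b1 s = \<Gamma> 1 1 1 s * b1 s + \<Gamma> 2 1 1 s * b2 s + b1 s * b1 s + K s * g11 s"
    "pd 2 b2 s = \<Gamma> 1 2 2 s * b1 s + \<Gamma> 2 2 2 s * b2 s + b2 s * b2 s + K s * g22 s"
    "pd 1 b2 s + pd 2 b1 s = 2 * (\<Gamma> 1 1 2 s * b1 s + \<Gamma> 2 1 2 s * b2 s + b1 s * b2 s + K s * g12 s)"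
    unfolding M11_def M12_def M21_def M22_def by algebra+
qed

end

section \<open>Several integrals force constant curvature\<close>

context riemannian_domain
begin

text \<open>The coordinate components of \<open>det g\<close> times the gradient of the curvature.\<close>

definition "gradP s = g22 s * pd 1 K s - g12 s * pd 2 K s"
definition "gradQ s = g11 s * pd 2 K s - g12 s * pd 1 K s"

text \<open>This is $-\det g\,\Delta K$.\<close>

definition "div_grad s = tr1 s * gradP s + tr2 s * gradQ s - pd 1 gradP s - pd 2 gradQ s"

lemma smooth_grad: "smooth_on U gradP" "smooth_on U gradQ"
  unfolding gradP_def[abs_def] gradQ_def[abs_def]
  by (intro smooth_intros open_U smooth_on_pd smooth_geometry)+

lemma gradient_zeroD:
  assumes "s \<in> U" "gradP s = 0" "gradQ s = 0"
  shows "pd 1 K s = 0" "pd 2 K s = 0"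
proof -
  have "dg s * pd 1 K s = 0" "dg s * pd 2 K s = 0"
    using assms(2,3) unfolding gradP_def gradQ_def dg_def by algebra+
  then show "pd 1 K s = 0" "pd 2 K s = 0"
    using dg_pos[OF assms(1)] by simp_all
qed

text \<open>
  For an integral form \<open>\<beta>\<close>, write $d\beta = 2w\,dx\wedge dy$. The compatibility conditions of the
  equation for \<open>\<beta>\<close> express the derivatives of \<open>w\<close> through \<open>\<beta>\<close>, \<open>w\<close> and the gradient of \<open>K\<close>.
\<close>

definition "curl b1 b2 s = (pd 1 b2 s - pd 2 b1 s) / 2"

context
  fixes V b1 b2
  assumes V: "open V" "V \<subseteq> U" and form: "integral_form V b1 b2"
begin

lemma smooth_b: "smooth_on V b1" "smooth_on V b2"
  using form by (simp_all add: integral_form_def)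

lemma smooth_curl: "smooth_on V (curl b1 b2)"
  unfolding curl_def[abs_def] divide_inverse
  by (intro smooth_intros V smooth_on_pd smooth_b)

lemma pd_b:
  assumes "s \<in> V"
  shows "pd 1 b1 s = \<Gamma> 1 1 1 s * b1 s + \<Gamma> 2 1 1 s * b2 s + b1 s * b1 s + K s * g11 s"
    "pd 1 b2 s = \<Gamma> 1 1 2 s * b1 s + \<Gamma> 2 1 2 s * b2 s + b1 s * b2 s + K s * g12 s + curl b1 b2 s"
    "pd 2 b1 s = \<Gamma> 1 1 2 s * b1 s + \<Gamma> 2 1 2 s * b2 s + b1 s * b2 s + K s * g12 s - curl b1 b2 s"
    "pd 2 b2 s = \<Gamma> 1 2 2 s * b1 s + \<Gamma> 2 2 2 s * b2 s + b2 s * b2 s + K s * g22 s"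
  using form assms unfolding integral_form_def curl_def by (auto simp: field_simps)

lemma pd_curl:
  assumes s: "s \<in> V"
  shows "pd 1 (curl b1 b2) s = 3 * curl b1 b2 s * b1 s + tr1 s * curl b1 b2 s - gradQ s"
    "pd 2 (curl b1 b2) s = 3 * curl b1 b2 s * b2 s + tr2 s * curl b1 b2 s + gradP s"
proof -
  have sU: "s \<in> U" using s V by blast
  note [simp] = smooth_on_differentiable[OF smooth_b(1) s] smooth_on_differentiable[OF smooth_b(2) s]
    smooth_on_differentiable[OF smooth_curl s] sU
  have c: "pd 1 (pd 2 b1) s = pd 2 (pd 1 b1) s" "pd 1 (pd 2 b2) s = pd 2 (pd 1 b2) s"
    using pd_commute[OF V(1) _ s] smooth_b by blast+
  show "pd 1 (curl b1 b2) s = 3 * curl b1 b2 s * b1 s + tr1 s * curl b1 b2 s - gradQ s"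
    using c(1)
    by (simp add: pd_pd_cong[OF V(1) s smooth_b(1) pd_b(1)] pd_pd_cong[OF V(1) s smooth_b(1) pd_b(3)] pd_simps
        pd_b[OF s] pd_metric[OF sU] pd2_christoffel[OF sU])
      (simp add: gradQ_def tr1_def algebra_simps)
  show "pd 2 (curl b1 b2) s = 3 * curl b1 b2 s * b2 s + tr2 s * curl b1 b2 s + gradP s"
    using c(2)
    by (simp add: pd_pd_cong[OF V(1) s smooth_b(2) pd_b(2)] pd_pd_cong[OF V(1) s smooth_b(2) pd_b(4)] pd_simps
        pd_b[OF s] pd_metric[OF sU] pd2_christoffel[OF sU])
      (simp add: gradP_def tr2_def algebra_simps)
qed

text \<open>
  The integrability condition for \<open>w\<close>.
\<close>

lemma curl_squared:
  assumes s: "s \<in> V"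
  shows "6 * (curl b1 b2 s * curl b1 b2 s) = 3 * (gradP s * b1 s + gradQ s * b2 s) + div_grad s"
proof -
  have sU: "s \<in> U" using s V by blast
  note [simp] = smooth_on_differentiable[OF smooth_b(1) s] smooth_on_differentiable[OF smooth_b(2) s]
    smooth_on_differentiable[OF smooth_curl s] sU smooth_on_differentiable[OF smooth_grad(1) sU]
    smooth_on_differentiable[OF smooth_grad(2) sU]
  have [simp]: "tr1 differentiable (at s)" "tr2 differentiable (at s)"
    unfolding tr1_def[abs_def] tr2_def[abs_def] by simp_all
  have tr: "pd 1 tr2 s = pd 2 tr1 s"
    unfolding tr1_def[abs_def] tr2_def[abs_def]
    by (simp add: pd_simps pd2_christoffel[OF sU])
  have "pd 1 (pd 2 (curl b1 b2)) s = pd 2 (pd 1 (curl b1 b2)) s"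
    using pd_commute[OF V(1) smooth_curl s] by blast
  then show ?thesis
    by (simp add: pd_pd_cong[OF V(1) s smooth_curl pd_curl(1)] pd_pd_cong[OF V(1) s smooth_curl pd_curl(2)] pd_simps
        pd_b[OF s] pd_curl[OF s] tr)
      (simp add: div_grad_def algebra_simps)
qed

end

text \<open>
  Differentiating once more, in the direction of the gradient, eliminates \<open>w\<close>: a quadratic
  equation for the values of \<open>\<beta>\<close> remains, with coefficients that depend on the metric alone and
  whose quadratic part is the square of \<open>\<beta>\<close> evaluated on the gradient.
\<close>

lemma integral_form_quadratic:
  assumes sU: "s \<in> U"
  obtains a1 a2 c :: real where
    "\<And>V b1 b2. open V \<Longrightarrow> V \<subseteq> U \<Longrightarrow> s \<in> V \<Longrightarrow> integral_form V b1 b2 \<Longrightarrow>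
      15 * (gradP s * b1 s + gradQ s * b2 s)\<^sup>2 + a1 * b1 s + a2 * b2 s + c = 0"
proof -
  define T where "T = tr1 s * gradP s + tr2 s * gradQ s"
  define a1 where "a1 = 6 * (div_grad s + T) * gradP s
    - 3 * ((gradP s)\<^sup>2 * \<Gamma> 1 1 1 s + 2 * (gradP s * gradQ s) * \<Gamma> 1 1 2 s + (gradQ s)\<^sup>2 * \<Gamma> 1 2 2 s)
    - 3 * (gradP s * pd 1 gradP s + gradQ s * pd 2 gradP s)"
  define a2 where "a2 = 6 * (div_grad s + T) * gradQ s
    - 3 * ((gradP s)\<^sup>2 * \<Gamma> 2 1 1 s + 2 * (gradP s * gradQ s) * \<Gamma> 2 1 2 s + (gradQ s)\<^sup>2 * \<Gamma> 2 2 2 s)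
    - 3 * (gradP s * pd 1 gradQ s + gradQ s * pd 2 gradQ s)"
  define c where "c = 2 * div_grad s * T
    - 3 * K s * ((gradP s)\<^sup>2 * g11 s + 2 * (gradP s * gradQ s) * g12 s + (gradQ s)\<^sup>2 * g22 s)
    - gradP s * pd 1 div_grad s - gradQ s * pd 2 div_grad s"
  show thesis
  proof (rule that[of a1 a2 c])
    fix V b1 b2 assume V: "open V" "V \<subseteq> U" "s \<in> V" and form: "integral_form V b1 b2"
    let ?w = "curl b1 b2"
    have "smooth_on U div_grad"
      unfolding div_grad_def[abs_def] tr1_def[abs_def] tr2_def[abs_def]
      by (intro smooth_intros open_U smooth_on_pd smooth_geometry smooth_grad)
    then have [simp]: "div_grad differentiable (at s)"
      using smooth_on_differentiable sU by blast
    note [simp] = smooth_on_differentiable[OF smooth_b(1)[OF V(1,2) form] V(3)]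
      smooth_on_differentiable[OF smooth_b(2)[OF V(1,2) form] V(3)]
      smooth_on_differentiable[OF smooth_curl[OF V(1,2) form] V(3)] smooth_on_differentiable[OF smooth_grad(1) sU]
      smooth_on_differentiable[OF smooth_grad(2) sU]
    have d: "pd i (\<lambda>t. 6 * (?w t * ?w t)) s =
        pd i (\<lambda>t. 3 * (gradP t * b1 t + gradQ t * b2 t) + div_grad t) s" for i
      by (rule pd_cong[OF V(1,3)]) (use curl_squared[OF V(1,2) form] in auto)
    have d': "12 * (?w s * pd i ?w s) = 3 * (pd i gradP s * b1 s + gradP s * pd i b1 s +
        (pd i gradQ s * b2 s + gradQ s * pd i b2 s)) + pd i div_grad s" for i
      using d[of i] by (simp add: pd_simps)
    show "15 * (gradP s * b1 s + gradQ s * b2 s)\<^sup>2 + a1 * b1 s + a2 * b2 s + c = 0"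
      using d'[of 1] d'[of 2] curl_squared[OF V(1,2) form V(3)]
      unfolding pd_b[OF V(1,2) form V(3)] pd_curl[OF V(1,2) form V(3)] a1_def a2_def c_def T_def
      by algebra
  qed
qed

end

text \<open>
  The hypothesis \<open>span\<close> says that \<open>(x0, y0)\<close> lies inside the triangle of the other points. After
  subtraction of the equation at this point, a linear form takes at the differences \<open>d\<close> to the
  vertices the values $-((p, q) \cdot d)^2$. Some positive combination of the three
  differences is zero, hence so is the same combination of these squares.
\<close>

lemma square_plus_affine_zero:
  fixes x0 x1 x2 x3 y0 y1 y2 y3 p q a1 a2 c :: real
  assumes 0: "(p * x0 + q * y0)\<^sup>2 + a1 * x0 + a2 * y0 + c = 0"
    and 1: "(p * x1 + q * y1)\<^sup>2 + a1 * x1 + a2 * y1 + c = 0"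
    and 2: "(p * x2 + q * y2)\<^sup>2 + a1 * x2 + a2 * y2 + c = 0"
    and 3: "(p * x3 + q * y3)\<^sup>2 + a1 * x3 + a2 * y3 + c = 0"
    and span: "(x1 - x0) * (y2 - y0) - (x2 - x0) * (y1 - y0) > 0"
      "(x2 - x0) * (y3 - y0) - (x3 - x0) * (y2 - y0) > 0"
      "(x3 - x0) * (y1 - y0) - (x1 - x0) * (y3 - y0) > 0"
  shows "p = 0" "q = 0"
proof -
  define u1 v1 u2 v2 u3 v3 where uv: "u1 = x1 - x0" "v1 = y1 - y0" "u2 = x2 - x0" "v2 = y2 - y0"
    "u3 = x3 - x0" "v3 = y3 - y0"
  define l1 l2 where l: "l1 = a1 + 2 * (p * x0 + q * y0) * p" "l2 = a2 + 2 * (p * x0 + q * y0) * q"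
  have e: "(p * u1 + q * v1)\<^sup>2 = - (l1 * u1 + l2 * v1)" "(p * u2 + q * v2)\<^sup>2 = - (l1 * u2 + l2 * v2)"
    "(p * u3 + q * v3)\<^sup>2 = - (l1 * u3 + l2 * v3)"
    using 0 1 2 3 unfolding uv l by algebra+
  \<comment> \<open>the barycentric coordinates of the inner point, up to a common factor\<close>
  define m1 m2 m3 where m: "m1 = u2 * v3 - u3 * v2" "m2 = u3 * v1 - u1 * v3" "m3 = u1 * v2 - u2 * v1"
  have pos: "m1 > 0" "m2 > 0" "m3 > 0" using span unfolding m uv by auto
  have "m1 * (p * u1 + q * v1)\<^sup>2 + m2 * (p * u2 + q * v2)\<^sup>2 + m3 * (p * u3 + q * v3)\<^sup>2 = 0"
    unfolding e m by algebra
  moreover have "m1 * (p * u1 + q * v1)\<^sup>2 \<ge> 0" "m2 * (p * u2 + q * v2)\<^sup>2 \<ge> 0" "m3 * (p * u3 + q * v3)\<^sup>2 \<ge> 0"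
    using pos by simp_all
  ultimately have "m1 * (p * u1 + q * v1)\<^sup>2 = 0" "m2 * (p * u2 + q * v2)\<^sup>2 = 0" by linarith+
  then have z: "p * u1 + q * v1 = 0" "p * u2 + q * v2 = 0" using pos by simp_all
  have "m3 * p = 0" "m3 * q = 0" using z unfolding m by algebra+
  then show "p = 0" "q = 0" using pos by simp_all
qed

context riemannian_domain
begin

lemma four_forms_gradient_zero:
  assumes V: "open V" "V \<subseteq> U" and sV: "s \<in> V"
    and f: "integral_form V x0 y0" "integral_form V x1 y1" "integral_form V x2 y2" "integral_form V x3 y3"
    and span: "(x1 s - x0 s) * (y2 s - y0 s) - (x2 s - x0 s) * (y1 s - y0 s) > 0"
      "(x2 s - x0 s) * (y3 s - y0 s) - (x3 s - x0 s) * (y2 s - y0 s) > 0"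
      "(x3 s - x0 s) * (y1 s - y0 s) - (x1 s - x0 s) * (y3 s - y0 s) > 0"
  shows "pd 1 K s = 0" "pd 2 K s = 0"
proof -
  have s: "s \<in> U" using V sV by blast
  obtain a1 a2 c :: real where
    q: "\<And>V b1 b2. open V \<Longrightarrow> V \<subseteq> U \<Longrightarrow> s \<in> V \<Longrightarrow> integral_form V b1 b2 \<Longrightarrow>
      15 * (gradP s * b1 s + gradQ s * b2 s)\<^sup>2 + a1 * b1 s + a2 * b2 s + c = 0"
    using integral_form_quadratic[OF s] by blast
  have q': "(gradP s * b1 s + gradQ s * b2 s)\<^sup>2 + a1 / 15 * b1 s + a2 / 15 * b2 s + c / 15 = 0"
    if "integral_form V b1 b2" for b1 b2
    using q[OF V sV that] by simp
  have "gradP s = 0" "gradQ s = 0"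
    using square_plus_affine_zero[OF q'[OF f(1)] q'[OF f(2)] q'[OF f(3)] q'[OF f(4)] span] by blast+
  then show "pd 1 K s = 0" "pd 2 K s = 0" using gradient_zeroD[OF s] by blast+
qed

lemma integral_form_subset: "integral_form V b1 b2 \<Longrightarrow> W \<subseteq> V \<Longrightarrow> integral_form W b1 b2"
  unfolding integral_form_def using smooth_on_subset by blast

text \<open>
  The position of the four values is an open condition, so what \<open>four_forms_gradient_zero\<close> says
  at \<open>s0\<close> holds on a whole neighbourhood.
\<close>

lemma curvature_locally_constant:
  assumes V: "open V" "V \<subseteq> U" and s0: "s0 \<in> V"
    and f: "integral_form V x0 y0" "integral_form V x1 y1" "integral_form V x2 y2" "integral_form V x3 y3"
    and span: "(x1 s0 - x0 s0) * (y2 s0 - y0 s0) - (x2 s0 - x0 s0) * (y1 s0 - y0 s0) > 0"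
      "(x2 s0 - x0 s0) * (y3 s0 - y0 s0) - (x3 s0 - x0 s0) * (y2 s0 - y0 s0) > 0"
      "(x3 s0 - x0 s0) * (y1 s0 - y0 s0) - (x1 s0 - x0 s0) * (y3 s0 - y0 s0) > 0"
  shows "\<exists>W c. open W \<and> s0 \<in> W \<and> W \<subseteq> U \<and> (\<forall>s\<in>W. K s = c)"
proof -
  define W where "W = {s \<in> V.
    (x1 s - x0 s) * (y2 s - y0 s) - (x2 s - x0 s) * (y1 s - y0 s) > 0 \<and>
    (x2 s - x0 s) * (y3 s - y0 s) - (x3 s - x0 s) * (y2 s - y0 s) > 0 \<and>
    (x3 s - x0 s) * (y1 s - y0 s) - (x1 s - x0 s) * (y3 s - y0 s) > 0}"
  note cont = f[unfolded integral_form_def, THEN conjunct1, THEN smooth_on_continuous]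
    f[unfolded integral_form_def, THEN conjunct2, THEN conjunct1, THEN smooth_on_continuous]
  have pos_open: "open {s \<in> V. h s > 0}" if "continuous_on V h" for h :: "real^2 \<Rightarrow> real"
    using continuous_open_preimage[OF that V(1), of "{0<..}"]
    by (simp add: vimage_def Int_def)
  have "W = {s \<in> V. (x1 s - x0 s) * (y2 s - y0 s) - (x2 s - x0 s) * (y1 s - y0 s) > 0} \<inter>
    {s \<in> V. (x2 s - x0 s) * (y3 s - y0 s) - (x3 s - x0 s) * (y2 s - y0 s) > 0} \<inter>
    {s \<in> V. (x3 s - x0 s) * (y1 s - y0 s) - (x1 s - x0 s) * (y3 s - y0 s) > 0}"
    unfolding W_def by blast
  also have "open \<dots>"
    by (intro open_Int pos_open continuous_intros cont)
  finally have "open W" .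
  moreover have "s0 \<in> W" using s0 span by (simp add: W_def)
  ultimately obtain r where r: "r > 0" "ball s0 r \<subseteq> W"
    using open_contains_ball by blast
  have "(K has_derivative (\<lambda>h. 0)) (at s within ball s0 r)" if "s \<in> ball s0 r" for s
  proof -
    have "s \<in> W" using that r by blast
    then have "pd 1 K s = 0" "pd 2 K s = 0" "s \<in> U"
      using four_forms_gradient_zero[OF V _ f] V unfolding W_def by auto
    then show ?thesis
      using has_derivative_pd[of K s] by (auto intro: has_derivative_at_withinI)
  qed
  then obtain c where "\<And>s. s \<in> ball s0 r \<Longrightarrow> K s = c"
    using has_derivative_zero_constant[of "ball s0 r" K] by auto
  then show ?thesis
    using r V by (intro exI[of _ "ball s0 r"] exI[of _ c]) (auto simp: W_def)
qed

end

section \<open>Flat linear total differential systems\<close>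

lemma ray_in_cball:
  fixes s x :: "'a::real_normed_vector"
  assumes "t \<in> {0..1}" "x \<in> cball 0 r"
  shows "s + t *\<^sub>R x \<in> cball s r" "t *\<^sub>R x \<in> cball 0 r"
proof -
  have "\<bar>t\<bar> * norm x \<le> 1 * r"
    using assms by (intro mult_mono) auto
  then show "s + t *\<^sub>R x \<in> cball s r" "t *\<^sub>R x \<in> cball 0 r"
    by (simp_all add: dist_norm)
qed

lemma integral_stretch01:
  fixes f :: "real \<Rightarrow> 'a::banach"
  assumes f: "continuous_on {0..1} f" and t: "t \<in> {0..1}"
  shows "integral {0..1} (\<lambda>\<tau>. t *\<^sub>R f (\<tau> * t)) = integral {0..t} f"
proof -
  let ?G = "\<lambda>u. integral {0..u} f"
  have sub: "(\<lambda>\<tau>. \<tau> * t) ` {0..1} \<subseteq> {0..1}"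
    using t by (auto intro: mult_le_one)
  have "((\<lambda>\<tau>. ?G (\<tau> * t)) has_vector_derivative t *\<^sub>R f (\<tau> * t)) (at \<tau> within {0..1})"
    if "\<tau> \<in> {0..1}" for \<tau>
  proof -
    have "(?G has_vector_derivative f (\<tau> * t)) (at (\<tau> * t) within {0..1})"
      by (rule integral_has_vector_derivative[OF f subsetD[OF sub imageI[OF that]]])
    then have "(?G has_vector_derivative f (\<tau> * t)) (at (\<tau> * t) within (\<lambda>\<tau>. \<tau> * t) ` {0..1})"
      using sub by (rule has_vector_derivative_within_subset)
    moreover have "((\<lambda>\<tau>. \<tau> * t) has_vector_derivative t) (at \<tau> within {0..1})"
      by (auto intro!: derivative_eq_intros)
    ultimately show ?thesis
      using vector_diff_chain_within by (fastforce simp: o_def)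
  qed
  from integral_unique[OF fundamental_theorem_of_calculus[OF _ this]]
  have "integral {0..1} (\<lambda>\<tau>. t *\<^sub>R f (\<tau> * t)) = ?G (1 * t) - ?G (0 * t)"
    by (simp only: zero_le_one)
  then show ?thesis by (simp only: mult_1 mult_zero_left integral_refl box_real[symmetric] diff_zero)
qed

text \<open>
  Along every ray through the origin a solution satisfies a linear ordinary differential
  equation. On a small ball all these equations are solved at once by a contraction of the
  space of bounded continuous functions; the nearest point projection onto the ball makes the
  integrand a function on the whole plane.
\<close>

lemma radial_fixpoint:
  fixes N :: "real^2 \<Rightarrow> real^2 \<Rightarrow> 'f::euclidean_space \<Rightarrow> 'f"
  assumes r: "r \<ge> 0" "L \<ge> 0" "L * r \<le> 1 / 2"
    and cont: "continuous_on (cball s0 r \<times> UNIV \<times> UNIV) (\<lambda>(p, u, f). N p u f)"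
    and diff: "\<And>p u f h. N p u (f - h) = N p u f - N p u h"
    and scale: "\<And>p u f c. N p (c *\<^sub>R u) f = c *\<^sub>R N p u f"
    and bound: "\<And>p u f. p \<in> cball s0 r \<Longrightarrow> norm (N p u f) \<le> L * norm u * norm f"
  obtains \<phi> where "continuous_on UNIV \<phi>" "\<phi> 0 = F0"
    "\<And>x t. x \<in> cball 0 r \<Longrightarrow> t \<in> {0..1} \<Longrightarrow>
      ((\<lambda>t. \<phi> (t *\<^sub>R x)) has_vector_derivative N (s0 + t *\<^sub>R x) x (\<phi> (t *\<^sub>R x))) (at t within {0..1})"
proof -
  define \<rho> :: "real^2 \<Rightarrow> real^2" where "\<rho> = closest_point (cball 0 r)"
  have \<rho>: "\<rho> x \<in> cball 0 r" for x
    unfolding \<rho>_def using r by (intro closest_point_in_set) auto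
  have \<rho>_id: "\<rho> x = x" if "x \<in> cball 0 r" for x
    unfolding \<rho>_def using that by (rule closest_point_self)
  have \<rho>_cont: "continuous_on UNIV \<rho>"
    unfolding \<rho>_def using r by (intro continuous_on_closest_point) auto
  note seg = ray_in_cball[where r = r]
  define I where "I \<phi> x t = N (s0 + t *\<^sub>R \<rho> x) (\<rho> x) (\<phi> (t *\<^sub>R \<rho> x))" for \<phi> :: "real^2 \<Rightarrow> 'f" and x t
  have I_cont: "continuous_on (UNIV \<times> cbox 0 1) (\<lambda>(x, t). I \<phi> x t)" if "continuous_on UNIV \<phi>" for \<phi>
  proof -
    have "continuous_on (UNIV \<times> cbox 0 (1::real)) (\<lambda>z. (\<lambda>(p, u, f). N p u f)
        (s0 + snd z *\<^sub>R \<rho> (fst z), \<rho> (fst z), \<phi> (snd z *\<^sub>R \<rho> (fst z))))"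
      by (rule continuous_on_compose2[OF cont])
        (use seg(1)[OF _ \<rho>, where s = s0] in \<open>auto intro!: continuous_intros continuous_on_compose2[OF \<rho>_cont]
          continuous_on_compose2[OF that]\<close>)
    then show ?thesis by (simp add: I_def case_prod_beta)
  qed
  have I_cont': "continuous_on {0..1} (I \<phi> x)" if "continuous_on UNIV \<phi>" for \<phi> x
  proof -
    have "continuous_on {0..1} (\<lambda>t. (\<lambda>(x, t). I \<phi> x t) (x, t))"
      by (rule continuous_on_compose2[OF I_cont[OF that]]) (auto intro!: continuous_intros)
    then show ?thesis by simp
  qed
  have I_bound: "norm (I \<phi> x t) \<le> 1 / 2 * norm (\<phi> (t *\<^sub>R \<rho> x))" if "t \<in> {0..1}" for \<phi> x t
  proof -
    have "norm (I \<phi> x t) \<le> L * norm (\<rho> x) * norm (\<phi> (t *\<^sub>R \<rho> x))"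
      unfolding I_def by (rule bound[OF seg(1)[OF that \<rho>]])
    also have "\<dots> \<le> 1 / 2 * norm (\<phi> (t *\<^sub>R \<rho> x))"
    proof (rule mult_right_mono)
      have "L * norm (\<rho> x) \<le> L * r" using \<rho>[of x] r by (intro mult_left_mono) auto
      then show "L * norm (\<rho> x) \<le> 1 / 2" using r(3) by linarith
    qed simp
    finally show ?thesis .
  qed
  have J_bound: "norm (integral {0..1} (I \<phi> x)) \<le> 1 / 2 * B"
    if "continuous_on UNIV \<phi>" "\<And>y. norm (\<phi> y) \<le> B" for \<phi> x B
  proof -
    have "norm (integral {0..1} (I \<phi> x)) \<le> 1 / 2 * B * (1 - 0)"
    proof (rule integral_bound)
      fix t :: real assume "t \<in> {0..1}"
      then show "norm (I \<phi> x t) \<le> 1 / 2 * B"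
        using I_bound[of t \<phi> x] that(2)[of "t *\<^sub>R \<rho> x"] by linarith
    qed (use I_cont'[OF that(1)] in auto)
    then show ?thesis by simp
  qed
  define T where "T \<phi> x = F0 + integral {0..1} (I \<phi> x)" for \<phi> x
  have T_bcontfun: "T (apply_bcontfun \<phi>) \<in> bcontfun" for \<phi>
  proof (rule bcontfun_normI)
    have "continuous_on UNIV (\<lambda>x. integral (cbox 0 1) (I (apply_bcontfun \<phi>) x))"
      by (intro integral_continuous_on_param I_cont) simp
    then show "continuous_on UNIV (T (apply_bcontfun \<phi>))"
      unfolding T_def by (auto intro!: continuous_intros)
    show "norm (T (apply_bcontfun \<phi>) x) \<le> norm F0 + 1 / 2 * norm \<phi>" for x
      unfolding T_def using J_bound[of "apply_bcontfun \<phi>" "norm \<phi>" x] norm_bounded[of \<phi>]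
      by (smt (verit) norm_triangle_ineq continuous_on_apply_bcontfun)
  qed
  define TT where "TT \<phi> = Bcontfun (T (apply_bcontfun \<phi>))" for \<phi> :: "(real^2) \<Rightarrow>\<^sub>C 'f"
  have TT: "apply_bcontfun (TT \<phi>) x = T (apply_bcontfun \<phi>) x" for \<phi> x
    unfolding TT_def using Bcontfun_inverse[OF T_bcontfun] by simp
  have "\<exists>!\<phi>. TT \<phi> = \<phi>"
  proof (rule banach_fix_type[of "1 / 2"], simp, simp, intro allI)
    fix \<phi> \<psi> :: "(real^2) \<Rightarrow>\<^sub>C 'f"
    show "dist (TT \<phi>) (TT \<psi>) \<le> 1 / 2 * dist \<phi> \<psi>"
    proof (rule dist_bound)
      fix x
      let ?\<delta> = "\<lambda>x. apply_bcontfun \<phi> x - apply_bcontfun \<psi> x"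
      have "I (apply_bcontfun \<phi>) x t - I (apply_bcontfun \<psi>) x t = I ?\<delta> x t" for t
        unfolding I_def by (simp add: diff)
      then have "T (apply_bcontfun \<phi>) x - T (apply_bcontfun \<psi>) x = integral {0..1} (I ?\<delta> x)"
        unfolding T_def
        using integral_diff[OF integrable_continuous_real[OF I_cont'] integrable_continuous_real[OF I_cont'],
            of "apply_bcontfun \<phi>" "apply_bcontfun \<psi>" x x]
        by simp
      also have "norm \<dots> \<le> 1 / 2 * dist \<phi> \<psi>"
        by (rule J_bound) (use dist_bounded[of \<phi> _ \<psi>] in \<open>auto intro!: continuous_intros simp: dist_norm\<close>)
      finally show "dist (apply_bcontfun (TT \<phi>) x) (apply_bcontfun (TT \<psi>) x) \<le> 1 / 2 * dist \<phi> \<psi>"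
        by (simp add: TT dist_norm)
    qed
  qed
  then obtain \<phi>' where "TT \<phi>' = \<phi>'" by blast
  define \<phi> where "\<phi> = apply_bcontfun \<phi>'"
  have fixpt: "\<phi> x = F0 + integral {0..1} (I \<phi> x)" for x
    using TT[of \<phi>' x] \<open>TT \<phi>' = \<phi>'\<close> unfolding T_def \<phi>_def by simp
  have c: "continuous_on UNIV \<phi>" unfolding \<phi>_def by simp
  show thesis
  proof (rule that[OF c])
    have "I \<phi> 0 t = 0" for t
      using scale[of s0 0 0 "\<phi> 0"] r by (simp add: I_def \<rho>_id)
    then have "I \<phi> 0 = (\<lambda>t. 0)" by blast
    then show "\<phi> 0 = F0" using fixpt[of 0] by simp
    fix x :: "real^2" and t :: real assume x: "x \<in> cball 0 r" and t: "t \<in> {0..1}"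
    have ray: "\<phi> (u *\<^sub>R x) = F0 + integral {0..u} (I \<phi> x)" if u: "u \<in> {0..1}" for u
    proof -
      have "I \<phi> (u *\<^sub>R x) = (\<lambda>\<tau>. u *\<^sub>R I \<phi> x (\<tau> * u))"
        unfolding I_def by (simp add: \<rho>_id[OF x] \<rho>_id[OF seg(2)[OF u x]] scale)
      then show ?thesis
        unfolding fixpt[of "u *\<^sub>R x"] integral_stretch01[OF I_cont'[OF c] u, symmetric] by (simp only:)
    qed
    have "((\<lambda>u. F0 + integral {0..u} (I \<phi> x)) has_vector_derivative I \<phi> x t) (at t within {0..1})"
      using integral_has_vector_derivative[OF I_cont'[OF c] t] by (auto intro!: derivative_eq_intros)
    then have "((\<lambda>u. \<phi> (u *\<^sub>R x)) has_vector_derivative I \<phi> x t) (at t within {0..1})"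
      by (rule has_vector_derivative_transform[OF t, rotated]) (use ray in auto)
    then show "((\<lambda>t. \<phi> (t *\<^sub>R x)) has_vector_derivative N (s0 + t *\<^sub>R x) x (\<phi> (t *\<^sub>R x))) (at t within {0..1})"
      unfolding I_def \<rho>_id[OF x] .
  qed
qed

text \<open>
  That the radial solution satisfies the system in all directions is where flatness enters: the
  defect of the linear approximation at a neighbouring point, followed along the rays, solves
  a linear equation with an inhomogeneity of second order in the displacement.
\<close>

lemma radial_solution_derivative:
  fixes N :: "real^2 \<Rightarrow> real^2 \<Rightarrow> 'f::euclidean_space \<Rightarrow> 'f"
    and DN :: "real^2 \<Rightarrow> real^2 \<Rightarrow> real^2 \<Rightarrow> 'f \<Rightarrow> 'f"
  assumes r: "r > 0" "L \<ge> 0" "L * r \<le> 1 / 2"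
    and bl: "\<And>p. bounded_bilinear (N p)"
    and bl': "\<And>p k. bounded_bilinear (DN p k)"
    and DN_scale: "\<And>p k u f c. DN p (c *\<^sub>R k) u f = c *\<^sub>R DN p k u f"
    and N_bound: "\<And>p u f. p \<in> cball s0 r \<Longrightarrow> norm (N p u f) \<le> L * norm u * norm f"
    and DN_bound: "\<And>p k u f. p \<in> cball s0 r \<Longrightarrow> norm (DN p k u f) \<le> L * norm k * norm u * norm f"
    and N_lip: "\<And>p q u f. p \<in> cball s0 r \<Longrightarrow> q \<in> cball s0 r \<Longrightarrow>
      norm (N q u f - N p u f) \<le> L * norm (q - p) * norm u * norm f"
    and N_taylor: "\<And>p q u f. p \<in> cball s0 r \<Longrightarrow> q \<in> cball s0 r \<Longrightarrow>
      norm (N q u f - N p u f - DN p (q - p) u f) \<le> L * (norm (q - p))\<^sup>2 * norm u * norm f"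
    and N_deriv: "\<And>x h f f' t. s0 + t *\<^sub>R x \<in> cball s0 r \<Longrightarrow>
      (f has_vector_derivative f') (at t within {0..1}) \<Longrightarrow>
      ((\<lambda>t. N (s0 + t *\<^sub>R x) h (f t)) has_vector_derivative
        (DN (s0 + t *\<^sub>R x) x h (f t) + N (s0 + t *\<^sub>R x) h f')) (at t within {0..1})"
    and flat: "\<And>p x h f. p \<in> cball s0 r \<Longrightarrow>
      DN p x h f + N p h (N p x f) = DN p h x f + N p x (N p h f)"
    and \<phi>_cont: "continuous_on UNIV \<phi>"
    and \<phi>: "\<And>x t. x \<in> cball 0 r \<Longrightarrow> t \<in> {0..1} \<Longrightarrow>
      ((\<lambda>t. \<phi> (t *\<^sub>R x)) has_vector_derivative N (s0 + t *\<^sub>R x) x (\<phi> (t *\<^sub>R x))) (at t within {0..1})"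
    and x: "x \<in> ball 0 r"
  shows "(\<phi> has_derivative (\<lambda>h. N (s0 + x) h (\<phi> x))) (at x)"
proof -
  have "bounded (\<phi> ` cball 0 r)"
    using \<phi>_cont by (intro compact_imp_bounded compact_continuous_image) (auto intro: continuous_on_subset)
  then obtain B where B: "\<And>y. y \<in> cball 0 r \<Longrightarrow> norm (\<phi> y) \<le> B" "B > 0"
    unfolding bounded_pos by (metis imageI)
  note seg = ray_in_cball[where r = r]
  note Nl = bounded_bilinear.add_left[OF bl] bounded_bilinear.add_right[OF bl]
    bounded_bilinear.scaleR_left[OF bl] bounded_bilinear.scaleR_right[OF bl]
  note DNl = bounded_bilinear.add_left[OF bl'] bounded_bilinear.add_right[OF bl']
    bounded_bilinear.scaleR_left[OF bl'] bounded_bilinear.scaleR_right[OF bl']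
  define C where "C = (L * r + L * r * L + L + L * L) * B"
  have "C \<ge> 0" unfolding C_def using r B by simp
  have main: "norm (\<phi> (x + h) - \<phi> x - N (s0 + x) h (\<phi> x)) \<le> 2 * C * (norm h)\<^sup>2" if h: "x + h \<in> cball 0 r" for h
  proof -
    have xr: "x \<in> cball 0 r" using x by simp
    define \<delta> where "\<delta> t = \<phi> (t *\<^sub>R (x + h)) - \<phi> (t *\<^sub>R x) - t *\<^sub>R N (s0 + t *\<^sub>R x) h (\<phi> (t *\<^sub>R x))" for t
    define \<delta>' where "\<delta>' t = N (s0 + t *\<^sub>R (x + h)) (x + h) (\<phi> (t *\<^sub>R (x + h))) - N (s0 + t *\<^sub>R x) x (\<phi> (t *\<^sub>R x))
      - (N (s0 + t *\<^sub>R x) h (\<phi> (t *\<^sub>R x)) + t *\<^sub>R (DN (s0 + t *\<^sub>R x) x h (\<phi> (t *\<^sub>R x))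
          + N (s0 + t *\<^sub>R x) h (N (s0 + t *\<^sub>R x) x (\<phi> (t *\<^sub>R x)))))" for t
    have deriv: "(\<delta> has_vector_derivative \<delta>' t) (at t within {0..1})" if t: "t \<in> {0..1}" for t
    proof -
      have id: "((\<lambda>t. t) has_vector_derivative 1) (at t within {0..1})"
        by (auto intro!: derivative_eq_intros)
      show ?thesis
        unfolding \<delta>_def[abs_def] \<delta>'_def
        using has_vector_derivative_diff[OF has_vector_derivative_diff[OF \<phi>[OF h t] \<phi>[OF xr t]]
          has_vector_derivative_scaleR[OF _ N_deriv[OF seg(1)[OF t xr] \<phi>[OF xr t], of h], of "\<lambda>t. t" 1]] id
        by (simp add: has_real_derivative_iff_has_vector_derivative add.commute)
    qed
    have cont: "continuous_on {0..1} \<delta>"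
      using deriv has_vector_derivative_continuous by (force simp: continuous_on_eq_continuous_within)
    obtain T where T: "T \<in> {0..1}" "\<And>t. t \<in> {0..1} \<Longrightarrow> norm (\<delta> t) \<le> norm (\<delta> T)"
      using continuous_attains_sup[OF compact_Icc _ continuous_on_norm[OF cont]] by auto
    have bound: "norm (\<delta>' t) \<le> 1 / 2 * norm (\<delta> T) + C * (norm h)\<^sup>2" if t: "t \<in> {0..1}" for t
    proof -
      define p q f where "p = s0 + t *\<^sub>R x" and "q = s0 + t *\<^sub>R (x + h)" and "f = \<phi> (t *\<^sub>R x)"
      have p: "p \<in> cball s0 r" and q: "q \<in> cball s0 r" and f: "norm f \<le> B"
        unfolding p_def q_def f_def using seg[OF t xr] seg[OF t h] B by blast+
      have qp: "q - p = t *\<^sub>R h" by (simp add: p_def q_def algebra_simps)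
      have nqp: "norm (q - p) \<le> norm h" unfolding qp using t by (simp add: mult_left_le_one_le)
      have f': "\<phi> (t *\<^sub>R (x + h)) = \<delta> t + f + t *\<^sub>R N p h f"
        by (simp add: \<delta>_def p_def f_def)
      have e1: "DN p x h f = DN p h (x + h) f - DN p h h f + N p (x + h) (N p h f) - N p h (N p h f) - N p h (N p x f)"
        using flat[OF p, of x h f] by (simp add: Nl DNl algebra_simps)
      \<comment> \<open>Flatness (\<open>e1\<close>) has replaced the derivative of \<open>N\<close> along the ray by the one in the direction
         \<open>h\<close>, and this one is what the Taylor expansion of \<open>N\<close> at \<open>p\<close> produces: all terms but the first
         are of second order in \<open>h\<close>.\<close>
      have dec: "\<delta>' t = N q (x + h) (\<delta> t) + (N q (x + h) f - N p (x + h) f - DN p (q - p) (x + h) f)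
          + t *\<^sub>R (N q (x + h) (N p h f) - N p (x + h) (N p h f)) + t *\<^sub>R (DN p h h f + N p h (N p h f))"
        unfolding \<delta>'_def p_def[symmetric] q_def[symmetric] f_def[symmetric] f' e1 qp
        by (simp add: Nl DNl DN_scale algebra_simps)
      have xh: "norm (x + h) \<le> r" using h by simp
      have Nh: "norm (N p h f) \<le> L * norm h * B"
        using order_trans[OF N_bound[OF p] mult_left_mono[OF f]] r by simp
      have b1: "norm (N q (x + h) (\<delta> t)) \<le> 1 / 2 * norm (\<delta> T)"
      proof -
        have "norm (N q (x + h) (\<delta> t)) \<le> L * norm (x + h) * norm (\<delta> t)" by (rule N_bound[OF q])
        also have "\<dots> \<le> L * r * norm (\<delta> T)"
          using xh T(2)[OF t] r by (intro mult_mono) auto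
        also have "\<dots> \<le> 1 / 2 * norm (\<delta> T)" using r(3) by (intro mult_right_mono) auto
        finally show ?thesis .
      qed
      have b2: "norm (N q (x + h) f - N p (x + h) f - DN p (q - p) (x + h) f) \<le> L * (norm h)\<^sup>2 * r * B"
        using xh f nqp r by (intro order_trans[OF N_taylor[OF p q]] mult_mono power_mono) auto
      have b3: "norm (N q (x + h) (N p h f) - N p (x + h) (N p h f)) \<le> L * norm h * r * (L * norm h * B)"
        using xh Nh nqp r by (intro order_trans[OF N_lip[OF p q]] mult_mono) auto
      have b4: "norm (DN p h h f) \<le> L * norm h * norm h * B"
        using f r by (intro order_trans[OF DN_bound[OF p]] mult_mono) auto
      have b5: "norm (N p h (N p h f)) \<le> L * norm h * (L * norm h * B)"
        using order_trans[OF N_bound[OF p] mult_left_mono[OF Nh]] r by simp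
      have tn: "norm (t *\<^sub>R v) \<le> norm v" for v :: 'f
        using t by (simp add: mult_left_le_one_le)
      have "norm (\<delta>' t) \<le> norm (N q (x + h) (\<delta> t)) + norm (N q (x + h) f - N p (x + h) f - DN p (q - p) (x + h) f)
          + norm (N q (x + h) (N p h f) - N p (x + h) (N p h f)) + (norm (DN p h h f) + norm (N p h (N p h f)))"
        unfolding dec
        by (intro norm_triangle_le add_mono order_trans[OF tn] order_refl norm_triangle_ineq)
      also have "\<dots> \<le> 1 / 2 * norm (\<delta> T) + L * (norm h)\<^sup>2 * r * B + L * norm h * r * (L * norm h * B)
          + (L * norm h * norm h * B + L * norm h * (L * norm h * B))"
        by (intro add_mono b1 b2 b3 b4 b5)
      also have "\<dots> = 1 / 2 * norm (\<delta> T) + C * (norm h)\<^sup>2"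
        unfolding C_def by (simp add: algebra_simps power2_eq_square)
      finally show ?thesis .
    qed
    have "norm (\<delta> T - \<delta> 0) \<le> (1 / 2 * norm (\<delta> T) + C * (norm h)\<^sup>2) * norm (T - 0)"
    proof (rule differentiable_bound[where f' = "\<lambda>t c. c *\<^sub>R \<delta>' t" and S = "{0..1}"])
      show "(\<delta> has_derivative (\<lambda>c. c *\<^sub>R \<delta>' t)) (at t within {0..1})" if "t \<in> {0..1}" for t
        using deriv[OF that] by (simp add: has_vector_derivative_def)
      show "onorm (\<lambda>c. c *\<^sub>R \<delta>' t) \<le> 1 / 2 * norm (\<delta> T) + C * (norm h)\<^sup>2" if "t \<in> {0..1}" for t
        using bound[OF that] by (intro onorm_le) (simp add: mult.commute mult_left_mono)
    qed (use T in auto)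
    also have "\<dots> \<le> (1 / 2 * norm (\<delta> T) + C * (norm h)\<^sup>2) * 1"
      using T(1) \<open>C \<ge> 0\<close> by (intro mult_left_mono) auto
    finally have "norm (\<delta> T) \<le> 2 * C * (norm h)\<^sup>2"
      by (simp add: \<delta>_def)
    with T(2)[of 1] show ?thesis by (simp add: \<delta>_def)
  qed
  show ?thesis
    unfolding has_derivative_at_alt
  proof (intro conjI allI impI)
    show "bounded_linear (\<lambda>h. N (s0 + x) h (\<phi> x))"
      by (rule bounded_bilinear.bounded_linear_left[OF bl])
    fix e :: real assume e: "e > 0"
    define d where "d = min (r - norm x) (e / (2 * C + 1))"
    have "d > 0" using x e \<open>C \<ge> 0\<close> by (auto simp: d_def intro!: divide_pos_pos)
    moreover have "norm (\<phi> y - \<phi> x - N (s0 + x) (y - x) (\<phi> x)) \<le> e * norm (y - x)"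
      if y: "norm (y - x) < d" for y
    proof -
      have "norm y \<le> norm x + norm (y - x)" by (rule norm_triangle_sub)
      then have "x + (y - x) \<in> cball 0 r" using y by (simp add: d_def)
      from main[OF this] have "norm (\<phi> y - \<phi> x - N (s0 + x) (y - x) (\<phi> x)) \<le> (2 * C * norm (y - x)) * norm (y - x)"
        by (simp add: power2_eq_square mult.assoc)
      also have "\<dots> \<le> e * norm (y - x)"
      proof (rule mult_right_mono)
        have "2 * C * norm (y - x) \<le> (2 * C + 1) * norm (y - x)"
          by (intro mult_right_mono) auto
        also have "\<dots> \<le> (2 * C + 1) * (e / (2 * C + 1))"
          using y \<open>C \<ge> 0\<close> by (intro mult_left_mono) (auto simp: d_def)
        also have "\<dots> = e" using \<open>C \<ge> 0\<close> by simp
        finally show "2 * C * norm (y - x) \<le> e" .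
      qed simp
      finally show ?thesis .
    qed
    ultimately show "\<exists>d>0. \<forall>y. norm (y - x) < d \<longrightarrow> norm (\<phi> y - \<phi> x - N (s0 + x) (y - x) (\<phi> x)) \<le> e * norm (y - x)"
      by blast
  qed
qed

text \<open>
  The constants that the estimates for radial solutions need, for a single coefficient matrix.
\<close>

lemma smooth_cball_bounds:
  fixes f :: "real^2 \<Rightarrow> 'b::real_normed_vector"
  assumes f: "smooth_on U f" and U: "cball s0 R \<subseteq> U"
  obtains B where "B \<ge> 0" "\<And>p. p \<in> cball s0 R \<Longrightarrow> norm (f p) \<le> B"
    "\<And>p (k::real^2). p \<in> cball s0 R \<Longrightarrow> norm (k $ 1 *\<^sub>R pd 1 f p + k $ 2 *\<^sub>R pd 2 f p) \<le> B * norm k"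
    "\<And>p q. p \<in> cball s0 R \<Longrightarrow> q \<in> cball s0 R \<Longrightarrow> norm (f q - f p) \<le> B * norm (q - p)"
    "\<And>p q. p \<in> cball s0 R \<Longrightarrow> q \<in> cball s0 R \<Longrightarrow>
       norm (f q - f p - ((q - p) $ 1 *\<^sub>R pd 1 f p + (q - p) $ 2 *\<^sub>R pd 2 f p)) \<le> B * (norm (q - p))\<^sup>2"
proof -
  have bdd: "\<exists>B\<ge>0. \<forall>p\<in>cball s0 R. norm (h p) \<le> B" if "smooth_on U h" for h :: "real^2 \<Rightarrow> 'b"
  proof -
    have "bounded (h ` cball s0 R)"
      using smooth_on_continuous[OF that] U
      by (intro compact_imp_bounded compact_continuous_image) (auto intro: continuous_on_subset)
    then show ?thesis unfolding bounded_pos by (meson imageI less_imp_le)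
  qed
  have comb: "norm (k $ 1 *\<^sub>R v + k $ 2 *\<^sub>R w) \<le> (norm v + norm w) * norm k" for k :: "real^2" and v w :: 'b
  proof -
    have "norm (k $ 1 *\<^sub>R v + k $ 2 *\<^sub>R w) \<le> \<bar>k $ 1\<bar> * norm v + \<bar>k $ 2\<bar> * norm w"
      using norm_triangle_ineq[of "k $ 1 *\<^sub>R v" "k $ 2 *\<^sub>R w"] by simp
    also have "\<dots> \<le> norm k * norm v + norm k * norm w"
      by (intro add_mono mult_right_mono component_le_norm_cart norm_ge_zero)
    finally show ?thesis by (simp add: algebra_simps)
  qed
  have der: "\<exists>B\<ge>0. \<forall>p\<in>cball s0 R. \<forall>k::real^2. norm (k $ 1 *\<^sub>R pd 1 h p + k $ 2 *\<^sub>R pd 2 h p) \<le> B * norm k"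
    if h: "smooth_on U h" for h :: "real^2 \<Rightarrow> 'b"
  proof -
    obtain B1 where B1: "B1 \<ge> 0" "\<forall>p\<in>cball s0 R. norm (pd 1 h p) \<le> B1"
      using bdd[OF smooth_on_pd[OF h, of 1]] by (elim exE conjE) (rule that)
    obtain B2 where B2: "B2 \<ge> 0" "\<forall>p\<in>cball s0 R. norm (pd 2 h p) \<le> B2"
      using bdd[OF smooth_on_pd[OF h, of 2]] by (elim exE conjE) (rule that)
    have "norm (k $ 1 *\<^sub>R pd 1 h p + k $ 2 *\<^sub>R pd 2 h p) \<le> (B1 + B2) * norm k"
      if p: "p \<in> cball s0 R" for p and k :: "real^2"
      using order_trans[OF comb mult_right_mono[OF add_mono[OF B1(2)[rule_format, OF p] B2(2)[rule_format, OF p]] norm_ge_zero]] .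
    then show ?thesis using B1(1) B2(1) by (intro exI[of _ "B1 + B2"] conjI ballI allI) simp_all
  qed
  have lip: "\<exists>B\<ge>0. \<forall>p\<in>cball s0 R. \<forall>q\<in>cball s0 R. norm (h q - h p) \<le> B * norm (q - p)"
    if h: "smooth_on U h" for h :: "real^2 \<Rightarrow> 'b"
  proof -
    obtain B where B: "B \<ge> 0"
      "\<forall>p\<in>cball s0 R. \<forall>k::real^2. norm (k $ 1 *\<^sub>R pd 1 h p + k $ 2 *\<^sub>R pd 2 h p) \<le> B * norm k"
      using der[OF h] by (elim exE conjE) (rule that)
    have "norm (h q - h p) \<le> B * norm (q - p)" if "p \<in> cball s0 R" "q \<in> cball s0 R" for p q
    proof (rule differentiable_bound[OF convex_cball _ _ that(2,1)])
      show "(h has_derivative (\<lambda>k::real^2. k $ 1 *\<^sub>R pd 1 h x + k $ 2 *\<^sub>R pd 2 h x)) (at x within cball s0 R)"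
        if "x \<in> cball s0 R" for x
        by (rule has_derivative_at_withinI, rule has_derivative_pd, rule smooth_on_differentiable[OF h])
           (use that U in blast)
      show "onorm (\<lambda>k::real^2. k $ 1 *\<^sub>R pd 1 h x + k $ 2 *\<^sub>R pd 2 h x) \<le> B" if "x \<in> cball s0 R" for x
        by (rule onorm_le) (rule B(2)[rule_format, OF that])
    qed
    then show ?thesis using B(1) by (intro exI[of _ B] conjI ballI)
  qed
  obtain B0 where B0: "B0 \<ge> 0" "\<forall>p\<in>cball s0 R. norm (f p) \<le> B0"
    using bdd[OF f] by (elim exE conjE) (rule that)
  obtain B1 where B1: "B1 \<ge> 0"
    "\<forall>p\<in>cball s0 R. \<forall>k::real^2. norm (k $ 1 *\<^sub>R pd 1 f p + k $ 2 *\<^sub>R pd 2 f p) \<le> B1 * norm k"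
    using der[OF f] by (elim exE conjE) (rule that)
  obtain B2 where B2: "B2 \<ge> 0" "\<forall>p\<in>cball s0 R. \<forall>q\<in>cball s0 R. norm (f q - f p) \<le> B2 * norm (q - p)"
    using lip[OF f] by (elim exE conjE) (rule that)
  obtain C1 where C1: "C1 \<ge> 0"
    "\<forall>p\<in>cball s0 R. \<forall>q\<in>cball s0 R. norm (pd 1 f q - pd 1 f p) \<le> C1 * norm (q - p)"
    using lip[OF smooth_on_pd[OF f, of 1]] by (elim exE conjE) (rule that)
  obtain C2 where C2: "C2 \<ge> 0"
    "\<forall>p\<in>cball s0 R. \<forall>q\<in>cball s0 R. norm (pd 2 f q - pd 2 f p) \<le> C2 * norm (q - p)"
    using lip[OF smooth_on_pd[OF f, of 2]] by (elim exE conjE) (rule that)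
  note C = C1(1) C2(1) C1(2)[rule_format] C2(2)[rule_format]
  have taylor: "norm (f q - f p - ((q - p) $ 1 *\<^sub>R pd 1 f p + (q - p) $ 2 *\<^sub>R pd 2 f p)) \<le> (C1 + C2) * (norm (q - p))\<^sup>2"
    if p: "p \<in> cball s0 R" and q: "q \<in> cball s0 R" for p q
  proof -
    let ?f' = "\<lambda>x (k::real^2). k $ 1 *\<^sub>R pd 1 f x + k $ 2 *\<^sub>R pd 2 f x :: 'b"
    let ?S = "cball s0 R \<inter> cball p (norm (q - p))"
    have "norm (f q - f p - ?f' p (q - p)) \<le> norm (q - p) * ((C1 + C2) * norm (q - p))"
    proof (rule differentiable_bound_linearization[where S = ?S])
      fix t :: real assume t: "t \<in> {0..1}"
      have "p + t *\<^sub>R (q - p) = (1 - t) *\<^sub>R p + t *\<^sub>R q" by (simp add: algebra_simps)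
      moreover have "q \<in> ?S" "p \<in> ?S" using p q by (auto simp: dist_norm norm_minus_commute)
      ultimately show "p + t *\<^sub>R (q - p) \<in> ?S"
        using convexD[OF convex_Int[OF convex_cball convex_cball], of p s0 R p "norm (q - p)" q "1 - t" t] t
        by simp
    next
      fix x assume x: "x \<in> ?S"
      show "(f has_derivative ?f' x) (at x within ?S)"
        by (rule has_derivative_at_withinI, rule has_derivative_pd, rule smooth_on_differentiable[OF f])
           (use x U in blast)
      have "norm (?f' x k - ?f' p k) \<le> (C1 + C2) * norm (q - p) * norm k" for k
      proof -
        have "?f' x k - ?f' p k = k $ 1 *\<^sub>R (pd 1 f x - pd 1 f p) + k $ 2 *\<^sub>R (pd 2 f x - pd 2 f p)"
          by (simp add: algebra_simps)
        also have "norm \<dots> \<le> (C1 * norm (x - p) + C2 * norm (x - p)) * norm k"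
          using x by (intro order_trans[OF comb] mult_right_mono add_mono C p) auto
        also have "\<dots> \<le> (C1 + C2) * norm (q - p) * norm k"
          using x C(1,2) by (simp add: distrib_right[symmetric] dist_norm norm_minus_commute mult_left_mono mult_right_mono)
        finally show ?thesis .
      qed
      then show "onorm (?f' x - ?f' p) \<le> (C1 + C2) * norm (q - p)"
        by (intro onorm_le) simp
    qed (use p in auto)
    then show ?thesis by (simp add: power2_eq_square mult_ac)
  qed
  define B where "B = B0 + B1 + B2 + (C1 + C2)"
  have le: "B0 \<le> B" "B1 \<le> B" "B2 \<le> B" "C1 + C2 \<le> B"
    using B0 B1 B2 C by (auto simp: B_def)
  show thesis
  proof (rule that[of B])
    show "B \<ge> 0" using le B0(1) by linarith
    show "norm (f p) \<le> B" if "p \<in> cball s0 R" for p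
      using order_trans[OF B0(2)[rule_format, OF that] le(1)] .
    show "norm (k $ 1 *\<^sub>R pd 1 f p + k $ 2 *\<^sub>R pd 2 f p) \<le> B * norm k"
      if "p \<in> cball s0 R" for p and k :: "real^2"
      using order_trans[OF B1(2)[rule_format, OF that] mult_right_mono[OF le(2)]] by simp
    show "norm (f q - f p) \<le> B * norm (q - p)" if "p \<in> cball s0 R" "q \<in> cball s0 R" for p q
      using order_trans[OF B2(2)[rule_format, OF that] mult_right_mono[OF le(3)]] by simp
    show "norm (f q - f p - ((q - p) $ 1 *\<^sub>R pd 1 f p + (q - p) $ 2 *\<^sub>R pd 2 f p)) \<le> B * (norm (q - p))\<^sup>2"
      if "p \<in> cball s0 R" "q \<in> cball s0 R" for p q
      using order_trans[OF taylor[OF that] mult_right_mono[OF le(4)]] by simp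
  qed
qed

lemma bounded_bilinear_matrix_vector_mult:
  "bounded_bilinear ((*v) :: real^'n^'m \<Rightarrow> real^'n \<Rightarrow> real^'m)"
  unfolding bilinear_conv_bounded_bilinear[symmetric] bilinear_def
  by (auto intro!: linearI simp: matrix_vector_mult_add_rdistrib matrix_vector_right_distrib
      scaleR_matrix_vector_assoc matrix_vector_mult_scaleR)

text \<open>
  The linear case of the theorem of Frobenius. The radius does not depend on the initial value.
\<close>

proposition flat_linear_system:
  fixes M1 M2 :: "real^2 \<Rightarrow> real^'n^'n"
  assumes U: "open U" "s0 \<in> U" and sm: "smooth_on U M1" "smooth_on U M2"
    and flat: "\<And>s. s \<in> U \<Longrightarrow> pd 1 M2 s + M2 s ** M1 s = pd 2 M1 s + M1 s ** M2 s"
  obtains r where "r > 0" "ball s0 r \<subseteq> U"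
    "\<And>F0. \<exists>F. smooth_on (ball s0 r) F \<and> F s0 = F0 \<and>
       (\<forall>s\<in>ball s0 r. pd 1 F s = M1 s *v F s \<and> pd 2 F s = M2 s *v F s)"
proof -
  obtain R where R: "R > 0" "cball s0 R \<subseteq> U"
    using U open_contains_cball by blast
  interpret mv: bounded_bilinear "(*v) :: real^'n^'n \<Rightarrow> real^'n \<Rightarrow> real^'n"
    by (rule bounded_bilinear_matrix_vector_mult)
  obtain \<kappa> where \<kappa>: "\<kappa> > 0" "\<forall>P f. norm ((P :: real^'n^'n) *v f) \<le> norm P * norm f * \<kappa>"
    using mv.pos_bounded by (elim exE conjE) (rule that)
  obtain B1 where B1: "B1 \<ge> 0" "\<And>p. p \<in> cball s0 R \<Longrightarrow> norm (M1 p) \<le> B1"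
    "\<And>p (k::real^2). p \<in> cball s0 R \<Longrightarrow> norm (k $ 1 *\<^sub>R pd 1 M1 p + k $ 2 *\<^sub>R pd 2 M1 p) \<le> B1 * norm k"
    "\<And>p q. p \<in> cball s0 R \<Longrightarrow> q \<in> cball s0 R \<Longrightarrow> norm (M1 q - M1 p) \<le> B1 * norm (q - p)"
    "\<And>p q. p \<in> cball s0 R \<Longrightarrow> q \<in> cball s0 R \<Longrightarrow>
       norm (M1 q - M1 p - ((q - p) $ 1 *\<^sub>R pd 1 M1 p + (q - p) $ 2 *\<^sub>R pd 2 M1 p)) \<le> B1 * (norm (q - p))\<^sup>2"
    by (rule smooth_cball_bounds[OF sm(1) R(2)], rule that)
  obtain B2 where B2: "B2 \<ge> 0" "\<And>p. p \<in> cball s0 R \<Longrightarrow> norm (M2 p) \<le> B2"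
    "\<And>p (k::real^2). p \<in> cball s0 R \<Longrightarrow> norm (k $ 1 *\<^sub>R pd 1 M2 p + k $ 2 *\<^sub>R pd 2 M2 p) \<le> B2 * norm k"
    "\<And>p q. p \<in> cball s0 R \<Longrightarrow> q \<in> cball s0 R \<Longrightarrow> norm (M2 q - M2 p) \<le> B2 * norm (q - p)"
    "\<And>p q. p \<in> cball s0 R \<Longrightarrow> q \<in> cball s0 R \<Longrightarrow>
       norm (M2 q - M2 p - ((q - p) $ 1 *\<^sub>R pd 1 M2 p + (q - p) $ 2 *\<^sub>R pd 2 M2 p)) \<le> B2 * (norm (q - p))\<^sup>2"
    by (rule smooth_cball_bounds[OF sm(2) R(2)], rule that)
  define N where "N p u f = u $ 1 *\<^sub>R (M1 p *v f) + u $ 2 *\<^sub>R (M2 p *v f)" for p u :: "real^2" and f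
  define DN where "DN p k u f = u $ 1 *\<^sub>R ((k $ 1 *\<^sub>R pd 1 M1 p + k $ 2 *\<^sub>R pd 2 M1 p) *v f)
    + u $ 2 *\<^sub>R ((k $ 1 *\<^sub>R pd 1 M2 p + k $ 2 *\<^sub>R pd 2 M2 p) *v f)" for p k u :: "real^2" and f
  define L where "L = \<kappa> * (B1 + B2)"
  have L: "L \<ge> 0" using \<kappa>(1) B1(1) B2(1) by (simp add: L_def)
  have bil: "bounded_bilinear (\<lambda>u f. u $ 1 *\<^sub>R (P *v f) + u $ 2 *\<^sub>R (Q *v f))"
    for P Q :: "real^'n^'n"
    unfolding bilinear_conv_bounded_bilinear[symmetric] bilinear_def
    by (auto intro!: linearI simp: mv.add_right mv.scaleR_right algebra_simps)
  have est: "norm (u $ 1 *\<^sub>R (P *v f) + u $ 2 *\<^sub>R (Q *v f)) \<le> L * c * norm u * norm f"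
    if P: "norm P \<le> B1 * c" and Q: "norm Q \<le> B2 * c" for P Q :: "real^'n^'n" and u :: "real^2" and f c
  proof -
    have "norm (u $ 1 *\<^sub>R (P *v f) + u $ 2 *\<^sub>R (Q *v f)) \<le> \<bar>u $ 1\<bar> * norm (P *v f) + \<bar>u $ 2\<bar> * norm (Q *v f)"
      using norm_triangle_ineq[of "u $ 1 *\<^sub>R (P *v f)" "u $ 2 *\<^sub>R (Q *v f)"] by simp
    also have "\<dots> \<le> norm u * (B1 * c * norm f * \<kappa>) + norm u * (B2 * c * norm f * \<kappa>)"
      using \<kappa>(1) by (intro add_mono mult_mono component_le_norm_cart order_trans[OF \<kappa>(2)[rule_format]] P Q order_refl
          mult_right_mono) auto
    also have "\<dots> = L * c * norm u * norm f"
      by (simp add: L_def algebra_simps)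
    finally show ?thesis .
  qed
  define r where "r = min R (1 / (2 * (L + 1)))"
  have r: "r > 0" "r \<le> R" using R L by (auto simp: r_def)
  have "L * r \<le> L * (1 / (2 * (L + 1)))" using L by (intro mult_left_mono) (auto simp: r_def)
  also have "\<dots> \<le> 1 / 2" using L by (simp add: field_simps)
  finally have Lr: "L * r \<le> 1 / 2" .
  have sub: "cball s0 r \<subseteq> cball s0 R" using r by auto
  then have subU: "cball s0 r \<subseteq> U" using R by blast
  have cont: "continuous_on (cball s0 r \<times> UNIV \<times> UNIV) (\<lambda>(p, u, f). N p u f)"
    unfolding N_def case_prod_beta using sm[THEN smooth_on_continuous]
    by (intro continuous_intros mv.continuous_on) (auto intro!: continuous_intros continuous_on_compose2[of U] subsetD[OF subU])
  have flat': "DN p x h f + N p h (N p x f) = DN p h x f + N p x (N p h f)" if p: "p \<in> cball s0 r" for p x h f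
  proof -
    have "DN p x h f + N p h (N p x f) - (DN p h x f + N p x (N p h f)) =
        (x $ 1 * h $ 2 - x $ 2 * h $ 1) *\<^sub>R
          ((pd 1 M2 p + M2 p ** M1 p - (pd 2 M1 p + M1 p ** M2 p)) *v f)"
      unfolding DN_def N_def
      by (simp add: mv.add_left mv.add_right mv.scaleR_left mv.scaleR_right mv.diff_left
          matrix_vector_mul_assoc[symmetric] algebra_simps)
    then show ?thesis using flat[of p] p subU by (simp add: subset_iff)
  qed
  have deriv: "((\<lambda>t. N (s0 + t *\<^sub>R x) h (f t)) has_vector_derivative
        (DN (s0 + t *\<^sub>R x) x h (f t) + N (s0 + t *\<^sub>R x) h f')) (at t within {0..1})"
    if p: "s0 + t *\<^sub>R x \<in> cball s0 r" and f: "(f has_vector_derivative f') (at t within {0..1})" for x h f f' t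
  proof -
    have M: "((\<lambda>t. M (s0 + t *\<^sub>R x)) has_vector_derivative
        (x $ 1 *\<^sub>R pd 1 M (s0 + t *\<^sub>R x) + x $ 2 *\<^sub>R pd 2 M (s0 + t *\<^sub>R x))) (at t within {0..1})"
      if "smooth_on U M" for M :: "real^2 \<Rightarrow> real^'n^'n"
    proof -
      have "(M has_derivative (\<lambda>v. v $ 1 *\<^sub>R pd 1 M (s0 + t *\<^sub>R x) + v $ 2 *\<^sub>R pd 2 M (s0 + t *\<^sub>R x))) (at (s0 + t *\<^sub>R x))"
        using p subU that by (intro has_derivative_pd smooth_on_differentiable) auto
      moreover have "((\<lambda>t. s0 + t *\<^sub>R x) has_derivative (\<lambda>c. c *\<^sub>R x)) (at t within {0..1})"
        by (auto intro!: derivative_eq_intros)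
      ultimately have "((\<lambda>t. M (s0 + t *\<^sub>R x)) has_derivative
          (\<lambda>c. (c *\<^sub>R x) $ 1 *\<^sub>R pd 1 M (s0 + t *\<^sub>R x) + (c *\<^sub>R x) $ 2 *\<^sub>R pd 2 M (s0 + t *\<^sub>R x))) (at t within {0..1})"
        by (rule has_derivative_compose[rotated])
      then show ?thesis by (simp add: has_vector_derivative_def scaleR_add_right)
    qed
    show ?thesis
      unfolding N_def DN_def
      by (rule has_vector_derivative_eq_rhs)
         (rule has_vector_derivative_add has_vector_derivative_scaleR mv.has_vector_derivative M sm f
          DERIV_const | simp add: algebra_simps)+
  qed
  show thesis
  proof (rule that[OF r(1)])
    show "ball s0 r \<subseteq> U" using subU by auto
    fix F0 :: "real^'n"
    have e1: "norm (N p u f) \<le> L * norm u * norm f" if "p \<in> cball s0 r" for p u f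
      using est[of "M1 p" 1 "M2 p" u f] B1(2) B2(2) that sub unfolding N_def by auto
    have e2: "norm (DN p k u f) \<le> L * norm k * norm u * norm f" if "p \<in> cball s0 r" for p k u f
      unfolding DN_def using B1(3) B2(3) that sub by (intro est) auto
    have e3: "norm (N q u f - N p u f) \<le> L * norm (q - p) * norm u * norm f"
      if "p \<in> cball s0 r" "q \<in> cball s0 r" for p q u f
    proof -
      have pq: "p \<in> cball s0 R" "q \<in> cball s0 R" using that sub by blast+
      have "N q u f - N p u f = u $ 1 *\<^sub>R ((M1 q - M1 p) *v f) + u $ 2 *\<^sub>R ((M2 q - M2 p) *v f)"
        by (simp add: N_def mv.diff_left algebra_simps)
      then show ?thesis using est[OF B1(4)[OF pq] B2(4)[OF pq]] by simp
    qed
    have e4: "norm (N q u f - N p u f - DN p (q - p) u f) \<le> L * (norm (q - p))\<^sup>2 * norm u * norm f"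
      if "p \<in> cball s0 r" "q \<in> cball s0 r" for p q u f
    proof -
      have pq: "p \<in> cball s0 R" "q \<in> cball s0 R" using that sub by blast+
      have e: "N q u f - N p u f - DN p (q - p) u f =
          u $ 1 *\<^sub>R ((M1 q - M1 p - ((q - p) $ 1 *\<^sub>R pd 1 M1 p + (q - p) $ 2 *\<^sub>R pd 2 M1 p)) *v f) +
          u $ 2 *\<^sub>R ((M2 q - M2 p - ((q - p) $ 1 *\<^sub>R pd 1 M2 p + (q - p) $ 2 *\<^sub>R pd 2 M2 p)) *v f)"
        by (simp add: N_def DN_def mv.diff_left mv.add_left algebra_simps)
      show ?thesis unfolding e by (rule est[OF B1(5)[OF pq] B2(5)[OF pq]])
    qed
    have bl: "bounded_bilinear (N p)" "bounded_bilinear (DN p k)" for p k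
      unfolding N_def[abs_def] DN_def[abs_def] by (rule bil)+
    obtain \<phi> where \<phi>: "continuous_on UNIV \<phi>" "\<phi> 0 = F0"
      "\<And>x t. x \<in> cball 0 r \<Longrightarrow> t \<in> {0..1} \<Longrightarrow>
        ((\<lambda>t. \<phi> (t *\<^sub>R x)) has_vector_derivative N (s0 + t *\<^sub>R x) x (\<phi> (t *\<^sub>R x))) (at t within {0..1})"
      using radial_fixpoint[OF _ L Lr cont _ _ e1, of F0] r
      by (auto simp: bounded_bilinear.diff_right[OF bl(1)] bounded_bilinear.scaleR_left[OF bl(1)])
    have D: "(\<phi> has_derivative (\<lambda>h. N (s0 + x) h (\<phi> x))) (at x)" if "x \<in> ball 0 r" for x
      by (rule radial_solution_derivative[OF r(1) L Lr bl _ e1 e2 e3 e4 deriv flat' \<phi>(1,3) that])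
        (simp_all add: DN_def mv.scaleR_left mv.add_left algebra_simps)
    define F where "F s = \<phi> (s - s0)" for s
    have DF: "(F has_derivative (\<lambda>h. N s h (F s))) (at s)" if "s \<in> ball s0 r" for s
    proof -
      have "(\<phi> has_derivative (\<lambda>h. N s h (F s))) (at (s - s0))"
        using D[of "s - s0"] that by (simp add: F_def dist_norm norm_minus_commute)
      moreover have "((\<lambda>s. s - s0) has_derivative (\<lambda>h. h)) (at s)"
        by (auto intro!: derivative_eq_intros)
      ultimately show ?thesis
        unfolding F_def[abs_def] by (rule has_derivative_compose[rotated])
    qed
    have "smooth_on (ball s0 r) F"
    proof (rule smooth_onI[OF open_ball DF])
      fix k v assume F: "Ck_on k (ball s0 r) F"
      have "Ck_on k (ball s0 r) M1" "Ck_on k (ball s0 r) M2"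
        using sm subU Ck_on_subset[of k U _ "ball s0 r"] ball_subset_cball unfolding smooth_on_def by blast+
      then show "Ck_on k (ball s0 r) (\<lambda>s. N s v (F s))"
        unfolding N_def using F
        by (intro Ck_on_add[OF open_ball] Ck_on_linear[OF open_ball bounded_linear_scaleR_right]
            Ck_on_bilinear[OF open_ball bounded_bilinear_matrix_vector_mult])
    qed
    moreover have "F s0 = F0" by (simp add: F_def \<phi>)
    moreover have "pd 1 F s = M1 s *v F s \<and> pd 2 F s = M2 s *v F s" if "s \<in> ball s0 r" for s
      using pd_eqI[OF DF[OF that]] by (simp add: N_def axis_def)
    ultimately show "\<exists>F. smooth_on (ball s0 r) F \<and> F s0 = F0 \<and>
       (\<forall>s\<in>ball s0 r. pd 1 F s = M1 s *v F s \<and> pd 2 F s = M2 s *v F s)" by blast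
  qed
qed

section \<open>Killing forms in constant curvature\<close>

context riemannian_domain
begin

text \<open>
  A Killing form has a skew covariant derivative. Together with its one independent
  component it satisfies a linear total differential system, which is flat when \<open>K\<close> is constant.
\<close>

definition killing_form :: "(real^2) set \<Rightarrow> (real^2 \<Rightarrow> real) \<Rightarrow> (real^2 \<Rightarrow> real) \<Rightarrow> (real^2 \<Rightarrow> real) \<Rightarrow> bool" where
  "killing_form V k1 k2 w \<longleftrightarrow> smooth_on V k1 \<and> smooth_on V k2 \<and>
     (\<forall>s\<in>V. nab k1 k2 1 1 s = 0 \<and> nab k1 k2 1 2 s = w s \<and> nab k1 k2 2 1 s = - w s \<and> nab k1 k2 2 2 s = 0)"

text \<open>
  The rows give the derivatives of \<open>k1\<close>, \<open>k2\<close> and \<open>w\<close>; the last one comes from the symmetry of the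
  second derivatives of \<open>k1\<close> and \<open>k2\<close>, by which a Killing form satisfies
  $\partial_i w = \Gamma^l_{il} w + K (g_{2i} k_1 - g_{1i} k_2)$.
\<close>

definition "killing_matrix1 c s = (vector [vector [\<Gamma> 1 1 1 s, \<Gamma> 2 1 1 s, 0],
  vector [\<Gamma> 1 1 2 s, \<Gamma> 2 1 2 s, 1], vector [c * g12 s, - c * g11 s, tr1 s]] :: real^3^3)"

definition "killing_matrix2 c s = (vector [vector [\<Gamma> 1 1 2 s, \<Gamma> 2 1 2 s, -1],
  vector [\<Gamma> 1 2 2 s, \<Gamma> 2 2 2 s, 0], vector [c * g22 s, - c * g12 s, tr2 s]] :: real^3^3)"

lemma smooth_tr: "smooth_on U tr1" "smooth_on U tr2"
  unfolding tr1_def[abs_def] tr2_def[abs_def] by (intro smooth_intros open_U smooth_christoffel)+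

lemma smooth_killing_matrix: "smooth_on U (killing_matrix1 c)" "smooth_on U (killing_matrix2 c)"
proof -
  have "\<forall>i j. smooth_on U (\<lambda>s. killing_matrix1 c s $ i $ j)" "\<forall>i j. smooth_on U (\<lambda>s. killing_matrix2 c s $ i $ j)"
    unfolding forall_3 killing_matrix1_def killing_matrix2_def
    by (simp_all add: smooth_christoffel smooth_tr smooth_on_const open_U smooth_on_mult smooth_on_minus
        smooth_g11 smooth_g12 smooth_g22)
  then show "smooth_on U (killing_matrix1 c)" "smooth_on U (killing_matrix2 c)"
    by (auto intro!: smooth_on_vec open_U)
qed

lemma killing_system_flat:
  assumes s: "s \<in> U" and K: "K s = c" and "pd 1 K s = 0" "pd 2 K s = 0"
  shows "pd 1 (killing_matrix2 c) s + killing_matrix2 c s ** killing_matrix1 c s =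
    pd 2 (killing_matrix1 c) s + killing_matrix1 c s ** killing_matrix2 c s"
proof -
  have p: "pd i M s $ a $ b = pd i (\<lambda>t. M t $ a $ b) s" if "smooth_on U M" for i a b and M :: "real^2 \<Rightarrow> real^3^3"
    using pd_vec_nth[OF smooth_on_differentiable[OF that s], of i a]
      pd_vec_nth[OF smooth_on_differentiable[OF smooth_on_vec_nth[OF open_U that] s], of i a b] by simp
  note [simp] = smooth_on_differentiable[OF smooth_tr(1) s] smooth_on_differentiable[OF smooth_tr(2) s] s
  have tr: "pd i tr1 s = pd i (\<Gamma> 1 1 1) s + pd i (\<Gamma> 2 1 2) s" "pd i tr2 s = pd i (\<Gamma> 1 1 2) s + pd i (\<Gamma> 2 2 2) s" for i
    unfolding tr1_def[abs_def] tr2_def[abs_def] by (simp_all add: pd_simps)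
  have e: "pd 1 (\<lambda>t. killing_matrix2 c t $ a $ b) s + (killing_matrix2 c s ** killing_matrix1 c s) $ a $ b =
    pd 2 (\<lambda>t. killing_matrix1 c t $ a $ b) s + (killing_matrix1 c s ** killing_matrix2 c s) $ a $ b" for a b
  proof -
    have "\<forall>a b. pd 1 (\<lambda>t. killing_matrix2 c t $ a $ b) s + (killing_matrix2 c s ** killing_matrix1 c s) $ a $ b =
      pd 2 (\<lambda>t. killing_matrix1 c t $ a $ b) s + (killing_matrix1 c s ** killing_matrix2 c s) $ a $ b"
      unfolding forall_3 killing_matrix1_def killing_matrix2_def matrix_matrix_mult_def
      by (simp add: sum_3 pd_simps pd2_christoffel pd_metric tr K tr1_def tr2_def algebra_simps)
    then show ?thesis by blast
  qed
  show ?thesis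
    by (simp add: vec_eq_iff p[OF smooth_killing_matrix(1)] p[OF smooth_killing_matrix(2)] e)
qed

proposition killing_forms_exist:
  assumes V: "open V" "s0 \<in> V" "V \<subseteq> U" and K: "\<And>s. s \<in> V \<Longrightarrow> K s = c"
  obtains r where "r > 0" "ball s0 r \<subseteq> V"
    "\<forall>p q w0. \<exists>k1 k2 w. killing_form (ball s0 r) k1 k2 w \<and> k1 s0 = p \<and> k2 s0 = q \<and> w s0 = w0"
proof -
  have dK: "pd i K s = 0" if "s \<in> V" for i s
    using pd_cong[OF V(1) that, of "\<lambda>t. c" K i] K by simp
  have sm: "smooth_on V (killing_matrix1 c)" "smooth_on V (killing_matrix2 c)"
    using smooth_killing_matrix smooth_on_subset V(3) by blast+
  obtain r where r: "r > 0" "ball s0 r \<subseteq> V"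
    "\<And>F0. \<exists>F. smooth_on (ball s0 r) F \<and> F s0 = F0 \<and>
       (\<forall>s\<in>ball s0 r. pd 1 F s = killing_matrix1 c s *v F s \<and> pd 2 F s = killing_matrix2 c s *v F s)"
    by (rule flat_linear_system[OF V(1,2) sm killing_system_flat], use V K dK in auto)
  show thesis
  proof (rule that[OF r(1,2)], intro allI)
    fix p q w0 :: real
    obtain F :: "real^2 \<Rightarrow> real^3" where F: "smooth_on (ball s0 r) F" "F s0 = vector [p, q, w0]"
      "\<forall>s\<in>ball s0 r. pd 1 F s = killing_matrix1 c s *v F s \<and> pd 2 F s = killing_matrix2 c s *v F s"
      using r(3)[of "vector [p, q, w0]"] by (elim exE conjE) (rule that)
    have pF: "pd i (\<lambda>s. F s $ j) s = pd i F s $ j" if "s \<in> ball s0 r" for i j s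
      by (rule pd_vec_nth[OF smooth_on_differentiable[OF F(1) that]])
    have "killing_form (ball s0 r) (\<lambda>s. F s $ 1) (\<lambda>s. F s $ 2) (\<lambda>s. F s $ 3)"
      unfolding killing_form_def
    proof (intro conjI ballI)
      show "smooth_on (ball s0 r) (\<lambda>s. F s $ 1)" "smooth_on (ball s0 r) (\<lambda>s. F s $ 2)"
        using F(1) by (auto intro: smooth_on_vec_nth)
      fix s assume s: "s \<in> ball s0 r"
      then have sU: "s \<in> U" using r V by blast
      show "nab (\<lambda>s. F s $ 1) (\<lambda>s. F s $ 2) 1 1 s = 0" "nab (\<lambda>s. F s $ 1) (\<lambda>s. F s $ 2) 1 2 s = F s $ 3"
        "nab (\<lambda>s. F s $ 1) (\<lambda>s. F s $ 2) 2 1 s = - F s $ 3" "nab (\<lambda>s. F s $ 1) (\<lambda>s. F s $ 2) 2 2 s = 0"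
        unfolding nab_def using F(3) s
        by (simp_all add: pF killing_matrix1_def killing_matrix2_def matrix_vector_mult_def sum_3
            christoffel_expand(7,8)[OF sU])
    qed
    then show "\<exists>k1 k2 w. killing_form (ball s0 r) k1 k2 w \<and> k1 s0 = p \<and> k2 s0 = q \<and> w s0 = w0"
      using F(2) by (intro exI[of _ "\<lambda>s. F s $ 1"] exI[of _ "\<lambda>s. F s $ 2"] exI[of _ "\<lambda>s. F s $ 3"]) simp
  qed
qed


section \<open>Normalization and jets of integrals\<close>

definition bracket_cond :: "(real^2 \<Rightarrow> real) \<Rightarrow> (real^2 \<Rightarrow> real) \<Rightarrow> (real^2 \<Rightarrow> real) \<Rightarrow> (real^2 \<Rightarrow> real) \<Rightarrow> real^2 \<Rightarrow> bool" where
  "bracket_cond x1 x2 y1 y2 s \<longleftrightarrow> (\<forall>a b. y1 s * a + y2 s * b \<noteq> 0 \<longrightarrow>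
      (y1 s * a + y2 s * b) * nabq x1 x2 s a b = (x1 s * a + x2 s * b) * nabq y1 y2 s a b)"

lemma fractional_linear_integral_on_iff:
  assumes V: "V \<subseteq> U"
  shows "fractional_linear_integral_on V g A B C E \<longleftrightarrow>
    smooth_on V A \<and> smooth_on V B \<and> smooth_on V C \<and> smooth_on V E \<and>
    (\<forall>s\<in>V. A s * E s - B s * C s \<noteq> 0 \<and> bracket_cond (low1 A B) (low2 A B) (low1 C E) (low2 C E) s)"
proof -
  have "(\<forall>m. C s * m $ 1 + E s * m $ 2 \<noteq> 0 \<longrightarrow>
      poisson (fractional_linear A B C E) (geodesic_hamiltonian g) (s, m) = 0) \<longleftrightarrow>
      bracket_cond (low1 A B) (low2 A B) (low1 C E) (low2 C E) s"
    if "s \<in> V" "smooth_on V A" "smooth_on V B" "smooth_on V C" "smooth_on V E" for s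
    unfolding bracket_cond_def
    by (rule bracket_condition_iff) (use that V smooth_on_differentiable in blast)+
  then show ?thesis
    unfolding fractional_linear_integral_on_def by blast
qed

lemma smooth_low:
  assumes "open V" "V \<subseteq> U" "smooth_on V A" "smooth_on V B"
  shows "smooth_on V (low1 A B)" "smooth_on V (low2 A B)"
  unfolding low1_def[abs_def] low2_def[abs_def]
  using assms smooth_g11 smooth_g12 smooth_g22 smooth_on_subset
  by (auto intro!: smooth_on_add smooth_on_mult)

lemma low_det:
  "low1 A B s * low2 C E s - low2 A B s * low1 C E s = dg s * (A s * E s - B s * C s)"
  unfolding low1_def low2_def dg_def by algebra

lemma low_scale: "low1 (\<lambda>t. \<rho> t * A t) (\<lambda>t. \<rho> t * B t) = (\<lambda>t. \<rho> t * low1 A B t)"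
  "low2 (\<lambda>t. \<rho> t * A t) (\<lambda>t. \<rho> t * B t) = (\<lambda>t. \<rho> t * low2 A B t)"
  unfolding low1_def[abs_def] low2_def[abs_def] by (auto simp: algebra_simps)

lemma nab_scale:
  assumes "\<rho> differentiable (at s)" "x1 differentiable (at s)" "x2 differentiable (at s)"
  shows "nab (\<lambda>t. \<rho> t * x1 t) (\<lambda>t. \<rho> t * x2 t) i k s =
    pd i \<rho> s * (if k = 1 then x1 s else x2 s) + \<rho> s * nab x1 x2 i k s"
  unfolding nab_def using assms by (simp add: pd_simps algebra_simps)

lemma nabq_scale:
  assumes "\<rho> differentiable (at s)" "x1 differentiable (at s)" "x2 differentiable (at s)"
  shows "nabq (\<lambda>t. \<rho> t * x1 t) (\<lambda>t. \<rho> t * x2 t) s a b =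
    (pd 1 \<rho> s * a + pd 2 \<rho> s * b) * (x1 s * a + x2 s * b) + \<rho> s * nabq x1 x2 s a b"
proof -
  have "(2::2) \<noteq> 1" by simp
  then show ?thesis
    unfolding nabq_def nab_scale[OF assms] by (simp add: algebra_simps power2_eq_square)
qed

text \<open>
  A common factor \<open>\<rho>\<close> does not change the quotient; it adds to both quadratic forms the
  product of the respective linear form with the derivative of \<open>\<rho>\<close>, and these additions cancel
  in the bracket condition. The factor \<open>\<epsilon>\<close> serves for the change of sign in the normalization.
\<close>

lemma fractional_linear_integral_scale:
  assumes V: "open V" "V \<subseteq> U" and I: "fractional_linear_integral_on V g A B C E"
    and \<rho>: "smooth_on V \<rho>" "\<And>s. s \<in> V \<Longrightarrow> \<rho> s \<noteq> 0" and \<epsilon>: "\<epsilon> \<noteq> 0"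
  shows "fractional_linear_integral_on V g (\<lambda>t. \<epsilon> * (\<rho> t * A t)) (\<lambda>t. \<epsilon> * (\<rho> t * B t)) (\<lambda>t. \<rho> t * C t) (\<lambda>t. \<rho> t * E t)"
proof -
  from I have sm: "smooth_on V A" "smooth_on V B" "smooth_on V C" "smooth_on V E"
    and c: "\<And>s. s \<in> V \<Longrightarrow> A s * E s - B s * C s \<noteq> 0"
      "\<And>s. s \<in> V \<Longrightarrow> bracket_cond (low1 A B) (low2 A B) (low1 C E) (low2 C E) s"
    unfolding fractional_linear_integral_on_iff[OF V(2)] by blast+
  have ne: "(\<epsilon> * (\<rho> s * A s)) * (\<rho> s * E s) - (\<epsilon> * (\<rho> s * B s)) * (\<rho> s * C s) \<noteq> 0" if "s \<in> V" for s
  proof -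
    have "(\<epsilon> * (\<rho> s * A s)) * (\<rho> s * E s) - (\<epsilon> * (\<rho> s * B s)) * (\<rho> s * C s) = \<epsilon> * \<rho> s * \<rho> s * (A s * E s - B s * C s)"
      by algebra
    then show ?thesis using c(1)[OF that] \<rho>(2)[OF that] \<epsilon> by simp
  qed
  have br: "bracket_cond (\<lambda>t. \<epsilon> * (\<rho> t * low1 A B t)) (\<lambda>t. \<epsilon> * (\<rho> t * low2 A B t)) (\<lambda>t. \<rho> t * low1 C E t) (\<lambda>t. \<rho> t * low2 C E t) s"
    if s: "s \<in> V" for s
    unfolding bracket_cond_def
  proof (intro allI impI)
    note d = smooth_on_differentiable[OF smooth_low(1)[OF V sm(1,2)] s] smooth_on_differentiable[OF smooth_low(2)[OF V sm(1,2)] s]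
      smooth_on_differentiable[OF smooth_low(1)[OF V sm(3,4)] s] smooth_on_differentiable[OF smooth_low(2)[OF V sm(3,4)] s]
      smooth_on_differentiable[OF \<rho>(1) s]
    fix a b assume *: "\<rho> s * low1 C E s * a + \<rho> s * low2 C E s * b \<noteq> 0"
    then have "low1 C E s * a + low2 C E s * b \<noteq> 0"
      by (metis mult.assoc mult_zero_right distrib_left)
    then have e: "(low1 C E s * a + low2 C E s * b) * nabq (low1 A B) (low2 A B) s a b =
        (low1 A B s * a + low2 A B s * b) * nabq (low1 C E) (low2 C E) s a b"
      using c(2)[OF s] unfolding bracket_cond_def by blast
    have "nabq (\<lambda>t. \<epsilon> * (\<rho> t * low1 A B t)) (\<lambda>t. \<epsilon> * (\<rho> t * low2 A B t)) s a b =
        \<epsilon> * nabq (\<lambda>t. \<rho> t * low1 A B t) (\<lambda>t. \<rho> t * low2 A B t) s a b"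
      using nabq_scale[of "\<lambda>t. \<epsilon>" s "\<lambda>t. \<rho> t * low1 A B t" "\<lambda>t. \<rho> t * low2 A B t" a b] d by simp
    then show "(\<rho> s * low1 C E s * a + \<rho> s * low2 C E s * b) *
        nabq (\<lambda>t. \<epsilon> * (\<rho> t * low1 A B t)) (\<lambda>t. \<epsilon> * (\<rho> t * low2 A B t)) s a b =
        (\<epsilon> * (\<rho> s * low1 A B s) * a + \<epsilon> * (\<rho> s * low2 A B s) * b) *
        nabq (\<lambda>t. \<rho> t * low1 C E t) (\<lambda>t. \<rho> t * low2 C E t) s a b"
      using e unfolding nabq_scale[OF d(5,1,2)] nabq_scale[OF d(5,3,4)] by algebra
  qed
  have low: "low1 (\<lambda>t. \<epsilon> * (\<rho> t * A t)) (\<lambda>t. \<epsilon> * (\<rho> t * B t)) = (\<lambda>t. \<epsilon> * (\<rho> t * low1 A B t))"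
    "low2 (\<lambda>t. \<epsilon> * (\<rho> t * A t)) (\<lambda>t. \<epsilon> * (\<rho> t * B t)) = (\<lambda>t. \<epsilon> * (\<rho> t * low2 A B t))"
    by (simp_all add: low_scale[of "\<lambda>t. \<epsilon>"] low_scale[of \<rho> A B])
  show ?thesis
    unfolding fractional_linear_integral_on_iff[OF V(2)] low low_scale[of \<rho> C E]
    using sm V(1) \<rho>(1) ne br by (auto intro!: smooth_on_mult smooth_on_const)
qed

lemma fractional_linear_integral_subset:
  "fractional_linear_integral_on V g A B C E \<Longrightarrow> W \<subseteq> V \<Longrightarrow> fractional_linear_integral_on W g A B C E"
  unfolding fractional_linear_integral_on_def using smooth_on_subset by blast

lemma normalized_integral_exists:
  assumes V: "open V" "s0 \<in> V" "V \<subseteq> U" and I: "fractional_linear_integral_on V g A B C E"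
  obtains W \<rho> \<epsilon> where "open W" "s0 \<in> W" "W \<subseteq> V" "smooth_on W \<rho>" "\<And>s. s \<in> W \<Longrightarrow> \<rho> s > 0"
    "\<rho> s0 = 1 / sqrt \<bar>A s0 * E s0 - B s0 * C s0\<bar>" "\<epsilon> = sgn (A s0 * E s0 - B s0 * C s0)"
    "fractional_linear_integral_on W g (\<lambda>t. \<epsilon> * (\<rho> t * A t)) (\<lambda>t. \<epsilon> * (\<rho> t * B t)) (\<lambda>t. \<rho> t * C t) (\<lambda>t. \<rho> t * E t)"
    "normalized_on W (\<lambda>t. \<epsilon> * (\<rho> t * A t)) (\<lambda>t. \<epsilon> * (\<rho> t * B t)) (\<lambda>t. \<rho> t * C t) (\<lambda>t. \<rho> t * E t)"
proof -
  define \<epsilon> where "\<epsilon> = sgn (A s0 * E s0 - B s0 * C s0)"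
  define D where "D s = \<epsilon> * (A s * E s - B s * C s)" for s
  define W where "W = {s \<in> V. D s > 0}"
  define \<rho> where "\<rho> s = 1 / sqrt (D s)" for s
  from I have sm: "smooth_on V A" "smooth_on V B" "smooth_on V C" "smooth_on V E"
    and ne: "\<And>s. s \<in> V \<Longrightarrow> A s * E s - B s * C s \<noteq> 0"
    unfolding fractional_linear_integral_on_def by blast+
  have smD: "smooth_on V D"
    unfolding D_def[abs_def] using V(1) sm by (intro smooth_intros)
  have \<epsilon>: "\<epsilon> = 1 \<or> \<epsilon> = -1" using ne[OF V(2)] by (auto simp: \<epsilon>_def sgn_if)
  have D0: "D s0 = \<bar>A s0 * E s0 - B s0 * C s0\<bar>" by (simp add: D_def \<epsilon>_def abs_sgn mult.commute)
  have W: "open W" "s0 \<in> W" "W \<subseteq> V"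
    using continuous_open_preimage[OF smooth_on_continuous[OF smD] V(1), of "{0<..}"] D0 ne[OF V(2)] V(2)
    by (auto simp: W_def vimage_def Int_def)
  have pos: "D s > 0" if "s \<in> W" for s using that by (simp add: W_def)
  have sqrt_pos: "sqrt (D s) \<noteq> 0" if "s \<in> W" for s using pos[OF that] by simp
  have sm\<rho>: "smooth_on W \<rho>"
    unfolding \<rho>_def[abs_def]
    by (intro smooth_on_divide smooth_on_const smooth_on_sqrt W smooth_on_subset[OF smD W(3)] pos sqrt_pos)
  have \<rho>pos: "\<rho> s > 0" if "s \<in> W" for s using pos[OF that] by (simp add: \<rho>_def)
  show thesis
  proof (rule that[OF W sm\<rho> \<rho>pos])
    show "\<rho> s0 = 1 / sqrt \<bar>A s0 * E s0 - B s0 * C s0\<bar>" by (simp add: \<rho>_def D0)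
    show "\<epsilon> = sgn (A s0 * E s0 - B s0 * C s0)" by (simp add: \<epsilon>_def)
    show "fractional_linear_integral_on W g (\<lambda>t. \<epsilon> * (\<rho> t * A t)) (\<lambda>t. \<epsilon> * (\<rho> t * B t)) (\<lambda>t. \<rho> t * C t) (\<lambda>t. \<rho> t * E t)"
      using \<rho>pos \<epsilon> V W
      by (intro fractional_linear_integral_scale fractional_linear_integral_subset[OF I W(3)] sm\<rho>) force+
    show "normalized_on W (\<lambda>t. \<epsilon> * (\<rho> t * A t)) (\<lambda>t. \<epsilon> * (\<rho> t * B t)) (\<lambda>t. \<rho> t * C t) (\<lambda>t. \<rho> t * E t)"
      unfolding normalized_on_def
    proof
      fix s assume s: "s \<in> W"
      have "\<epsilon> * (\<rho> s * A s) * (\<rho> s * E s) - \<epsilon> * (\<rho> s * B s) * (\<rho> s * C s) = \<rho> s * \<rho> s * D s"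
        unfolding D_def by algebra
      also have "\<dots> = 1" using pos[OF s] by (simp add: \<rho>_def)
      finally show "\<epsilon> * (\<rho> s * A s) * (\<rho> s * E s) - \<epsilon> * (\<rho> s * B s) * (\<rho> s * C s) = 1" .
    qed
  qed
qed

end

lemma vector_4 [simp]:
  "(vector [a, b, c, d] :: 'a::zero^4) $ 1 = a" "(vector [a, b, c, d] :: 'a::zero^4) $ 2 = b"
  "(vector [a, b, c, d] :: 'a::zero^4) $ 3 = c" "(vector [a, b, c, d] :: 'a::zero^4) $ 4 = d"
  unfolding vector_def by simp_all

context riemannian_domain
begin

text \<open>
  The partial derivatives at \<open>s\<close> of a vector field with value \<open>X\<close> that belongs to a normalized
  integral; \<open>u\<close> is the vector dual to the value of the form of the integral.
\<close>

definition "slope11 s u1 u2 X1 X2 = - \<Gamma> 1 1 1 s * X1 - \<Gamma> 1 1 2 s * X2 +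
  (tr1 s - (g11 s * u1 + g12 s * u2)) / 2 * X1 + u1 * (g11 s * X1 + g12 s * X2)"
definition "slope12 s u1 u2 X1 X2 = - \<Gamma> 2 1 1 s * X1 - \<Gamma> 2 1 2 s * X2 +
  (tr1 s - (g11 s * u1 + g12 s * u2)) / 2 * X2 + u2 * (g11 s * X1 + g12 s * X2)"
definition "slope21 s u1 u2 X1 X2 = - \<Gamma> 1 1 2 s * X1 - \<Gamma> 1 2 2 s * X2 +
  (tr2 s - (g12 s * u1 + g22 s * u2)) / 2 * X1 + u1 * (g12 s * X1 + g22 s * X2)"
definition "slope22 s u1 u2 X1 X2 = - \<Gamma> 2 1 2 s * X1 - \<Gamma> 2 2 2 s * X2 +
  (tr2 s - (g12 s * u1 + g22 s * u2)) / 2 * X2 + u2 * (g12 s * X1 + g22 s * X2)"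

definition integral_jet :: "real^2 \<Rightarrow> real^4 \<Rightarrow> real^2 \<Rightarrow> (real^4) \<times> ((real^4)^2)" where
  "integral_jet s v u = (v, vector [
     vector [slope11 s (u $ 1) (u $ 2) (v $ 1) (v $ 2), slope12 s (u $ 1) (u $ 2) (v $ 1) (v $ 2),
             slope11 s (u $ 1) (u $ 2) (v $ 3) (v $ 4), slope12 s (u $ 1) (u $ 2) (v $ 3) (v $ 4)],
     vector [slope21 s (u $ 1) (u $ 2) (v $ 1) (v $ 2), slope22 s (u $ 1) (u $ 2) (v $ 1) (v $ 2),
             slope21 s (u $ 1) (u $ 2) (v $ 3) (v $ 4), slope22 s (u $ 1) (u $ 2) (v $ 3) (v $ 4)]])"

lemma pd_of_low_splits:
  assumes s: "s \<in> U" and A: "A differentiable (at s)" and B: "B differentiable (at s)"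
    and b: "b1 = g11 s * u1 + g12 s * u2" "b2 = g12 s * u1 + g22 s * u2"
    and sp: "nab_splits ((tr1 s - b1) / 2) ((tr2 s - b2) / 2) b1 b2 (low1 A B) (low2 A B) s"
  shows "pd 1 A s = slope11 s u1 u2 (A s) (B s)" "pd 1 B s = slope12 s u1 u2 (A s) (B s)"
    "pd 2 A s = slope21 s u1 u2 (A s) (B s)" "pd 2 B s = slope22 s u1 u2 (A s) (B s)"
proof -
  have l: "pd i (low1 A B) s = pd i g11 s * A s + g11 s * pd i A s + (pd i g12 s * B s + g12 s * pd i B s)"
    "pd i (low2 A B) s = pd i g12 s * A s + g12 s * pd i A s + (pd i g22 s * B s + g22 s * pd i B s)" for i
    unfolding low1_def[abs_def] low2_def[abs_def] using s A B by (simp_all add: pd_simps)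
  define a1 a2 where a: "a1 = (tr1 s - b1) / 2" "a2 = (tr2 s - b2) / 2"
  note p = nab_splits_pd[OF s sp, folded a, unfolded l, unfolded low1_def low2_def pd_metric[OF s] b]
  have sl: "slope11 s u1 u2 (A s) (B s) = - \<Gamma> 1 1 1 s * A s - \<Gamma> 1 1 2 s * B s + a1 * A s + u1 * (g11 s * A s + g12 s * B s)"
    "slope12 s u1 u2 (A s) (B s) = - \<Gamma> 2 1 1 s * A s - \<Gamma> 2 1 2 s * B s + a1 * B s + u2 * (g11 s * A s + g12 s * B s)"
    "slope21 s u1 u2 (A s) (B s) = - \<Gamma> 1 1 2 s * A s - \<Gamma> 1 2 2 s * B s + a2 * A s + u1 * (g12 s * A s + g22 s * B s)"
    "slope22 s u1 u2 (A s) (B s) = - \<Gamma> 2 1 2 s * A s - \<Gamma> 2 2 2 s * B s + a2 * B s + u2 * (g12 s * A s + g22 s * B s)"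
    unfolding slope11_def slope12_def slope21_def slope22_def a b by simp_all
  show "pd 1 A s = slope11 s u1 u2 (A s) (B s)" "pd 1 B s = slope12 s u1 u2 (A s) (B s)"
    unfolding sl by (rule dg_cancel[OF s], use p(1,2) in \<open>unfold dg_def, algebra\<close>)+
  show "pd 2 A s = slope21 s u1 u2 (A s) (B s)" "pd 2 B s = slope22 s u1 u2 (A s) (B s)"
    unfolding sl by (rule dg_cancel[OF s], use p(3,4) in \<open>unfold dg_def, algebra\<close>)+
qed

text \<open>
  The form of the integral with the coefficients \<open>A\<close>, \<open>B\<close>, \<open>C\<close>, \<open>E\<close>.
\<close>

definition "assoc_form1 A B C E = form1 (low1 A B) (low2 A B) (low1 C E) (low2 C E)"
definition "assoc_form2 A B C E = form2 (low1 A B) (low2 A B) (low1 C E) (low2 C E)"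

lemma normalized_integral_structure:
  assumes V: "open V" "V \<subseteq> U" and I: "fractional_linear_integral_on V g A B C E" and n: "normalized_on V A B C E"
  shows "integral_form V (assoc_form1 A B C E) (assoc_form2 A B C E)"
    and "\<And>s u. s \<in> V \<Longrightarrow> assoc_form1 A B C E s = g11 s * u $ 1 + g12 s * u $ 2 \<Longrightarrow>
      assoc_form2 A B C E s = g12 s * u $ 1 + g22 s * u $ 2 \<Longrightarrow>
      jet1 s (\<lambda>s. vector [A s, B s, C s, E s]) = integral_jet s (vector [A s, B s, C s, E s]) u"
proof -
  let ?b1 = "assoc_form1 A B C E" and ?b2 = "assoc_form2 A B C E"
  from I have sm: "smooth_on V A" "smooth_on V B" "smooth_on V C" "smooth_on V E"
    and br: "\<And>s. s \<in> V \<Longrightarrow> bracket_cond (low1 A B) (low2 A B) (low1 C E) (low2 C E) s"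
    unfolding fractional_linear_integral_on_iff[OF V(2)] by blast+
  have det: "low1 A B s * low2 C E s - low2 A B s * low1 C E s = dg s" if "s \<in> V" for s
    using n that unfolding low_det normalized_on_def by simp
  have dne: "low1 A B s * low2 C E s - low2 A B s * low1 C E s \<noteq> 0" if "s \<in> V" for s
    using det[OF that] dg_pos[of s] that V by auto
  note sml = smooth_low[OF V sm(1,2)] smooth_low[OF V sm(3,4)]
  have splits: "nab_splits ((tr1 s - ?b1 s) / 2) ((tr2 s - ?b2 s) / 2) (?b1 s) (?b2 s) (low1 A B) (low2 A B) s \<and>
      nab_splits ((tr1 s - ?b1 s) / 2) ((tr2 s - ?b2 s) / 2) (?b1 s) (?b2 s) (low1 C E) (low2 C E) s"
    if s: "s \<in> V" for s
  proof -
    obtain a1 a2 where *: "nab_splits a1 a2 (?b1 s) (?b2 s) (low1 A B) (low2 A B) s"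
      "nab_splits a1 a2 (?b1 s) (?b2 s) (low1 C E) (low2 C E) s"
      unfolding assoc_form1_def assoc_form2_def
      by (rule bracket_condition_splits[OF dne[OF s] br[OF s, unfolded bracket_cond_def]])
    note dl = sml[THEN smooth_on_differentiable[OF _ s]]
    have "a1 = (tr1 s - ?b1 s) / 2" "a2 = (tr2 s - ?b2 s) / 2"
      using nab_splits_trace[OF V s dl det *] by simp_all
    with * show ?thesis by simp
  qed
  have smb: "smooth_on V ?b1" "smooth_on V ?b2"
    unfolding assoc_form1_def assoc_form2_def using smooth_form[OF V sml dne] by blast+
  have sma: "smooth_on V (\<lambda>s. (tr1 s - ?b1 s) / 2)" "smooth_on V (\<lambda>s. (tr2 s - ?b2 s) / 2)"
    unfolding divide_inverse
    by (intro smooth_intros V smb smooth_on_subset[OF smooth_tr(1) V(2)] smooth_on_subset[OF smooth_tr(2) V(2)])+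
  show "integral_form V ?b1 ?b2"
    by (rule integral_formI[OF V sml smb sma dne]) (use splits in blast)+
  fix s and u :: "real^2" assume s: "s \<in> V" and u: "?b1 s = g11 s * u $ 1 + g12 s * u $ 2" "?b2 s = g12 s * u $ 1 + g22 s * u $ 2"
  have sU: "s \<in> U" using s V by blast
  let ?F = "\<lambda>s. vector [A s, B s, C s, E s] :: real^4"
  have smF: "smooth_on V ?F"
  proof (rule smooth_on_vec[OF V(1)])
    have "\<forall>i. smooth_on V (\<lambda>x. ?F x $ i)" using sm by (simp add: forall_4)
    then show "smooth_on V (\<lambda>x. ?F x $ i)" for i by blast
  qed
  have c: "pd j ?F s $ i = pd j (\<lambda>s. ?F s $ i) s" for i j
    by (rule pd_vec_nth[OF smooth_on_differentiable[OF smF s], symmetric])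
  note d = smooth_on_differentiable[OF sm(1) s] smooth_on_differentiable[OF sm(2) s]
    smooth_on_differentiable[OF sm(3) s] smooth_on_differentiable[OF sm(4) s]
  note p = pd_of_low_splits[OF sU d(1,2) u splits[OF s, THEN conjunct1]]
    pd_of_low_splits[OF sU d(3,4) u splits[OF s, THEN conjunct2]]
  show "jet1 s ?F = integral_jet s (?F s) u"
    unfolding jet1_def integral_jet_def by (simp add: vec_eq_iff forall_2 forall_4 c p)
qed

lemma ex_dual_vector:
  assumes s: "s \<in> U"
  obtains u :: "real^2" where "b1 = g11 s * u $ 1 + g12 s * u $ 2" "b2 = g12 s * u $ 1 + g22 s * u $ 2"
  using ex_velocity[OF s, of "vector [b1, b2]"] by auto

text \<open>
  The jets of integrals lie in a manifold parametrized by the values and the dual vector \<open>u\<close>,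
  and only those \<open>u\<close> occur that come from a solution of the equation for the form.
\<close>

lemma integral_jetsD:
  assumes z: "z \<in> integral_jets U g s0"
  obtains v u V b1 b2 where "z = integral_jet s0 v u" "v $ 1 * v $ 4 - v $ 2 * v $ 3 = 1"
    "open V" "s0 \<in> V" "V \<subseteq> U" "integral_form V b1 b2"
    "b1 s0 = g11 s0 * u $ 1 + g12 s0 * u $ 2" "b2 s0 = g12 s0 * u $ 1 + g22 s0 * u $ 2"
proof -
  from z obtain A B C E V where z: "z = jet1 s0 (\<lambda>s. vector [A s, B s, C s, E s])" and V: "open V" "s0 \<in> V" "V \<subseteq> U"
    and I: "fractional_linear_integral_on V g A B C E" "normalized_on V A B C E"
    unfolding integral_jets_def by blast
  obtain u :: "real^2" where u: "assoc_form1 A B C E s0 = g11 s0 * u $ 1 + g12 s0 * u $ 2"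
    "assoc_form2 A B C E s0 = g12 s0 * u $ 1 + g22 s0 * u $ 2"
    using ex_dual_vector[of s0] V by blast
  show thesis
    by (rule that[OF _ _ V normalized_integral_structure(1)[OF V(1,3) I] u])
      (use normalized_integral_structure(2)[OF V(1,3) I V(2) u] z I(2) V(2) in \<open>auto simp: normalized_on_def\<close>)
qed

text \<open>
  In constant curvature the quotient of two independent Killing forms, normalized, is an
  integral; the values of the forms and of their derivatives at \<open>s0\<close> are arbitrary.
\<close>

lemma integral_jet_in_integral_jets:
  assumes V: "open V" "s0 \<in> V" "V \<subseteq> U" and K: "\<And>s. s \<in> V \<Longrightarrow> K s = c"
    and v: "v $ 1 * v $ 4 - v $ 2 * v $ 3 = 1"
  shows "integral_jet s0 v u \<in> integral_jets U g s0"
proof -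
  have s0: "s0 \<in> U" using V by blast
  obtain r where r: "r > 0" "ball s0 r \<subseteq> V" and ex:
    "\<forall>p q w0. \<exists>k1 k2 w. killing_form (ball s0 r) k1 k2 w \<and> k1 s0 = p \<and> k2 s0 = q \<and> w s0 = w0"
    by (rule killing_forms_exist[OF V K]) blast
  define b1 b2 where b: "b1 = g11 s0 * u $ 1 + g12 s0 * u $ 2" "b2 = g12 s0 * u $ 1 + g22 s0 * u $ 2"
  define p1 p2 q1 q2 where pq: "p1 = g11 s0 * v $ 1 + g12 s0 * v $ 2" "p2 = g12 s0 * v $ 1 + g22 s0 * v $ 2"
    "q1 = g11 s0 * v $ 3 + g12 s0 * v $ 4" "q2 = g12 s0 * v $ 3 + g22 s0 * v $ 4"
  \<comment> \<open>A multiple of a Killing form satisfies \<open>nab_splits\<close> with the covector \<open>b\<close> where \<open>w = b2 k1 - b1 k2\<close>.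
     This determines the initial values of \<open>w\<close> and \<open>w'\<close>.\<close>
  obtain k1 k2 w where k: "killing_form (ball s0 r) k1 k2 w" "k1 s0 = p1" "k2 s0 = p2" "w s0 = b2 * p1 - b1 * p2"
    using ex[rule_format, of p1 p2 "b2 * p1 - b1 * p2"] by blast
  obtain l1 l2 w' where l: "killing_form (ball s0 r) l1 l2 w'" "l1 s0 = q1" "l2 s0 = q2" "w' s0 = b2 * q1 - b1 * q2"
    using ex[rule_format, of q1 q2 "b2 * q1 - b1 * q2"] by blast
  have d0: "p1 * q2 - p2 * q1 = dg s0"
  proof -
    have "p1 * q2 - p2 * q1 = dg s0 * (v $ 1 * v $ 4 - v $ 2 * v $ 3)" unfolding pq dg_def by algebra
    then show ?thesis using v by simp
  qed
  define B0 where "B0 = ball s0 r \<inter> {s \<in> V. k1 s * l2 s - k2 s * l1 s > 0}"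
  have smk: "smooth_on (ball s0 r) k1" "smooth_on (ball s0 r) k2" "smooth_on (ball s0 r) l1" "smooth_on (ball s0 r) l2"
    using k(1) l(1) unfolding killing_form_def by blast+
  have "B0 = ball s0 r \<inter> (\<lambda>s. k1 s * l2 s - k2 s * l1 s) -` {0<..}"
    using r(2) by (auto simp: B0_def)
  also have "open \<dots>"
    using smk[THEN smooth_on_continuous]
    by (intro continuous_open_preimage continuous_intros) auto
  finally have oB: "open B0" .
  have sB: "s0 \<in> B0" using r V k l d0 dg_pos[OF s0] by (simp add: B0_def)
  have BU: "B0 \<subseteq> U" and Bball: "B0 \<subseteq> ball s0 r" using V by (auto simp: B0_def)
  define raise1 raise2 where "raise1 = (\<lambda>x y s. (g22 s * x s - g12 s * y s) / dg s)"
    and "raise2 = (\<lambda>x y s. (g11 s * y s - g12 s * x s) / dg s)"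
  have low_raise: "low1 (raise1 x y) (raise2 x y) s = x s" "low2 (raise1 x y) (raise2 x y) s = y s" if "s \<in> U" for x y s
    using dg_pos[OF that] unfolding low1_def low2_def raise1_def raise2_def
    by (simp_all add: field_simps) (simp_all add: dg_def algebra_simps)
  have raise_smooth: "smooth_on B0 (raise1 x y)" "smooth_on B0 (raise2 x y)"
    if "smooth_on (ball s0 r) x" "smooth_on (ball s0 r) y" for x y
    unfolding raise1_def raise2_def
    using smooth_on_subset[OF that(1) Bball] smooth_on_subset[OF that(2) Bball] smooth_geometry(1-4)[THEN smooth_on_subset[OF _ BU]] oB BU dg_pos
    by (intro smooth_on_divide smooth_on_diff smooth_on_mult; force)+
  let ?A = "raise1 k1 k2" and ?B = "raise2 k1 k2" and ?C = "raise1 l1 l2" and ?E = "raise2 l1 l2"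
  have nab_low: "nab (low1 (raise1 x y) (raise2 x y)) (low2 (raise1 x y) (raise2 x y)) i j s = nab x y i j s"
    if "s \<in> B0" "smooth_on (ball s0 r) x" "smooth_on (ball s0 r) y" for x y i j s
  proof -
    have s: "s \<in> U" using that BU by blast
    have diff: "x differentiable (at s)" "y differentiable (at s)"
      using smooth_on_differentiable that Bball by blast+
    have "pd i (low1 (raise1 x y) (raise2 x y)) s = pd i x s" "pd i (low2 (raise1 x y) (raise2 x y)) s = pd i y s"
      by (rule pd_cong[OF oB that(1) _ diff(1)], simp add: low_raise(1)[OF subsetD[OF BU]])
        (rule pd_cong[OF oB that(1) _ diff(2)], simp add: low_raise(2)[OF subsetD[OF BU]])
    then show ?thesis unfolding nab_def using low_raise[OF s] by simp
  qed
  have kill: "nab k1 k2 1 1 s = 0 \<and> nab k1 k2 1 2 s = w s \<and> nab k1 k2 2 1 s = - w s \<and> nab k1 k2 2 2 s = 0"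
    "nab l1 l2 1 1 s = 0 \<and> nab l1 l2 1 2 s = w' s \<and> nab l1 l2 2 1 s = - w' s \<and> nab l1 l2 2 2 s = 0"
    if "s \<in> B0" for s
    using k(1) l(1) that Bball unfolding killing_form_def by blast+
  have I: "fractional_linear_integral_on B0 g ?A ?B ?C ?E"
    unfolding fractional_linear_integral_on_iff[OF BU]
  proof (intro conjI ballI raise_smooth smk)
    fix s assume s: "s \<in> B0"
    then have sU: "s \<in> U" using BU by blast
    show "bracket_cond (low1 ?A ?B) (low2 ?A ?B) (low1 ?C ?E) (low2 ?C ?E) s"
      unfolding bracket_cond_def nabq_def nab_low[OF s smk(1,2)] nab_low[OF s smk(3,4)]
      using kill[OF s] by simp
    have "dg s * (?A s * ?E s - ?B s * ?C s) > 0"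
      unfolding low_det[symmetric] low_raise[OF sU] using s by (simp add: B0_def)
    then show "?A s * ?E s - ?B s * ?C s \<noteq> 0" by auto
  qed
  have low0: "low1 ?A ?B s0 = p1" "low2 ?A ?B s0 = p2" "low1 ?C ?E s0 = q1" "low2 ?C ?E s0 = q2"
    using low_raise[OF s0] k l by simp_all
  have det0: "?A s0 * ?E s0 - ?B s0 * ?C s0 = 1"
  proof -
    have "dg s0 * (?A s0 * ?E s0 - ?B s0 * ?C s0) = dg s0 * 1"
      unfolding low_det[symmetric] low0 using d0 by simp
    then show ?thesis using dg_pos[OF s0] by simp
  qed
  obtain W \<rho> \<epsilon> where W: "open W" "s0 \<in> W" "W \<subseteq> B0" and \<rho>: "smooth_on W \<rho>" "\<And>s. s \<in> W \<Longrightarrow> \<rho> s > 0"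
    "\<rho> s0 = 1 / sqrt \<bar>?A s0 * ?E s0 - ?B s0 * ?C s0\<bar>" and \<epsilon>: "\<epsilon> = sgn (?A s0 * ?E s0 - ?B s0 * ?C s0)"
    and IW: "fractional_linear_integral_on W g (\<lambda>t. \<epsilon> * (\<rho> t * ?A t)) (\<lambda>t. \<epsilon> * (\<rho> t * ?B t)) (\<lambda>t. \<rho> t * ?C t) (\<lambda>t. \<rho> t * ?E t)"
    "normalized_on W (\<lambda>t. \<epsilon> * (\<rho> t * ?A t)) (\<lambda>t. \<epsilon> * (\<rho> t * ?B t)) (\<lambda>t. \<rho> t * ?C t) (\<lambda>t. \<rho> t * ?E t)"
    by (rule normalized_integral_exists[OF oB sB BU I]) blast
  have e1: "\<epsilon> = 1" and \<rho>1: "\<rho> s0 = 1" using \<rho>(3) \<epsilon> det0 by simp_all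
  let ?A' = "\<lambda>t. \<rho> t * ?A t" and ?B' = "\<lambda>t. \<rho> t * ?B t" and ?C' = "\<lambda>t. \<rho> t * ?C t" and ?E' = "\<lambda>t. \<rho> t * ?E t"
  have IW': "fractional_linear_integral_on W g ?A' ?B' ?C' ?E'" "normalized_on W ?A' ?B' ?C' ?E'"
    using IW unfolding e1 by simp_all
  have WU: "W \<subseteq> U" using W BU by blast
  have d: "\<rho> differentiable (at s0)" "low1 ?A ?B differentiable (at s0)" "low2 ?A ?B differentiable (at s0)"
    "low1 ?C ?E differentiable (at s0)" "low2 ?C ?E differentiable (at s0)"
    using smooth_low[OF oB BU raise_smooth(1)[OF smk(1,2)] raise_smooth(2)[OF smk(1,2)]]
      smooth_low[OF oB BU raise_smooth(1)[OF smk(3,4)] raise_smooth(2)[OF smk(3,4)]]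
    by (simp_all add: smooth_on_differentiable[OF \<rho>(1) W(2)] smooth_on_differentiable[OF _ sB])
  have two: "(2::2) \<noteq> 1" by simp
  have lv: "low1 ?A' ?B' s0 = p1" "low2 ?A' ?B' s0 = p2" "low1 ?C' ?E' s0 = q1" "low2 ?C' ?E' s0 = q2"
    by (simp_all only: low_scale low0 \<rho>1 mult_1)
  have n: "nab (low1 ?A' ?B') (low2 ?A' ?B') i j s0 = pd i \<rho> s0 * (if j = 1 then p1 else p2) + nab k1 k2 i j s0"
    "nab (low1 ?C' ?E') (low2 ?C' ?E') i j s0 = pd i \<rho> s0 * (if j = 1 then q1 else q2) + nab l1 l2 i j s0" for i j
    by (simp_all only: low_scale nab_scale[OF d(1-3)] nab_scale[OF d(1,4,5)] nab_low[OF sB smk(1,2)]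
        nab_low[OF sB smk(3,4)] low0 \<rho>1 mult_1)
  have nk: "nab (low1 ?A' ?B') (low2 ?A' ?B') 1 1 s0 = pd 1 \<rho> s0 * p1"
    "nab (low1 ?A' ?B') (low2 ?A' ?B') 1 2 s0 = pd 1 \<rho> s0 * p2 + (b2 * p1 - b1 * p2)"
    "nab (low1 ?A' ?B') (low2 ?A' ?B') 2 1 s0 = pd 2 \<rho> s0 * p1 - (b2 * p1 - b1 * p2)"
    "nab (low1 ?A' ?B') (low2 ?A' ?B') 2 2 s0 = pd 2 \<rho> s0 * p2"
    using kill(1)[OF sB] two unfolding n k(4) by simp_all
  have nl: "nab (low1 ?C' ?E') (low2 ?C' ?E') 1 1 s0 = pd 1 \<rho> s0 * q1"
    "nab (low1 ?C' ?E') (low2 ?C' ?E') 1 2 s0 = pd 1 \<rho> s0 * q2 + (b2 * q1 - b1 * q2)"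
    "nab (low1 ?C' ?E') (low2 ?C' ?E') 2 1 s0 = pd 2 \<rho> s0 * q1 - (b2 * q1 - b1 * q2)"
    "nab (low1 ?C' ?E') (low2 ?C' ?E') 2 2 s0 = pd 2 \<rho> s0 * q2"
    using kill(2)[OF sB] two unfolding n l(4) by simp_all
  have fP: "frameP (low1 ?A' ?B') (low2 ?A' ?B') (low1 ?C' ?E') (low2 ?C' ?E') s0 = (b2 * p1 - b1 * p2) * dg s0"
    unfolding frameP_def nk lv d0[symmetric] by algebra
  have fR: "frameR (low1 ?A' ?B') (low2 ?A' ?B') (low1 ?C' ?E') (low2 ?C' ?E') s0 = - (b2 * q1 - b1 * q2) * dg s0"
    unfolding frameR_def nl lv d0[symmetric] by algebra
  have ne: "dg s0 \<noteq> 0" using dg_pos[OF s0] by simp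
  have co: "assoc_form1 ?A' ?B' ?C' ?E' s0 = b1" "assoc_form2 ?A' ?B' ?C' ?E' s0 = b2"
  proof -
    have "(- (b2 * q1 - b1 * q2) * dg s0 * p1 + (b2 * p1 - b1 * p2) * dg s0 * q1) = b1 * (dg s0)\<^sup>2"
      "(- (b2 * q1 - b1 * q2) * dg s0 * p2 + (b2 * p1 - b1 * p2) * dg s0 * q2) = b2 * (dg s0)\<^sup>2"
      unfolding d0[symmetric] by algebra+
    then show "assoc_form1 ?A' ?B' ?C' ?E' s0 = b1" "assoc_form2 ?A' ?B' ?C' ?E' s0 = b2"
      unfolding assoc_form1_def assoc_form2_def form1_def form2_def fP fR lv d0
      using ne by simp_all
  qed
  have vals: "vector [?A' s0, ?B' s0, ?C' s0, ?E' s0] = v"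
  proof -
    have "?A s0 = v $ 1" "?B s0 = v $ 2" "?C s0 = v $ 3" "?E s0 = v $ 4"
      by (rule dg_cancel[OF s0], use k l ne in \<open>simp add: raise1_def raise2_def pq\<close>, simp add: dg_def algebra_simps)+
    then show ?thesis by (simp add: vec_eq_iff forall_4 \<rho>1)
  qed
  have "integral_jet s0 v u = jet1 s0 (\<lambda>s. vector [?A' s, ?B' s, ?C' s, ?E' s])"
    using normalized_integral_structure(2)[OF W(1) WU IW' W(2), of u] co b vals by simp
  then show ?thesis
    unfolding integral_jets_def mem_Collect_eq using W WU IW'
    by (intro exI[of _ ?A'] exI[of _ ?B'] exI[of _ ?C'] exI[of _ ?E'] exI[of _ W] conjI)
qed

text \<open>
  The dual vector is recovered from two entries of the left translates of the derivatives, each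
  of which contains just one of its components.
\<close>

definition "jet_dual s z = (vector
  [(fst z $ 1 * snd z $ 2 $ 3 - fst z $ 3 * snd z $ 2 $ 1 + \<Gamma> 1 2 2 s) / g22 s,
   (fst z $ 4 * snd z $ 1 $ 2 - fst z $ 2 * snd z $ 1 $ 4 + \<Gamma> 2 1 1 s) / g11 s] :: real^2)"

lemma g_diag_pos: "s \<in> U \<Longrightarrow> g11 s > 0" "s \<in> U \<Longrightarrow> g22 s > 0"
  using g_quadratic_pos[of s 1 0] g_quadratic_pos[of s 0 1] by simp_all

lemma jet_dual_integral_jet:
  assumes s: "s \<in> U" and v: "v $ 1 * v $ 4 - v $ 2 * v $ 3 = 1"
  shows "jet_dual s (integral_jet s v u) = u"
proof -
  have "v $ 1 * slope21 s (u $ 1) (u $ 2) (v $ 3) (v $ 4) - v $ 3 * slope21 s (u $ 1) (u $ 2) (v $ 1) (v $ 2) =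
      (u $ 1 * g22 s - \<Gamma> 1 2 2 s) * (v $ 1 * v $ 4 - v $ 2 * v $ 3)"
    unfolding slope21_def by (simp add: algebra_simps)
  moreover have "v $ 4 * slope12 s (u $ 1) (u $ 2) (v $ 1) (v $ 2) - v $ 2 * slope12 s (u $ 1) (u $ 2) (v $ 3) (v $ 4) =
      (u $ 2 * g11 s - \<Gamma> 2 1 1 s) * (v $ 1 * v $ 4 - v $ 2 * v $ 3)"
    unfolding slope12_def by (simp add: algebra_simps)
  ultimately show ?thesis
    unfolding jet_dual_def integral_jet_def using g_diag_pos[OF s] v
    by (simp add: vec_eq_iff forall_2)
qed

end

section \<open>The manifold of jets\<close>

lemma Ck_on_compose_linear:
  assumes U: "open U" and V: "open V" and L: "bounded_linear L" "L ` V \<subseteq> U"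
  shows "Ck_on k U f \<Longrightarrow> Ck_on k V (\<lambda>x. f (L x))"
proof (induction k arbitrary: f)
  case 0
  then show ?case
    using continuous_on_compose2[OF _ linear_continuous_on[OF L(1)] L(2)] by simp
next
  case (Suc k)
  show ?case
  proof (rule Ck_on_SucI[OF V, where f' = "\<lambda>x v. frechet_derivative f (at (L x)) (L v)"])
    fix x assume "x \<in> V"
    then have "L x \<in> U" using L(2) by blast
    then show "((\<lambda>x. f (L x)) has_derivative (\<lambda>v. frechet_derivative f (at (L x)) (L v))) (at x)"
      using has_derivative_compose[where g = f and f = L, OF bounded_linear_imp_has_derivative[OF L(1)]]
        Ck_on_SucE[OF Suc.prems] by blast
  next
    fix v
    show "Ck_on k V (\<lambda>x. frechet_derivative f (at (L x)) (L v))"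
      by (rule Suc.IH) (use Suc.prems in simp)
  qed
qed

lemma smooth_on_compose_linear:
  assumes "open U" "open V" "bounded_linear L" "L ` V \<subseteq> U" "smooth_on U f"
  shows "smooth_on V (\<lambda>x. f (L x))"
  using assms Ck_on_compose_linear unfolding smooth_on_def by blast

text \<open>
  The condition on a single point in the definition of an embedded submanifold; charts at some
  points are carried to others by linear symmetries of the set.
\<close>

definition slice_chart_at :: "nat \<Rightarrow> 'a::euclidean_space set \<Rightarrow> 'a \<Rightarrow> bool" where
  "slice_chart_at d M z \<longleftrightarrow> (\<exists>W W' T. \<exists>\<phi> :: 'a \<Rightarrow> 'a. \<exists>\<psi> :: 'a \<Rightarrow> 'a.
        open W \<and> z \<in> W \<and> open W' \<and> subspace T \<and> dim T = d \<and>
        smooth_on W \<phi> \<and> smooth_on W' \<psi> \<and> \<phi> ` W = W' \<and> \<psi> ` W' = W \<and>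
        (\<forall>w\<in>W. \<psi> (\<phi> w) = w) \<and> (\<forall>w\<in>W'. \<phi> (\<psi> w) = w) \<and>
        \<phi> ` (M \<inter> W) = T \<inter> W')"

lemma embedded_submanifold_iff: "embedded_submanifold d M \<longleftrightarrow> (\<forall>z\<in>M. slice_chart_at d M z)"
  unfolding embedded_submanifold_def slice_chart_at_def ..

lemma slice_chart_at_linear:
  fixes M :: "'a::euclidean_space set"
  assumes "bounded_linear \<sigma>" "bounded_linear \<tau>" and inv: "\<And>w. \<tau> (\<sigma> w) = w" "\<And>w. \<sigma> (\<tau> w) = w"
    and M: "\<And>w. \<sigma> w \<in> M \<longleftrightarrow> w \<in> M" and ch: "slice_chart_at d M (\<sigma> z)"
  shows "slice_chart_at d M z"
proof -
  obtain W W' T and \<phi> \<psi> :: "'a \<Rightarrow> 'a" where c: "open W" "\<sigma> z \<in> W" "open W'" "subspace T" "dim T = d"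
    "smooth_on W \<phi>" "smooth_on W' \<psi>" "\<phi> ` W = W'" "\<psi> ` W' = W"
    "\<forall>w\<in>W. \<psi> (\<phi> w) = w" "\<forall>w\<in>W'. \<phi> (\<psi> w) = w" "\<phi> ` (M \<inter> W) = T \<inter> W'"
    using ch unfolding slice_chart_at_def by (elim exE conjE) (rule that)
  have o: "open (\<sigma> -` W)"
    using linear_continuous_on[OF assms(1), of UNIV] c(1) by (simp add: continuous_on_open_vimage[OF open_UNIV])
  have surj: "surj \<sigma>" using inv(2) by (rule surjI)
  have e: "M \<inter> \<sigma> -` W = \<sigma> -` (M \<inter> W)" using M by auto
  have im: "\<sigma> ` (\<sigma> -` W) = W" "\<sigma> ` (M \<inter> \<sigma> -` W) = M \<inter> W"
    unfolding e by (rule surj_image_vimage_eq[OF surj])+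
  have "x \<in> \<tau> ` W" if "\<sigma> x \<in> W" for x
    using imageI[OF that, of \<tau>] inv(1) by simp
  then have im': "\<tau> ` W = \<sigma> -` W" using inv(2) by auto
  have "(\<lambda>w. \<phi> (\<sigma> w)) ` (\<sigma> -` W) = W'" "(\<lambda>w. \<phi> (\<sigma> w)) ` (M \<inter> \<sigma> -` W) = T \<inter> W'"
    "(\<lambda>w. \<tau> (\<psi> w)) ` W' = \<sigma> -` W"
    using c(8,9,12) im im' image_image[of \<phi> \<sigma>] image_image[of \<tau> \<psi>] by metis+
  moreover have "smooth_on (\<sigma> -` W) (\<lambda>w. \<phi> (\<sigma> w))"
    by (rule smooth_on_compose_linear[OF c(1) o assms(1) _ c(6)]) auto
  moreover have "smooth_on W' (\<lambda>w. \<tau> (\<psi> w))"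
    by (rule smooth_on_linear[OF c(3) assms(2) c(7)])
  moreover have "\<forall>w\<in>\<sigma> -` W. \<tau> (\<psi> (\<phi> (\<sigma> w))) = w" "\<forall>w\<in>W'. \<phi> (\<sigma> (\<tau> (\<psi> w))) = w" "z \<in> \<sigma> -` W"
    using c(2,10,11) inv by simp_all
  ultimately show ?thesis
    unfolding slice_chart_at_def using c(3-5) o
    by (intro exI[of _ "\<sigma> -` W"] exI[of _ W'] exI[of _ T] exI[of _ "\<lambda>w. \<phi> (\<sigma> w)"] exI[of _ "\<lambda>w. \<tau> (\<psi> w)"] conjI)
qed

text \<open>
  The left trivialization of the jets at a point of maps to the unimodular \<open>2\<times>2\<close> matrices. A
  matrix is stored as its list of rows in \<^typ>\<open>real^4\<close>; \<open>\<Omega> $ j\<close> are the entries of the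
  coefficient matrix of the differential system in the direction \<open>j\<close>.
\<close>

definition jdet :: "real^4 \<Rightarrow> real" where "jdet v = v $ 1 * v $ 4 - v $ 2 * v $ 3"

definition jact :: "real^4 \<Rightarrow> (real^4)^2 \<Rightarrow> (real^4)^2" where
  "jact v \<Omega> = (\<chi> j. vector [\<Omega> $ j $ 1 * v $ 1 + \<Omega> $ j $ 2 * v $ 2, \<Omega> $ j $ 3 * v $ 1 + \<Omega> $ j $ 4 * v $ 2,
     \<Omega> $ j $ 1 * v $ 3 + \<Omega> $ j $ 2 * v $ 4, \<Omega> $ j $ 3 * v $ 3 + \<Omega> $ j $ 4 * v $ 4])"

definition junact :: "real^4 \<Rightarrow> (real^4)^2 \<Rightarrow> (real^4)^2" where
  "junact v D = (\<chi> j. vector [v $ 4 * D $ j $ 1 - v $ 2 * D $ j $ 3, v $ 1 * D $ j $ 3 - v $ 3 * D $ j $ 1,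
     v $ 4 * D $ j $ 2 - v $ 2 * D $ j $ 4, v $ 1 * D $ j $ 4 - v $ 3 * D $ j $ 2])"

lemma junact_jact: "junact v (jact v \<Omega>) = jdet v *\<^sub>R \<Omega>"
  by (simp add: junact_def jact_def jdet_def vec_eq_iff forall_4 algebra_simps)

lemma jact_junact: "jact v (junact v D) = jdet v *\<^sub>R D"
  by (simp add: junact_def jact_def jdet_def vec_eq_iff forall_4 algebra_simps)

lemma junact_scaleR: "junact v (c *\<^sub>R D) = c *\<^sub>R junact v D"
  by (simp add: junact_def vec_eq_iff forall_4 algebra_simps)

text \<open>
  Left multiplication by a rotation: it leaves \<open>trivial_jets\<close> invariant and makes the upper left
  entry nonzero if it was zero.
\<close>

definition jswap :: "(real^4) \<times> ((real^4)^2) \<Rightarrow> (real^4) \<times> ((real^4)^2)" where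
  "jswap z = (vector [fst z $ 3, fst z $ 4, - fst z $ 1, - fst z $ 2],
     \<chi> j. vector [snd z $ j $ 3, snd z $ j $ 4, - snd z $ j $ 1, - snd z $ j $ 2])"

definition trivial_jets :: "(real^4)^2 \<Rightarrow> ((real^4)^2) set \<Rightarrow> ((real^4) \<times> ((real^4)^2)) set" where
  "trivial_jets \<Omega>0 S = {(v, jact v (\<Omega>0 + \<omega>)) | v \<omega>. jdet v = 1 \<and> \<omega> \<in> S}"

lemma jswap: "bounded_linear jswap" "jswap (jswap z) = - z" "jswap (- z) = - jswap z"
  "jswap z \<in> trivial_jets \<Omega>0 S \<longleftrightarrow> z \<in> trivial_jets \<Omega>0 S"
proof -
  show "bounded_linear jswap"
    unfolding linear_conv_bounded_linear[symmetric]
    by (rule linearI) (simp_all add: jswap_def vec_eq_iff forall_4)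
  show 2: "jswap (jswap z) = - z" for z by (simp add: jswap_def prod_eq_iff vec_eq_iff forall_4)
  show 3: "jswap (- z) = - jswap z" for z by (simp add: jswap_def prod_eq_iff vec_eq_iff forall_4)
  have a: "jswap (v, jact v \<Omega>) = (fst (jswap (v, jact v \<Omega>)), jact (fst (jswap (v, jact v \<Omega>))) \<Omega>)"
    "jdet (fst (jswap (v, D))) = jdet v" "- (v, jact v \<Omega>) = (- v, jact (- v) \<Omega>)" "jdet (- v) = jdet v" for v \<Omega> D
    by (simp_all add: jswap_def jact_def jdet_def vec_eq_iff forall_4 algebra_simps)
  have imp: "jswap z \<in> trivial_jets \<Omega>0 S" if "z \<in> trivial_jets \<Omega>0 S" for z
    using that a(1,2) unfolding trivial_jets_def by fastforce
  have "- z \<in> trivial_jets \<Omega>0 S" if "z \<in> trivial_jets \<Omega>0 S" for z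
    using that a(3,4) unfolding trivial_jets_def by fastforce
  then show "jswap z \<in> trivial_jets \<Omega>0 S \<longleftrightarrow> z \<in> trivial_jets \<Omega>0 S"
    using imp 2[of z] minus_minus[of z] by metis
qed

text \<open>
  The chart replaces the lower right entry of the matrix by its determinant, for which one has to
  divide by the upper left entry, and the derivatives by their left translates.
\<close>

lemma slice_chart_trivial_jets:
  assumes S: "subspace S" "dim S = k" and z: "fst z $ 1 \<noteq> 0" "jdet (fst z) = 1"
  shows "slice_chart_at (3 + k) (trivial_jets \<Omega>0 S) z"
proof -
  define \<phi> :: "(real^4) \<times> ((real^4)^2) \<Rightarrow> (real^4) \<times> ((real^4)^2)" where
    "\<phi> z = (vector [fst z $ 1, fst z $ 2, fst z $ 3, jdet (fst z) - 1], junact (fst z) (snd z) - \<Omega>0)" for z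
  define p where "p x = (vector [x $ 1, x $ 2, x $ 3, (1 + x $ 4 + x $ 2 * x $ 3) / x $ 1] :: real^4)" for x :: "real^4"
  define \<psi> :: "(real^4) \<times> ((real^4)^2) \<Rightarrow> (real^4) \<times> ((real^4)^2)" where
    "\<psi> y = (p (fst y), inverse (1 + fst y $ 4) *\<^sub>R jact (p (fst y)) (\<Omega>0 + snd y))" for y
  define W where "W = {z :: (real^4) \<times> ((real^4)^2). fst z $ 1 \<noteq> 0 \<and> jdet (fst z) \<noteq> 0}"
  define W' where "W' = {y :: (real^4) \<times> ((real^4)^2). fst y $ 1 \<noteq> 0 \<and> 1 + fst y $ 4 \<noteq> 0}"
  define T where "T = {x :: real^4. axis 4 1 \<bullet> x = 0} \<times> S"
  have coord: "smooth_on A (\<lambda>z. fst z $ i)" "smooth_on A (\<lambda>z. snd z $ j $ i)" if "open A"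
    for A :: "((real^4) \<times> ((real^4)^2)) set" and i j
    by (intro smooth_on_vec_nth that smooth_on_linear[OF that bounded_linear_fst smooth_on_ident[OF that]]
        smooth_on_linear[OF that bounded_linear_snd smooth_on_ident[OF that]])+
  have c: "continuous_on UNIV (\<lambda>z :: (real^4) \<times> ((real^4)^2). fst z $ 1)"
    "continuous_on UNIV (\<lambda>z :: (real^4) \<times> ((real^4)^2). jdet (fst z))"
    "continuous_on UNIV (\<lambda>z :: (real^4) \<times> ((real^4)^2). 1 + fst z $ 4)"
    unfolding jdet_def by (intro continuous_intros)+
  have oW: "open W" "open W'"
    unfolding W_def W'_def by (intro open_Collect_conj open_Collect_neq c continuous_on_const)+
  have sm_jact: "smooth_on A (\<lambda>z. jact (f z) (h z))"
    if "open A" "\<And>i. smooth_on A (\<lambda>z. f z $ i)" "\<And>j i. smooth_on A (\<lambda>z. h z $ j $ i)"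
    for A :: "((real^4) \<times> ((real^4)^2)) set" and f h
  proof (intro smooth_on_vec that(1))
    have "\<forall>i. smooth_on A (\<lambda>z. jact (f z) (h z) $ j $ i)" for j
      unfolding forall_4 jact_def by (simp; intro conjI smooth_on_add smooth_on_mult that)
    then show "smooth_on A (\<lambda>z. jact (f z) (h z) $ j $ i)" for i j by blast
  qed
  have smphi: "smooth_on W \<phi>"
    unfolding \<phi>_def
  proof (intro smooth_on_Pair smooth_on_diff smooth_on_const oW smooth_on_vec)
    have "\<forall>i. smooth_on W (\<lambda>z. (vector [fst z $ 1, fst z $ 2, fst z $ 3, jdet (fst z) - 1] :: real^4) $ i)"
      unfolding forall_4 jdet_def by (simp; intro conjI smooth_intros coord oW)
    then show "smooth_on W (\<lambda>z. (vector [fst z $ 1, fst z $ 2, fst z $ 3, jdet (fst z) - 1] :: real^4) $ i)" for i by blast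
    have "\<forall>i. smooth_on W (\<lambda>z. junact (fst z) (snd z) $ j $ i)" for j
      unfolding forall_4 junact_def by (simp; intro conjI smooth_on_diff smooth_on_mult coord oW)
    then show "smooth_on W (\<lambda>z. junact (fst z) (snd z) $ j $ i)" for j i by blast
  qed
  have smpsi: "smooth_on W' \<psi>"
  proof -
    have "\<forall>i. smooth_on W' (\<lambda>y. p (fst y) $ i)"
      unfolding forall_4 p_def
      by (simp; intro conjI smooth_on_divide smooth_on_add smooth_on_mult smooth_on_const coord oW)
        (simp add: W'_def)
    then have sp: "smooth_on W' (\<lambda>y. p (fst y) $ i)" for i by blast
    have "smooth_on W' (\<lambda>y. inverse (1 + fst y $ 4))"
      by (intro smooth_on_inverse smooth_on_add smooth_on_const coord oW) (simp add: W'_def)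
    moreover have "smooth_on W' (\<lambda>y. jact (p (fst y)) (\<Omega>0 + snd y))"
      by (intro sm_jact oW sp) (simp, intro smooth_on_add smooth_on_const coord oW)
    ultimately show ?thesis
      unfolding \<psi>_def
      by (intro smooth_on_Pair smooth_on_bilinear[OF _ bounded_bilinear_scaleR] smooth_on_vec[OF oW(2) sp] oW)
  qed
  have \<psi>\<phi>: "\<psi> (\<phi> z) = z" if "z \<in> W" for z
  proof -
    have "p (fst (\<phi> z)) = fst z"
      using that by (simp add: \<phi>_def p_def W_def jdet_def vec_eq_iff forall_4)
    then show ?thesis
      using that by (simp add: \<psi>_def) (simp add: \<phi>_def jact_junact W_def prod_eq_iff)
  qed
  have jp: "jdet (p x) = 1 + x $ 4" if "x $ 1 \<noteq> 0" for x
    using that by (simp add: jdet_def p_def)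
  have \<phi>\<psi>: "\<phi> (\<psi> y) = y" if "y \<in> W'" for y
    using that
    by (simp add: \<phi>_def \<psi>_def W'_def jp junact_scaleR junact_jact prod_eq_iff)
      (simp add: p_def vec_eq_iff forall_4)
  have mem: "\<phi> z \<in> W'" if "z \<in> W" for z
    using that by (simp add: W_def W'_def \<phi>_def)
  have mem': "\<psi> y \<in> W" if "y \<in> W'" for y
    using that jp[of "fst y"] by (simp add: W_def W'_def \<psi>_def) (simp add: p_def)
  have im: "\<phi> ` W = W'" "\<psi> ` W' = W"
    using mem mem' \<phi>\<psi> \<psi>\<phi> by (auto simp: image_iff) (metis)+
  have imT: "\<phi> ` (trivial_jets \<Omega>0 S \<inter> W) = T \<inter> W'"
  proof (intro equalityI subsetI)
    fix y assume "y \<in> \<phi> ` (trivial_jets \<Omega>0 S \<inter> W)"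
    then obtain v \<omega> where "y = \<phi> (v, jact v (\<Omega>0 + \<omega>))" "jdet v = 1" "\<omega> \<in> S" "(v, jact v (\<Omega>0 + \<omega>)) \<in> W"
      unfolding trivial_jets_def by blast
    then show "y \<in> T \<inter> W'"
      using mem[of "(v, jact v (\<Omega>0 + \<omega>))"] by (simp add: \<phi>_def T_def junact_jact inner_axis')
  next
    fix y assume y: "y \<in> T \<inter> W'"
    then have "\<psi> y \<in> trivial_jets \<Omega>0 S"
      using jp[of "fst y"] by (auto simp: trivial_jets_def \<psi>_def T_def W'_def inner_axis')
    then show "y \<in> \<phi> ` (trivial_jets \<Omega>0 S \<inter> W)"
      using \<phi>\<psi>[of y] mem'[of y] y by (metis IntD2 IntI imageI)
  qed
  have T: "subspace T" "dim T = 3 + k"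
    unfolding T_def using S
    by (simp_all add: subspace_Times subspace_hyperplane dim_Times dim_hyperplane)
  have "z \<in> W" using z by (simp add: W_def)
  then show ?thesis
    unfolding slice_chart_at_def using oW T smphi smpsi im imT \<psi>\<phi> \<phi>\<psi>
    by (intro exI[of _ W] exI[of _ W'] exI[of _ T] exI[of _ \<phi>] exI[of _ \<psi>] conjI ballI)
qed

lemma trivial_jets_submanifold:
  assumes S: "subspace S" "dim S = k"
  shows "embedded_submanifold (3 + k) (trivial_jets \<Omega>0 S)"
  unfolding embedded_submanifold_iff
proof
  fix z assume z: "z \<in> trivial_jets \<Omega>0 S"
  have det: "jdet (fst w) = 1" if "w \<in> trivial_jets \<Omega>0 S" for w
    using that by (auto simp: trivial_jets_def)
  show "slice_chart_at (3 + k) (trivial_jets \<Omega>0 S) z"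
  proof (cases "fst z $ 1 = 0")
    case False
    then show ?thesis using slice_chart_trivial_jets[OF S] det[OF z] by blast
  next
    case True
    have "fst (jswap z) $ 1 \<noteq> 0"
      using True det[OF z] by (auto simp: jswap_def jdet_def)
    then have "slice_chart_at (3 + k) (trivial_jets \<Omega>0 S) (jswap z)"
      using slice_chart_trivial_jets[OF S] det jswap(4) z by blast
    then show ?thesis
      by (rule slice_chart_at_linear[of jswap "\<lambda>w. - jswap w", rotated -1])
        (simp_all add: jswap bounded_linear_minus)
  qed
qed

text \<open>
  In a slice chart the submanifold is an open subset of a linear space of the same dimension as
  the target of \<open>\<pi>\<close>, so invariance of domain applies.
\<close>

lemma embedded_submanifold_image_open:
  fixes M :: "'a::euclidean_space set" and \<pi> :: "'a \<Rightarrow> 'b::euclidean_space"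
  assumes M: "embedded_submanifold DIM('b) M" and z: "z \<in> M" "z \<in> O'" and O': "open O'"
    and cont: "continuous_on O' \<pi>" and inj: "inj_on \<pi> (M \<inter> O')"
  obtains e where "e > 0" "ball (\<pi> z) e \<subseteq> \<pi> ` (M \<inter> O')"
proof -
  have "slice_chart_at DIM('b) M z" using M z(1) unfolding embedded_submanifold_iff by (rule bspec)
  then obtain W W' T and \<phi> \<psi> :: "'a \<Rightarrow> 'a" where c: "open W" "z \<in> W" "open W'" "subspace T" "dim T = DIM('b)"
    "smooth_on W \<phi>" "smooth_on W' \<psi>" "\<phi> ` W = W'" "\<psi> ` W' = W"
    "\<forall>w\<in>W. \<psi> (\<phi> w) = w" "\<forall>w\<in>W'. \<phi> (\<psi> w) = w" "\<phi> ` (M \<inter> W) = T \<inter> W'"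
    unfolding slice_chart_at_def by (elim exE conjE) (rule that)
  define S where "S = T \<inter> (W' \<inter> \<psi> -` O')"
  have contpsi: "continuous_on W' \<psi>" using smooth_on_continuous[OF c(7)] .
  have "openin (top_of_set T) S"
    unfolding S_def using continuous_open_preimage[OF contpsi c(3) O'] by (simp add: openin_open_Int)
  have SM: "\<psi> y \<in> M \<inter> O'" if "y \<in> S" for y
  proof -
    have "y \<in> \<phi> ` (M \<inter> W)" using that c(12) by (auto simp: S_def)
    then show ?thesis using c(10) that by (auto simp: S_def)
  qed
  have "openin (top_of_set UNIV) ((\<lambda>y. \<pi> (\<psi> y)) ` S)"
  proof (rule invariance_of_domain_subspaces[OF \<open>openin (top_of_set T) S\<close> c(4) subspace_UNIV])
    show "dim (UNIV :: 'b set) \<le> dim T" using c(5) by simp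
    show "continuous_on S (\<lambda>y. \<pi> (\<psi> y))"
      by (rule continuous_on_compose2[OF cont continuous_on_subset[OF contpsi]]) (auto simp: S_def)
    show "(\<lambda>y. \<pi> (\<psi> y)) \<in> S \<rightarrow> UNIV" by simp
    show "inj_on (\<lambda>y. \<pi> (\<psi> y)) S"
    proof (rule inj_onI)
      fix y y' assume y: "y \<in> S" "y' \<in> S" "\<pi> (\<psi> y) = \<pi> (\<psi> y')"
      then have "\<psi> y = \<psi> y'" using inj SM by (auto dest: inj_onD)
      then show "y = y'" using c(11) y by (metis IntD1 IntD2 S_def)
    qed
  qed
  then have "open ((\<lambda>y. \<pi> (\<psi> y)) ` S)" by simp
  moreover have "\<phi> z \<in> S" "\<psi> (\<phi> z) = z" using c z by (auto simp: S_def)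
  then have "\<pi> z \<in> (\<lambda>y. \<pi> (\<psi> y)) ` S" by (metis imageI)
  ultimately obtain e where "e > 0" "ball (\<pi> z) e \<subseteq> (\<lambda>y. \<pi> (\<psi> y)) ` S"
    using open_contains_ball by blast
  moreover have "(\<lambda>y. \<pi> (\<psi> y)) ` S \<subseteq> \<pi> ` (M \<inter> O')" using SM by blast
  ultimately show thesis using that by blast
qed

section \<open>Dimension five\<close>

context riemannian_domain
begin

definition jet_base :: "real^2 \<Rightarrow> (real^4)^2" where
  "jet_base s = vector [
     vector [tr1 s / 2 - \<Gamma> 1 1 1 s, - \<Gamma> 1 1 2 s, - \<Gamma> 2 1 1 s, tr1 s / 2 - \<Gamma> 2 1 2 s],
     vector [tr2 s / 2 - \<Gamma> 1 1 2 s, - \<Gamma> 1 2 2 s, - \<Gamma> 2 1 2 s, tr2 s / 2 - \<Gamma> 2 2 2 s]]"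

definition jet_dir :: "real^2 \<Rightarrow> real^2 \<Rightarrow> (real^4)^2" where
  "jet_dir s u = vector [
     vector [u $ 1 * g11 s - (g11 s * u $ 1 + g12 s * u $ 2) / 2, u $ 1 * g12 s,
             u $ 2 * g11 s, u $ 2 * g12 s - (g11 s * u $ 1 + g12 s * u $ 2) / 2],
     vector [u $ 1 * g12 s - (g12 s * u $ 1 + g22 s * u $ 2) / 2, u $ 1 * g22 s,
             u $ 2 * g12 s, u $ 2 * g22 s - (g12 s * u $ 1 + g22 s * u $ 2) / 2]]"

lemma integral_jet_trivialization: "integral_jet s v u = (v, jact v (jet_base s + jet_dir s u))"
  unfolding integral_jet_def jact_def jet_base_def jet_dir_def slope11_def slope12_def slope21_def slope22_def
  by (simp add: vec_eq_iff forall_2 forall_4 field_simps)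

lemma range_jet_dir:
  assumes s: "s \<in> U"
  shows "subspace (range (jet_dir s))" "dim (range (jet_dir s)) = 2"
proof -
  have lin: "linear (jet_dir s)"
    by (rule linearI) (simp_all add: jet_dir_def vec_eq_iff forall_2 forall_4 algebra_simps add_divide_distrib)
  have "inj (jet_dir s)"
  proof (rule linear_injective_0[OF lin, THEN iffD2], intro allI impI)
    fix u assume "jet_dir s u = 0"
    then have "jet_dir s u $ 2 $ 2 = 0" "jet_dir s u $ 1 $ 3 = 0" by simp_all
    then show "u = 0" using g_diag_pos[OF s] by (simp add: jet_dir_def vec_eq_iff forall_2)
  qed
  then show "dim (range (jet_dir s)) = 2"
    using dim_image_eq[OF lin, of UNIV] by simp
  show "subspace (range (jet_dir s))"
    using lin by (simp add: linear_subspace_image)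
qed

proposition constant_curvature_imp_dim_5:
  assumes V: "open V" "s0 \<in> V" "V \<subseteq> U" and K: "\<And>s. s \<in> V \<Longrightarrow> K s = c"
  shows "embedded_submanifold 5 (integral_jets U g s0)"
proof -
  have s0: "s0 \<in> U" using V by blast
  have "integral_jets U g s0 = trivial_jets (jet_base s0) (range (jet_dir s0))"
  proof (intro equalityI subsetI)
    fix z assume "z \<in> integral_jets U g s0"
    then obtain v u where "z = integral_jet s0 v u" "v $ 1 * v $ 4 - v $ 2 * v $ 3 = 1"
      by (rule integral_jetsD)
    then show "z \<in> trivial_jets (jet_base s0) (range (jet_dir s0))"
      unfolding trivial_jets_def integral_jet_trivialization jdet_def by blast
  next
    fix z assume "z \<in> trivial_jets (jet_base s0) (range (jet_dir s0))"
    then obtain v u where "z = integral_jet s0 v u" "v $ 1 * v $ 4 - v $ 2 * v $ 3 = 1"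
      unfolding trivial_jets_def integral_jet_trivialization jdet_def by blast
    then show "z \<in> integral_jets U g s0"
      using integral_jet_in_integral_jets[OF V K] by simp
  qed
  then show ?thesis
    using trivial_jets_submanifold[OF range_jet_dir[OF s0], of "jet_base s0"] by simp
qed

text \<open>
  A jet of an integral is determined by its dual vector and by three suitable entries of the
  unimodular matrix, so these five numbers map the jets onto a neighbourhood of each of their
  values.
\<close>

lemma jet_dual_values_open:
  assumes s0: "s0 \<in> U" and M: "embedded_submanifold 5 (integral_jets U g s0)" and z0: "z0 \<in> integral_jets U g s0"
  obtains e where "e > 0" "ball (jet_dual s0 z0) e \<subseteq> jet_dual s0 ` integral_jets U g s0"
proof -
  let ?J = "integral_jets U g s0"
  have J: "jdet (fst z) = 1" "z = integral_jet s0 (fst z) (jet_dual s0 z)" if z: "z \<in> ?J" for z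
  proof -
    obtain v u where "z = integral_jet s0 v u" "v $ 1 * v $ 4 - v $ 2 * v $ 3 = 1"
      using z by (rule integral_jetsD)
    then show "jdet (fst z) = 1" "z = integral_jet s0 (fst z) (jet_dual s0 z)"
      using jet_dual_integral_jet[OF s0, of v u] by (simp_all add: jdet_def integral_jet_def)
  qed
  have cont: "continuous_on A (jet_dual s0)" for A
  proof -
    have "\<forall>i. continuous_on A (\<lambda>z. jet_dual s0 z $ i)"
      unfolding forall_2 jet_dual_def vector_2 using g_diag_pos[OF s0]
      by (intro conjI continuous_intros) auto
    then show ?thesis
      using continuous_on_vec_lambda[of A "\<lambda>i z. jet_dual s0 z $ i"] by simp
  qed
  \<comment> \<open>Which entry is a function of the others depends on which entry in the first column is nonzero.\<close>
  have "\<exists>i1 i2 i3 O'. open O' \<and> z0 \<in> O' \<and>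
    (\<forall>v w :: real^4. (\<exists>D. (v, D) \<in> O') \<longrightarrow> (\<exists>D. (w, D) \<in> O') \<longrightarrow> jdet v = 1 \<longrightarrow> jdet w = 1 \<longrightarrow>
      v $ i1 = w $ i1 \<longrightarrow> v $ i2 = w $ i2 \<longrightarrow> v $ i3 = w $ i3 \<longrightarrow> v = w)"
  proof -
    have o: "open {z :: (real^4) \<times> ((real^4)^2). fst z $ i \<noteq> 0}" for i
      by (intro open_Collect_neq continuous_intros)
    have solve: "x = y" if "a \<noteq> 0" "a * x - b = 1" "a * y - b = 1" for a b x y :: real
      using that by (metis diff_add_cancel mult_left_cancel)
    have solve': "x = y" if "a \<noteq> 0" "b - x * a = 1" "b - y * a = 1" for a b x y :: real
    proof -
      have "a * (x - y) = 0" using that(2,3) by algebra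
      then show ?thesis using that(1) by simp
    qed
    show ?thesis
    proof (cases "fst z0 $ 1 = 0")
      case False
      then show ?thesis
        by (rule_tac exI[of _ 1], rule_tac exI[of _ 2], rule_tac exI[of _ 3], rule_tac exI[of _ "{z. fst z $ 1 \<noteq> 0}"])
          (auto simp: o jdet_def vec_eq_iff forall_4 intro: solve)
    next
      case True
      then have "fst z0 $ 3 \<noteq> 0" using J(1)[OF z0] by (auto simp: jdet_def)
      then show ?thesis
        by (rule_tac exI[of _ 1], rule_tac exI[of _ 3], rule_tac exI[of _ 4], rule_tac exI[of _ "{z. fst z $ 3 \<noteq> 0}"])
          (auto simp: o jdet_def vec_eq_iff forall_4 intro: solve')
    qed
  qed
  then obtain i1 i2 i3 O' where O': "open O'" "z0 \<in> O'" and det: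
    "\<forall>v w :: real^4. (\<exists>D. (v, D) \<in> O') \<longrightarrow> (\<exists>D. (w, D) \<in> O') \<longrightarrow> jdet v = 1 \<longrightarrow> jdet w = 1 \<longrightarrow>
      v $ i1 = w $ i1 \<longrightarrow> v $ i2 = w $ i2 \<longrightarrow> v $ i3 = w $ i3 \<longrightarrow> v = w"
    by (elim exE conjE) (rule that)
  define \<pi> :: "(real^4) \<times> ((real^4)^2) \<Rightarrow> (real^3) \<times> (real^2)" where
    "\<pi> z = (\<chi> j. fst z $ (if j = 1 then i1 else if j = 2 then i2 else i3), jet_dual s0 z)" for z
  have cont_pi: "continuous_on O' \<pi>"
    unfolding \<pi>_def by (intro continuous_intros cont)
  have inj_pi: "inj_on \<pi> (?J \<inter> O')"
  proof (rule inj_onI)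
    fix z w assume z: "z \<in> ?J \<inter> O'" and w: "w \<in> ?J \<inter> O'" and e: "\<pi> z = \<pi> w"
    have "fst z $ i1 = fst w $ i1 \<and> fst z $ i2 = fst w $ i2 \<and> fst z $ i3 = fst w $ i3"
      using e by (simp add: \<pi>_def vec_eq_iff forall_3)
    moreover have "(fst z, snd z) \<in> O'" "(fst w, snd w) \<in> O'" using z w by simp_all
    ultimately have "fst z = fst w"
      using det J(1) z w by blast
    moreover have "jet_dual s0 z = jet_dual s0 w" using e by (simp add: \<pi>_def)
    ultimately show "z = w" using J(2) z w by (metis IntD1)
  qed
  have "embedded_submanifold DIM((real^3) \<times> (real^2)) ?J" using M by simp
  then obtain e where e: "e > 0" "ball (\<pi> z0) e \<subseteq> \<pi> ` (?J \<inter> O')"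
    by (rule embedded_submanifold_image_open[OF _ z0 O'(2,1) cont_pi inj_pi])
  show thesis
  proof (rule that[OF e(1)])
    show "ball (jet_dual s0 z0) e \<subseteq> jet_dual s0 ` ?J"
    proof
      fix u assume "u \<in> ball (jet_dual s0 z0) e"
      then have "(fst (\<pi> z0), u) \<in> ball (\<pi> z0) e"
        by (simp add: dist_Pair_Pair \<pi>_def)
      then have "(fst (\<pi> z0), u) \<in> \<pi> ` (?J \<inter> O')" using e(2) by blast
      then show "u \<in> jet_dual s0 ` ?J" by (auto simp: \<pi>_def)
    qed
  qed
qed

text \<open>
  Four dual vectors near each other in the position that \<open>curvature_locally_constant\<close> requires are
  \<open>u0\<close> and its translates by \<open>h\<close> times \<open>(1, 0)\<close>, \<open>(0, 1)\<close> and \<open>(- 1, - 1)\<close>. The metric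
  maps vectors to covectors with positive determinant, so it preserves their position.
\<close>

proposition dim_5_imp_constant_curvature:
  assumes s0: "s0 \<in> U" and M: "embedded_submanifold 5 (integral_jets U g s0)" and ne: "integral_jets U g s0 \<noteq> {}"
  shows "\<exists>W c. open W \<and> s0 \<in> W \<and> W \<subseteq> U \<and> (\<forall>s\<in>W. K s = c)"
proof -
  obtain z0 where z0: "z0 \<in> integral_jets U g s0" using ne by blast
  define u0 where "u0 = jet_dual s0 z0"
  obtain e where e: "e > 0" "ball u0 e \<subseteq> jet_dual s0 ` integral_jets U g s0"
    unfolding u0_def by (rule jet_dual_values_open[OF s0 M z0])
  have form: "\<exists>V b1 b2. open V \<and> s0 \<in> V \<and> V \<subseteq> U \<and> integral_form V b1 b2 \<and>
      b1 s0 = g11 s0 * u $ 1 + g12 s0 * u $ 2 \<and> b2 s0 = g12 s0 * u $ 1 + g22 s0 * u $ 2"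
    if u: "u \<in> ball u0 e" for u
  proof -
    obtain z where z: "z \<in> integral_jets U g s0" "u = jet_dual s0 z" using e u by blast
    obtain v u' V b1 b2 where *: "z = integral_jet s0 v u'" "v $ 1 * v $ 4 - v $ 2 * v $ 3 = 1"
      "open V" "s0 \<in> V" "V \<subseteq> U" "integral_form V b1 b2"
      "b1 s0 = g11 s0 * u' $ 1 + g12 s0 * u' $ 2" "b2 s0 = g12 s0 * u' $ 1 + g22 s0 * u' $ 2"
      using z(1) by (rule integral_jetsD)
    then have "u' = u" using jet_dual_integral_jet[OF s0] z(2) by simp
    with * show ?thesis by blast
  qed
  define t where "t = e / 2"
  have t: "t > 0" using e by (simp add: t_def)
  define d :: "real \<Rightarrow> real \<Rightarrow> real^2" where "d x y = vector [x, y]" for x y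
  have near: "u0 + (t / 2) *\<^sub>R d x y \<in> ball u0 e" if "\<bar>x\<bar> \<le> 1" "\<bar>y\<bar> \<le> 1" for x y
  proof -
    have "norm (d x y) \<le> (\<Sum>i\<in>UNIV. \<bar>d x y $ i\<bar>)" by (rule norm_le_l1_cart)
    also have "\<dots> \<le> 2" using that by (simp add: sum_2 d_def)
    finally have "norm (d x y) \<le> 2" .
    then have "t / 2 * norm (d x y) \<le> t" using t by (simp add: field_simps)
    then show ?thesis using t e by (simp add: dist_norm t_def)
  qed
  have near0: "u0 \<in> ball u0 e" using e by simp
  obtain V0 x0 y0 where f0: "open V0" "s0 \<in> V0" "V0 \<subseteq> U" "integral_form V0 x0 y0"
    "x0 s0 = g11 s0 * u0 $ 1 + g12 s0 * u0 $ 2" "y0 s0 = g12 s0 * u0 $ 1 + g22 s0 * u0 $ 2"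
    using form[OF near0] by (elim exE conjE) (rule that)
  define h where "h = t / 2"
  have h: "h > 0" using t by (simp add: h_def)
  obtain V1 x1 y1 where f1: "open V1" "s0 \<in> V1" "V1 \<subseteq> U" "integral_form V1 x1 y1"
    "x1 s0 = g11 s0 * (u0 $ 1 + h) + g12 s0 * u0 $ 2" "y1 s0 = g12 s0 * (u0 $ 1 + h) + g22 s0 * u0 $ 2"
    using form[OF near[of 1 0]] by (simp add: d_def flip: h_def) (elim exE conjE, rule that)
  obtain V2 x2 y2 where f2: "open V2" "s0 \<in> V2" "V2 \<subseteq> U" "integral_form V2 x2 y2"
    "x2 s0 = g11 s0 * u0 $ 1 + g12 s0 * (u0 $ 2 + h)" "y2 s0 = g12 s0 * u0 $ 1 + g22 s0 * (u0 $ 2 + h)"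
    using form[OF near[of 0 1]] by (simp add: d_def flip: h_def) (elim exE conjE, rule that)
  obtain V3 x3 y3 where f3: "open V3" "s0 \<in> V3" "V3 \<subseteq> U" "integral_form V3 x3 y3"
    "x3 s0 = g11 s0 * (u0 $ 1 - h) + g12 s0 * (u0 $ 2 - h)" "y3 s0 = g12 s0 * (u0 $ 1 - h) + g22 s0 * (u0 $ 2 - h)"
    using form[OF near[of "-1" "-1"]] by (simp add: d_def flip: h_def) (elim exE conjE, rule that)
  let ?V = "V0 \<inter> V1 \<inter> V2 \<inter> V3"
  have pos: "h * h * dg s0 > 0" using h dg_pos[OF s0] by simp
  have span: "(x1 s0 - x0 s0) * (y2 s0 - y0 s0) - (x2 s0 - x0 s0) * (y1 s0 - y0 s0) = h * h * dg s0"
    "(x2 s0 - x0 s0) * (y3 s0 - y0 s0) - (x3 s0 - x0 s0) * (y2 s0 - y0 s0) = h * h * dg s0"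
    "(x3 s0 - x0 s0) * (y1 s0 - y0 s0) - (x1 s0 - x0 s0) * (y3 s0 - y0 s0) = h * h * dg s0"
    unfolding f0(5,6) f1(5,6) f2(5,6) f3(5,6) dg_def by algebra+
  show ?thesis
  proof (rule curvature_locally_constant)
    show "open ?V" "?V \<subseteq> U" "s0 \<in> ?V" using f0 f1 f2 f3 by auto
    show "integral_form ?V x0 y0" "integral_form ?V x1 y1" "integral_form ?V x2 y2" "integral_form ?V x3 y3"
      by (rule integral_form_subset[OF f0(4)] integral_form_subset[OF f1(4)] integral_form_subset[OF f2(4)]
        integral_form_subset[OF f3(4)], blast)+
  qed (use span pos in simp_all)
qed

lemma integral_jets_nonempty:
  assumes V: "open V" "s0 \<in> V" "V \<subseteq> U" and I: "fractional_linear_integral_on V g A B C E"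
  shows "integral_jets U g s0 \<noteq> {}"
proof -
  obtain W \<rho> \<epsilon> where W: "open W" "s0 \<in> W" "W \<subseteq> V"
    "fractional_linear_integral_on W g (\<lambda>t. \<epsilon> * (\<rho> t * A t)) (\<lambda>t. \<epsilon> * (\<rho> t * B t)) (\<lambda>t. \<rho> t * C t) (\<lambda>t. \<rho> t * E t)"
    "normalized_on W (\<lambda>t. \<epsilon> * (\<rho> t * A t)) (\<lambda>t. \<epsilon> * (\<rho> t * B t)) (\<lambda>t. \<rho> t * C t) (\<lambda>t. \<rho> t * E t)"
    by (rule normalized_integral_exists[OF V I]) blast
  then have "W \<subseteq> U" using V by blast
  with W show ?thesis unfolding integral_jets_def by blast
qed

end

theorem theorem9:
  fixes U :: "(real^2) set" and g :: "real^2 \<Rightarrow> real^2^2" and s\<^sub>0 :: "real^2"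
  assumes "open U" and "s\<^sub>0 \<in> U" and "riemannian_metric_on U g"
    and "\<exists>V A B C E. open V \<and> s\<^sub>0 \<in> V \<and> V \<subseteq> U \<and> fractional_linear_integral_on V g A B C E"
  shows "integrals_have_dim U g s\<^sub>0 5 \<longleftrightarrow>
    (\<exists>V c. open V \<and> s\<^sub>0 \<in> V \<and> V \<subseteq> U \<and> (\<forall>s\<in>V. gaussian_curvature g s = c))"
proof -
  interpret riemannian_domain U g
    using assms by unfold_locales
  have "integral_jets U g s\<^sub>0 \<noteq> {}"
    using assms(4) integral_jets_nonempty by blast
  then show ?thesis
    unfolding integrals_have_dim_def
    using dim_5_imp_constant_curvature[OF assms(2)] constant_curvature_imp_dim_5 by blast
qed

end
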